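(* Let $s\ge2$ and $G=\mathsf P'_{8\cdot3^s}$. The integral cohomology ring $H^\bullet(G;\mathbb Z)$ (trivial coefficients, cup product) is isomorphic as a graded ring to $\mathbb Z[x,y]\big/\big(3^sx,\ 8\cdot3^sy,\ x^2-8y\big)$, where $x$ has degree $2$ and $y$ has degree $4$.
   Context: $G=\mathsf P'_{8\cdot3^s}=\langle p,q,z\mid p^2=(pq)^2=q^2,\ zpz^{-1}=q,\ zqz^{-1}=pq,\ z^{3^s}=1\rangle$. *)

theory Defs
  imports "HOL-Algebra.Algebra" "HOL-Library.Poly_Mapping" "HOL-Library.Product_Plus"
begin

section \<open>Integral group cohomology via inhomogeneous (bar) cochains, trivial coefficients\<close>

definition cochains :: "('a, 'b) monoid_scheme \<Rightarrow> nat \<Rightarrow> ('a list \<Rightarrow> int) set" where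
  "cochains G n = {f. \<forall>gs. f gs \<noteq> 0 \<longrightarrow> length gs = n \<and> set gs \<subseteq> carrier G}"

text \<open>Merge entries i and i+1 (1-indexed i) of a list by the group product.\<close>
definition merge_at :: "('a, 'b) monoid_scheme \<Rightarrow> nat \<Rightarrow> 'a list \<Rightarrow> 'a list" where
  "merge_at G i gs = take (i - 1) gs @ [(gs ! (i - 1)) \<otimes>\<^bsub>G\<^esub> (gs ! i)] @ drop (i + 1) gs"

definition cobound :: "('a, 'b) monoid_scheme \<Rightarrow> nat \<Rightarrow> ('a list \<Rightarrow> int) \<Rightarrow> ('a list \<Rightarrow> int)" where
  "cobound G n f gs =
     (if length gs = Suc n \<and> set gs \<subseteq> carrier G then
        f (tl gs) + (\<Sum>i = 1..n. (-1) ^ i * f (merge_at G i gs)) + (-1) ^ (Suc n) * f (butlast gs)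
      else 0)"

definition cocycles :: "('a, 'b) monoid_scheme \<Rightarrow> nat \<Rightarrow> ('a list \<Rightarrow> int) set" where
  "cocycles G n = {f \<in> cochains G n. cobound G n f = (\<lambda>_. 0)}"

definition coboundaries :: "('a, 'b) monoid_scheme \<Rightarrow> nat \<Rightarrow> ('a list \<Rightarrow> int) set" where
  "coboundaries G n = (case n of 0 \<Rightarrow> {\<lambda>_. 0} | Suc m \<Rightarrow> cobound G m ` cochains G m)"

definition cup :: "nat \<Rightarrow> nat \<Rightarrow> ('a list \<Rightarrow> int) \<Rightarrow> ('a list \<Rightarrow> int) \<Rightarrow> ('a list \<Rightarrow> int)" where
  "cup p q f g gs = (if length gs = p + q then f (take p gs) * g (drop p gs) else 0)"

definition cunit :: "'a list \<Rightarrow> int" where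
  "cunit gs = (if gs = [] then 1 else 0)"

fun cup_power :: "nat \<Rightarrow> ('a list \<Rightarrow> int) \<Rightarrow> nat \<Rightarrow> ('a list \<Rightarrow> int)" where
  "cup_power d x 0 = cunit"
| "cup_power d x (Suc a) = cup d (d * a) x (cup_power d x a)"

text \<open>Polynomials in two variables X, Y: finitely supported maps from exponent pairs (a,b)
(monomial X^a Y^b) to integer coefficients; multiplication is convolution.\<close>
type_synonym poly2 = "(nat \<times> nat) \<Rightarrow>\<^sub>0 int"

definition varX :: poly2 where "varX = Poly_Mapping.single (1, 0) 1"
definition varY :: poly2 where "varY = Poly_Mapping.single (0, 1) 1"

definition wdeg :: "nat \<times> nat \<Rightarrow> nat" where
  "wdeg m = 2 * fst m + 4 * snd m"

definition homogeneous :: "nat \<Rightarrow> poly2 \<Rightarrow> bool" where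
  "homogeneous n P \<longleftrightarrow> (\<forall>m \<in> Poly_Mapping.keys P. wdeg m = n)"

definition eval_deg :: "nat \<Rightarrow> ('a list \<Rightarrow> int) \<Rightarrow> ('a list \<Rightarrow> int) \<Rightarrow> poly2 \<Rightarrow> ('a list \<Rightarrow> int)" where
  "eval_deg n x y P = (\<lambda>gs. \<Sum>m \<in> {m \<in> Poly_Mapping.keys P. wdeg m = n}.
      Poly_Mapping.lookup P m * cup (2 * fst m) (4 * snd m) (cup_power 2 x (fst m)) (cup_power 4 y (snd m)) gs)"

definition in_ideal :: "nat \<Rightarrow> poly2 \<Rightarrow> bool" where
  "in_ideal s P \<longleftrightarrow> (\<exists>A B C. P = of_nat (3 ^ s) * varX * A + of_nat (8 * 3 ^ s) * varY * B
                                   + (varX ^ 2 - 8 * varY) * C)"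

end

(*
The group is Q x| C with Q = <p, q> quaternion and C = <z> cyclic of order 3^s. The homogeneous cochains E n of G form an
acyclic complex of free modules over G, and the invariants of E under a subgroup H compute the cohomology of H. Both C and Q have
periodic resolutions, of period 2 and 4: chasing a cocycle through the exact sequences
0 -> E^C -> E -> E -> E^C -> 0 and 0 -> E^Q -> E -> E^2 -> E^2 -> E -> E^Q -> 0 shows that H^n(C) -> H^(n+2)(C) and
H^n(Q) -> H^(n+4)(Q) are given by the cup product with one class. Summing over coset representatives is a transfer from the invariants
of C or Q to those of G, and the composite with the inclusion is multiplication by 8 or by 3^s. As these numbers are coprime,
a combination y of the transfer of the class of Q and of x^2, where x in H^2(G) is the Bockstein of G -> Z/3^s,
gives isomorphisms H^n(G) -> H^(n+4)(G) for n > 0 and the surjection Z -> Z/(8 3^s) for n = 0, and can be chosen with 8y = x^2.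
It remains to know the degrees at most 3, where H^1 = H^3 = 0 and H^2 = Z/3^s is generated by x.
*)

theory Submission
  imports Defs "HOL-Library.Function_Algebras"
begin

section \<open>Homogeneous cochains\<close>

text \<open>Subgroups occur only as sets of generators whose invariants are taken in the one complex
  \<open>E\<close>, so that restriction is an inclusion. The delicate point is the restriction to Q
  of the transfer of a generator of H^4(Q): it is the sum of the conjugates of the generator under
  the powers of z, and equals 3^s times the generator because z acts trivially on H^4(Q). Since x
  restricts to 0 on Q, adding a multiple of x^2 to the transfer leaves that restriction unchanged.
  The coefficient of x^2 can therefore be an inverse of 8 modulo 3^s; as the transfer from Q is
  killed by 8 and x^2 by 3^s, this gives 8y = x^2. So y becomes a unit multiple of the periodicity
  class on Q, and 8 times y, with 8 a unit modulo 3^s, becomes the square of the periodicity class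
  on C. Degree 2 needs an argument of its own, as H^2(Q) is not zero: a class killed by 8 comes from
  a homomorphism from G to Z/8, and there is none but 0, since conjugation by z permutes p, q, pq
  cyclically and z has odd order.\<close>

primrec alt :: "'a list \<Rightarrow> ('a list \<Rightarrow> int) \<Rightarrow> int" where
  "alt [] F = 0"
| "alt (x # ys) F = F ys - alt ys (\<lambda>zs. F (x # zs))"

lemma alt_cong:
  assumes "\<And>ys. set ys \<subseteq> set xs \<Longrightarrow> F ys = H ys"
  shows "alt xs F = alt xs H"
  using assms
proof (induction xs arbitrary: F H)
  case (Cons x xs)
  have "alt xs (\<lambda>zs. F (x # zs)) = alt xs (\<lambda>zs. H (x # zs))"
    by (rule Cons.IH, rule Cons.prems) auto
  with Cons.prems[of xs] show ?case by (simp add: subset_insertI)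
qed simp

lemma alt_add: "alt xs (\<lambda>ys. F ys + H ys) = alt xs F + alt xs H"
  by (induction xs arbitrary: F H) (auto simp: algebra_simps)

lemma alt_diff: "alt xs (\<lambda>ys. F ys - H ys) = alt xs F - alt xs H"
  by (induction xs arbitrary: F H) (auto simp: algebra_simps)

lemma alt_scale: "alt xs (\<lambda>ys. c * F ys) = c * alt xs F"
  by (induction xs arbitrary: F) (auto simp: algebra_simps)

text \<open>Unfolding the first entry once on both levels makes the two copies of
  \<open>alt xs F\<close> cancel; what is left is the same statement for \<open>xs\<close> and the
  function with \<open>x\<close> prefixed.\<close>

lemma alt_alt: "alt xs (\<lambda>ys. alt ys F) = 0"
proof (induction xs arbitrary: F)
  case (Cons x xs)
  show ?case by (simp add: alt_diff Cons)
qed simp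

lemma alt_map: "alt (map f xs) F = alt xs (\<lambda>ys. F (map f ys))"
  by (induction xs arbitrary: F) auto

lemma alt_length:
  assumes "\<And>ys. F ys \<noteq> 0 \<Longrightarrow> length ys = n" and "alt xs F \<noteq> 0"
  shows "length xs = Suc n"
  using assms
proof (induction xs arbitrary: F n)
  case (Cons x xs)
  show ?case
  proof (cases "F xs = 0")
    case True
    then have nz: "alt xs (\<lambda>zs. F (x # zs)) \<noteq> 0" using Cons.prems(2) by simp
    show ?thesis
    proof (cases n)
      case 0
      then have "(\<lambda>zs. F (x # zs)) = (\<lambda>zs. 0 * F zs)" using Cons.prems(1) by fastforce
      then show ?thesis using nz alt_scale[of xs 0 F] by simp
    next
      case (Suc m)
      have "length xs = Suc m"
        by (rule Cons.IH[OF _ nz]) (use Cons.prems(1) Suc in fastforce)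
      then show ?thesis using Suc by simp
    qed
  qed (use Cons.prems(1)[of xs] in simp)
qed simp

definition sc :: "int \<Rightarrow> ('a list \<Rightarrow> int) \<Rightarrow> 'a list \<Rightarrow> int" where
  "sc c F = (\<lambda>xs. c * F xs)"

definition hcup :: "nat \<Rightarrow> ('a list \<Rightarrow> int) \<Rightarrow> ('a list \<Rightarrow> int) \<Rightarrow> 'a list \<Rightarrow> int" where
  "hcup n F H = (\<lambda>xs. F (take (Suc n) xs) * H (drop n xs))"

text \<open>Leibniz rule for the front face / back face product, in which the two faces share the
  entry at position \<open>n\<close>. The last face of the first factor and the first face of the
  second contribute the same product with opposite signs. \<open>H [] = 0\<close> makes this hold
  for lists that are too short as well.\<close>

lemma alt_hcup:
  assumes "H [] = 0"
  shows "alt xs (hcup n F H) = alt (take (Suc (Suc n)) xs) F * H (drop (Suc n) xs)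
           + (-1) ^ n * (F (take (Suc n) xs) * alt (drop n xs) H)"
proof (induction n arbitrary: F xs)
  case 0
  show ?case
  proof (cases xs)
    case (Cons x ys)
    have *: "alt ys (\<lambda>zs. F [x] * H (x # zs)) = F [x] * alt ys (\<lambda>zs. H (x # zs))"
      by (rule alt_scale)
    show ?thesis
      by (cases ys) (use assms * in \<open>auto simp: Cons hcup_def algebra_simps\<close>)
  qed simp
next
  case (Suc n)
  show ?case
  proof (cases xs)
    case (Cons x ys)
    have "(\<lambda>zs. hcup (Suc n) F H (x # zs)) = hcup n (\<lambda>zs. F (x # zs)) H"
      by (auto simp: hcup_def)
    then have "alt xs (hcup (Suc n) F H) = hcup (Suc n) F H ys - alt ys (hcup n (\<lambda>zs. F (x # zs)) H)"
      by (simp add: Cons)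
    then show ?thesis
      unfolding Suc by (simp add: Cons hcup_def algebra_simps)
  qed simp
qed

lemma sc_simps:
  "sc c (F + H) = sc c F + sc c H" "sc c (F - H) = sc c F - sc c H"
  "sc a (sc b F) = sc (a * b) F" "sc 1 F = F" "sc 0 F = 0" "sc c 0 = 0"
  "sc (a + b) F = sc a F + sc b F" "sc (a - b) F = sc a F - sc b F"
  by (auto simp: sc_def fun_eq_iff algebra_simps)

lemma hcup_simps:
  "hcup n (F + F') H = hcup n F H + hcup n F' H"
  "hcup n (F - F') H = hcup n F H - hcup n F' H"
  "hcup n F (H + H') = hcup n F H + hcup n F H'"
  "hcup n F (H - H') = hcup n F H - hcup n F H'"
  "hcup n (sc c F) H = sc c (hcup n F H)"
  "hcup n F (sc c H) = sc c (hcup n F H)"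
  "hcup n 0 H = 0" "hcup n F 0 = 0"
  by (auto simp: hcup_def sc_def fun_eq_iff algebra_simps)

lemma hcup_assoc: "hcup (n + m) (hcup n F H) K = hcup n F (hcup m H K)"
  by (auto simp: hcup_def fun_eq_iff take_drop min_def add.commute)

context group
begin

text \<open>Cochains of degree \<open>n\<close> live on tuples of length \<open>Suc n\<close> and
  are 0 elsewhere, so that equal cochains are equal as functions.\<close>

definition E :: "nat \<Rightarrow> ('a list \<Rightarrow> int) set" where
  "E n = {F. \<forall>xs. F xs \<noteq> 0 \<longrightarrow> length xs = Suc n \<and> set xs \<subseteq> carrier G}"

definition d :: "('a list \<Rightarrow> int) \<Rightarrow> 'a list \<Rightarrow> int" where
  "d F xs = (if set xs \<subseteq> carrier G then alt xs F else 0)"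

text \<open>A right action: \<open>act g (act h F) = act (h \<otimes> g) F\<close>.\<close>

definition act :: "'a \<Rightarrow> ('a list \<Rightarrow> int) \<Rightarrow> 'a list \<Rightarrow> int" where
  "act h F xs = (if set xs \<subseteq> carrier G then F (map ((\<otimes>) h) xs) else 0)"

definition contr :: "('a list \<Rightarrow> int) \<Rightarrow> 'a list \<Rightarrow> int" where
  "contr F xs = (if set xs \<subseteq> carrier G \<and> xs \<noteq> [] then F (\<one> # xs) else 0)"

lemma E_I: "(\<And>xs. F xs \<noteq> 0 \<Longrightarrow> length xs = Suc n \<and> set xs \<subseteq> carrier G) \<Longrightarrow> F \<in> E n"
  by (auto simp: E_def)

lemma E_D: "F \<in> E n \<Longrightarrow> F xs \<noteq> 0 \<Longrightarrow> length xs = Suc n \<and> set xs \<subseteq> carrier G"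
  unfolding E_def by blast

lemma E_outside: "F \<in> E n \<Longrightarrow> \<not> (length xs = Suc n \<and> set xs \<subseteq> carrier G) \<Longrightarrow> F xs = 0"
  unfolding E_def by blast

lemma E_Nil: "F \<in> E n \<Longrightarrow> F [] = 0"
  by (rule E_outside) auto

lemma E_eqI:
  assumes "F \<in> E n" "H \<in> E n"
    and "\<And>xs. length xs = Suc n \<Longrightarrow> set xs \<subseteq> carrier G \<Longrightarrow> F xs = H xs"
  shows "F = H"
proof
  fix xs show "F xs = H xs"
    using E_outside[OF assms(1), of xs] E_outside[OF assms(2), of xs] assms(3)[of xs] by metis
qed

lemma E_zero [simp]: "0 \<in> E n"
  by (auto simp: E_def)

lemma E_add [simp]: "F \<in> E n \<Longrightarrow> H \<in> E n \<Longrightarrow> F + H \<in> E n"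
  unfolding E_def plus_fun_def by (smt (verit) mem_Collect_eq)

lemma E_diff [simp]: "F \<in> E n \<Longrightarrow> H \<in> E n \<Longrightarrow> F - H \<in> E n"
  unfolding E_def fun_diff_def by (smt (verit) mem_Collect_eq)

lemma E_sc [simp]: "F \<in> E n \<Longrightarrow> sc c F \<in> E n"
  by (auto simp: E_def sc_def)

lemma E_sum: "(\<And>i. i \<in> I \<Longrightarrow> F i \<in> E n) \<Longrightarrow> sum F I \<in> E n"
  by (induction I rule: infinite_finite_induct) auto

lemma map_mult_carrier:
  "h \<in> carrier G \<Longrightarrow> set xs \<subseteq> carrier G \<Longrightarrow> set (map ((\<otimes>) h) xs) \<subseteq> carrier G"
  by auto

lemma E_act [simp]: "F \<in> E n \<Longrightarrow> act h F \<in> E n"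
  by (rule E_I) (auto simp: act_def split: if_splits dest!: E_D)

lemma E_d [simp]: "F \<in> E n \<Longrightarrow> d F \<in> E (Suc n)"
  by (rule E_I) (auto simp: d_def split: if_splits dest: E_D alt_length[rotated])

lemma E_contr [simp]: "F \<in> E (Suc n) \<Longrightarrow> contr F \<in> E n"
  by (rule E_I) (auto simp: contr_def split: if_splits dest!: E_D)

lemma E_hcup [simp]: 
  assumes "F \<in> E n" "H \<in> E m" shows "hcup n F H \<in> E (n + m)"
proof (rule E_I)
  fix xs assume "hcup n F H xs \<noteq> 0"
  then have "F (take (Suc n) xs) \<noteq> 0" "H (drop n xs) \<noteq> 0" by (auto simp: hcup_def)
  then have *: "length (take (Suc n) xs) = Suc n" "set (take (Suc n) xs) \<subseteq> carrier G"
      "length (drop n xs) = Suc m" "set (drop n xs) \<subseteq> carrier G"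
    using E_D assms by blast+
  have "set xs = set (take n xs) \<union> set (drop n xs)"
    by (metis append_take_drop_id set_append)
  moreover have "set (take n xs) \<subseteq> set (take (Suc n) xs)"
    by (simp add: set_take_subset_set_take)
  ultimately show "length xs = Suc (n + m) \<and> set xs \<subseteq> carrier G" using * by auto
qed

lemma d_add: "d (F + H) = d F + d H"
  by (simp add: d_def fun_eq_iff plus_fun_def alt_add)

lemma d_diff: "d (F - H) = d F - d H"
  by (simp add: d_def fun_eq_iff fun_diff_def alt_diff)

lemma d_sc: "d (sc c F) = sc c (d F)"
  by (auto simp: d_def fun_eq_iff alt_scale sc_def)

lemma d_zero [simp]: "d 0 = 0"
  using d_sc[of 0 0] by (simp add: sc_simps)

lemma d_sum: "d (sum F I) = (\<Sum>i\<in>I. d (F i))"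
  using sum_comp_morphism[of d F I] by (simp add: d_add comp_def)

lemma d_d [simp]: "d (d F) = 0"
proof
  fix xs 
  show "d (d F) xs = 0 xs"
  proof (cases "set xs \<subseteq> carrier G")
    case True
    then have "alt xs (d F) = alt xs (\<lambda>ys. alt ys F)"
      by (intro alt_cong) (auto simp: d_def)
    then show ?thesis by (simp add: d_def alt_alt)
  qed (simp add: d_def)
qed

lemma d_hcup:
  assumes "F \<in> E n" "H \<in> E m"
  shows "d (hcup n F H) = hcup (Suc n) (d F) H + sc ((-1) ^ n) (hcup n F (d H))"
proof (rule E_eqI[of _ "Suc (n + m)"])
  fix xs :: "'a list" assume "set xs \<subseteq> carrier G"
  moreover from this have "set (take (Suc (Suc n)) xs) \<subseteq> carrier G" "set (drop n xs) \<subseteq> carrier G"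
    by (meson order_trans set_take_subset set_drop_subset)+
  ultimately show "d (hcup n F H) xs = (hcup (Suc n) (d F) H + sc ((-1) ^ n) (hcup n F (d H))) xs"
    using alt_hcup[of H xs n F] E_Nil[OF assms(2)] by (simp add: d_def hcup_def sc_def)
next
  have "hcup (Suc n) (d F) H \<in> E (Suc n + m)" "hcup n F (d H) \<in> E (n + Suc m)"
    using assms by (intro E_hcup; simp)+
  then show "hcup (Suc n) (d F) H + sc ((-1) ^ n) (hcup n F (d H)) \<in> E (Suc (n + m))"
    by simp
qed (use assms in auto)

lemma act_add: "act h (F + H) = act h F + act h H"
  by (auto simp: act_def fun_eq_iff)

lemma act_diff: "act h (F - H) = act h F - act h H"
  by (auto simp: act_def fun_eq_iff)

lemma act_sc: "act h (sc c F) = sc c (act h F)"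
  by (auto simp: act_def fun_eq_iff sc_def)

lemma act_zero [simp]: "act h 0 = 0"
  by (auto simp: act_def fun_eq_iff)

lemma act_sum: "act h (sum F I) = (\<Sum>i\<in>I. act h (F i))"
  using sum_comp_morphism[of "act h" F I] by (simp add: act_add comp_def)

lemma act_act:
  assumes "g \<in> carrier G" "h \<in> carrier G"
  shows "act g (act h F) = act (h \<otimes> g) F"
proof
  fix xs
  show "act g (act h F) xs = act (h \<otimes> g) F xs"
  proof (cases "set xs \<subseteq> carrier G")
    case True
    then have "map ((\<otimes>) h) (map ((\<otimes>) g) xs) = map ((\<otimes>) (h \<otimes> g)) xs"
      using assms by (auto simp: m_assoc)
    then show ?thesis using True assms by (simp add: act_def map_mult_carrier del: map_map set_map)
  qed (simp add: act_def)
qed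

lemma act_one: "F \<in> E n \<Longrightarrow> act \<one> F = F"
proof (rule E_eqI)
  fix xs :: "'a list" assume "set xs \<subseteq> carrier G"
  moreover from this have "map ((\<otimes>) \<one>) xs = xs" by (auto intro!: map_idI)
  ultimately show "act \<one> F xs = F xs" by (simp add: act_def)
qed auto

lemma d_act: 
  assumes "h \<in> carrier G" shows "d (act h F) = act h (d F)"
proof
  fix xs
  show "d (act h F) xs = act h (d F) xs"
  proof (cases "set xs \<subseteq> carrier G")
    case True
    then have "alt xs (act h F) = alt xs (\<lambda>ys. F (map ((\<otimes>) h) ys))"
      by (intro alt_cong) (auto simp: act_def)
    then show ?thesis using True assms by (simp add: d_def act_def alt_map map_mult_carrier del: set_map)
  qed (simp add: d_def act_def)
qed

lemma act_hcup:
  assumes "F \<in> E n" "H \<in> E m" "h \<in> carrier G"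
  shows "act h (hcup n F H) = hcup n (act h F) (act h H)"
proof (rule E_eqI[of _ "n + m"])
  fix xs :: "'a list" assume "set xs \<subseteq> carrier G"
  moreover from this have "set (take (Suc n) xs) \<subseteq> carrier G" "set (drop n xs) \<subseteq> carrier G"
      by (meson order_trans set_take_subset set_drop_subset)+
  ultimately show "act h (hcup n F H) xs = hcup n (act h F) (act h H) xs"
    by (simp add: act_def hcup_def take_map drop_map)
qed (use assms in auto)

text \<open>The cone at the unit: in \<open>d F (\<one> # xs) = 0\<close> the first face gives
  \<open>F xs\<close>, and the remaining faces are those of \<open>contr F\<close> at
  \<open>xs\<close>.\<close>

lemma contr_cocycle:
  assumes "F \<in> E (Suc n)" "d F = 0"
  shows "d (contr F) = F"
proof (rule E_eqI[of _ "Suc n"])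
  fix xs :: "'a list" assume xs: "length xs = Suc (Suc n)" "set xs \<subseteq> carrier G"
  have "d F (\<one> # xs) = 0" using assms(2) by simp
  then have "F xs = alt xs (\<lambda>zs. F (\<one> # zs))" using xs by (simp add: d_def)
  also have "\<dots> = alt xs (contr F) + alt xs (\<lambda>zs. F (\<one> # zs) - contr F zs)"
    by (simp add: alt_diff)
  also have "alt xs (\<lambda>zs. F (\<one> # zs) - contr F zs) = alt xs (\<lambda>zs. 0 * F zs)"
  proof (rule alt_cong)
    fix ys :: "'a list" assume "set ys \<subseteq> set xs"
    then show "F (\<one> # ys) - contr F ys = 0 * F ys"
      using xs E_outside[OF assms(1), of "[\<one>]"] by (auto simp: contr_def)
  qed
  finally show "d (contr F) xs = F xs" using xs alt_scale[of xs 0 F] by (simp add: d_def)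
qed (use assms in auto)

lemma cocycle_0_const:
  assumes "F \<in> E 0" "d F = 0" "x \<in> carrier G"
  shows "F [x] = F [\<one>]"
proof -
  have "d F [\<one>, x] = 0" using assms by simp
  moreover have "d F [\<one>, x] = F [x] - F [\<one>]" using assms(3) by (simp add: d_def)
  ultimately show ?thesis by simp
qed

end

section \<open>The group: normal form and coordinates\<close>

locale q8_cyclic = group G for G (structure) +
  fixes p q z :: 'a and s :: nat
  assumes p [simp]: "p \<in> carrier G" and q [simp]: "q \<in> carrier G" and z [simp]: "z \<in> carrier G"
    and qq: "q \<otimes> q = p \<otimes> p" and pqp: "p \<otimes> (q \<otimes> p) = q"
    and zp: "z \<otimes> p = q \<otimes> z" and zq: "z \<otimes> q = p \<otimes> (q \<otimes> z)"
    and zM: "z [^] ((3::nat) ^ s) = \<one>"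
    and gen: "carrier G = generate G {p, q, z}"
    and ord: "order G = 8 * 3 ^ s"
begin

abbreviation M :: nat where "M \<equiv> 3 ^ s"

text \<open>The entry at m is p^(m mod 4) q^(m div 4), bracketed to the right so that it is already
  normal for rewriting with \<open>m_assoc\<close>.\<close>

definition el :: "nat \<Rightarrow> 'a" where
  "el m = [\<one>, p, p \<otimes> p, p \<otimes> (p \<otimes> p), q, p \<otimes> q, p \<otimes> (p \<otimes> q), p \<otimes> (p \<otimes> (p \<otimes> q))] ! m"

lemma lt8: "m < 8 \<longleftrightarrow> m = 0 \<or> m = 1 \<or> m = 2 \<or> m = 3 \<or> m = 4 \<or> m = 5 \<or> m = 6 \<or> m = (7::nat)"
  by auto

lemma lessThan8: "{..<8::nat} = {0, 1, 2, 3, 4, 5, 6, 7}"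
  by auto

lemma el_simps [simp]:
  "el 0 = \<one>" "el 1 = p" "el (Suc 0) = p" "el 2 = p \<otimes> p" "el 3 = p \<otimes> (p \<otimes> p)"
  "el 4 = q" "el 5 = p \<otimes> q" "el 6 = p \<otimes> (p \<otimes> q)" "el 7 = p \<otimes> (p \<otimes> (p \<otimes> q))"
  by (simp_all add: el_def)

lemma el_carrier [simp]: "m < 8 \<Longrightarrow> el m \<in> carrier G"
  by (auto simp: lt8)

text \<open>As p^2 = q^2 commutes with q, q p^4 = p^2 q p^2 = p (p q p) p = p q p = q.\<close>

lemma p4: "p \<otimes> (p \<otimes> (p \<otimes> p)) = \<one>"
proof -
  have 1: "(p \<otimes> p) \<otimes> q = q \<otimes> (p \<otimes> p)"
    by (simp add: qq[symmetric] m_assoc)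
  have 2: "(p \<otimes> p) \<otimes> q \<otimes> (p \<otimes> p) = q"
  proof -
    have "(p \<otimes> p) \<otimes> q \<otimes> (p \<otimes> p) = p \<otimes> (p \<otimes> (q \<otimes> p)) \<otimes> p" by (simp add: m_assoc)
    then show ?thesis using pqp by (simp add: m_assoc)
  qed
  have "q \<otimes> (p \<otimes> (p \<otimes> (p \<otimes> p))) = q \<otimes> (p \<otimes> p) \<otimes> (p \<otimes> p)" by (simp add: m_assoc)
  also have "\<dots> = q" using 1 2 by simp
  finally show ?thesis by (metis l_cancel_one p q m_closed)
qed

lemma qp: "q \<otimes> p = p \<otimes> (p \<otimes> (p \<otimes> q))"
proof -
  have "p \<otimes> (p \<otimes> (p \<otimes> q)) = p \<otimes> (p \<otimes> (p \<otimes> (p \<otimes> (q \<otimes> p))))" by (simp add: pqp)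
  also have "\<dots> = p \<otimes> (p \<otimes> (p \<otimes> p)) \<otimes> (q \<otimes> p)" by (simp add: m_assoc)
  finally show ?thesis by (simp add: p4)
qed

lemma rel_ext:
  assumes [simp]: "x \<in> carrier G"
  shows "p \<otimes> (p \<otimes> (p \<otimes> (p \<otimes> x))) = x" "q \<otimes> (p \<otimes> x) = p \<otimes> (p \<otimes> (p \<otimes> (q \<otimes> x)))"
    "q \<otimes> (q \<otimes> x) = p \<otimes> (p \<otimes> x)" "z \<otimes> (p \<otimes> x) = q \<otimes> (z \<otimes> x)"
    "z \<otimes> (q \<otimes> x) = p \<otimes> (q \<otimes> (z \<otimes> x))"
proof -
  have "p \<otimes> (p \<otimes> (p \<otimes> (p \<otimes> x))) = (p \<otimes> (p \<otimes> (p \<otimes> p))) \<otimes> x" by (simp add: m_assoc)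
  then show "p \<otimes> (p \<otimes> (p \<otimes> (p \<otimes> x))) = x" by (simp add: p4)
  have "q \<otimes> (p \<otimes> x) = (q \<otimes> p) \<otimes> x" by (simp add: m_assoc)
  then show "q \<otimes> (p \<otimes> x) = p \<otimes> (p \<otimes> (p \<otimes> (q \<otimes> x)))" by (simp add: qp m_assoc)
  have "q \<otimes> (q \<otimes> x) = (q \<otimes> q) \<otimes> x" by (simp add: m_assoc)
  then show "q \<otimes> (q \<otimes> x) = p \<otimes> (p \<otimes> x)" by (simp add: qq m_assoc)
  have "z \<otimes> (p \<otimes> x) = (z \<otimes> p) \<otimes> x" by (simp add: m_assoc)
  then show "z \<otimes> (p \<otimes> x) = q \<otimes> (z \<otimes> x)" by (simp add: zp m_assoc)
  have "z \<otimes> (q \<otimes> x) = (z \<otimes> q) \<otimes> x" by (simp add: m_assoc)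
  then show "z \<otimes> (q \<otimes> x) = p \<otimes> (q \<otimes> (z \<otimes> x))" by (simp add: zq m_assoc)
qed

lemmas rels = qq qp p4 zp zq rel_ext m_assoc

text \<open>Left multiplication by p and by q, and conjugation by z, as permutations of the indices
  of \<open>el\<close>. They turn calculations in Q into finite case checks.\<close>

definition pl :: "nat \<Rightarrow> nat" where "pl m = [1, 2, 3, 0, 5, 6, 7, 4] ! m"
definition ql :: "nat \<Rightarrow> nat" where "ql m = [4, 7, 6, 5, 2, 1, 0, 3] ! m"
definition zl :: "nat \<Rightarrow> nat" where "zl m = [0, 4, 2, 6, 5, 1, 7, 3] ! m"

lemma table_lt: "m < 8 \<Longrightarrow> pl m < 8" "m < 8 \<Longrightarrow> ql m < 8" "m < 8 \<Longrightarrow> zl m < 8"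
  by (auto simp: lt8 pl_def ql_def zl_def)

lemma p_el: "m < 8 \<Longrightarrow> p \<otimes> el m = el (pl m)"
  and q_el: "m < 8 \<Longrightarrow> q \<otimes> el m = el (ql m)"
  and z_el: "m < 8 \<Longrightarrow> z \<otimes> el m = el (zl m) \<otimes> z"
  by (auto simp: lt8 pl_def ql_def zl_def rels)

lemma el_mult:
  assumes "m < 8" "x \<in> carrier G"
  shows "p \<otimes> (el m \<otimes> x) = el (pl m) \<otimes> x" "q \<otimes> (el m \<otimes> x) = el (ql m) \<otimes> x"
    "z \<otimes> (el m \<otimes> x) = el (zl m) \<otimes> (z \<otimes> x)"
  using assms by (simp_all add: m_assoc[symmetric] p_el q_el z_el table_lt)

lemma zcomm: 
  "z [^] (k::nat) \<otimes> z = z \<otimes> z [^] k"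
  "x \<in> carrier G \<Longrightarrow> z [^] (k::nat) \<otimes> (z \<otimes> x) = z \<otimes> (z [^] k \<otimes> x)"
proof -
  show 1: "z [^] k \<otimes> z = z \<otimes> z [^] k"
    using nat_pow_Suc[of z k] nat_pow_Suc2[of z k] by simp
  show "z [^] k \<otimes> (z \<otimes> x) = z \<otimes> (z [^] k \<otimes> x)" if "x \<in> carrier G"
    using that 1 by (simp only: m_assoc[symmetric] nat_pow_closed z)
qed

lemma zpow_mod: "z [^] (k mod M) = z [^] k"
proof -
  have "z [^] k = z [^] (M * (k div M) + k mod M)" by simp
  also have "\<dots> = (z [^] M) [^] (k div M) \<otimes> z [^] (k mod M)"
    by (metis nat_pow_mult nat_pow_pow z)
  finally show ?thesis by (simp add: zM)
qed

definition el_set :: "'a set" where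
  "el_set = (\<lambda>(m, k). el m \<otimes> z [^] k) ` ({..<8} \<times> {..<M})"

lemma el_setI: "m < 8 \<Longrightarrow> el m \<otimes> z [^] (k::nat) \<in> el_set"
  unfolding el_set_def by (rule image_eqI[of _ _ "(m, k mod M)"]) (auto simp: zpow_mod)

lemma el_set_mult:
  assumes "y \<in> el_set"
  shows "p \<otimes> y \<in> el_set" "q \<otimes> y \<in> el_set" "z \<otimes> y \<in> el_set"
proof -
  obtain m k where mk: "m < 8" "y = el m \<otimes> z [^] (k::nat)" using assms by (auto simp: el_set_def)
  then have "z \<otimes> y = el (zl m) \<otimes> z [^] Suc k"
    by (simp add: el_mult zcomm)
  moreover have "p \<otimes> y = el (pl m) \<otimes> z [^] k" "q \<otimes> y = el (ql m) \<otimes> z [^] k" 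
    using mk by (simp_all add: el_mult)
  ultimately show "p \<otimes> y \<in> el_set" "q \<otimes> y \<in> el_set" "z \<otimes> y \<in> el_set"
    using mk(1) table_lt el_setI by metis+
qed

lemma el_set_zpow_mult: "y \<in> el_set \<Longrightarrow> z [^] (k::nat) \<otimes> y \<in> el_set"
proof (induction k)
  case 0
  then have "y \<in> carrier G" by (auto simp: el_set_def)
  then show ?case using 0 by simp
next
  case (Suc k)
  moreover have "y \<in> carrier G" using Suc.prems by (auto simp: el_set_def)
  ultimately show ?case using el_set_mult(3) by (simp add: zcomm m_assoc)
qed

lemma inv_gens: "inv p = p \<otimes> (p \<otimes> p)" "inv q = q \<otimes> (q \<otimes> q)" "inv z = z [^] (M - 1)"
proof -
  show "inv p = p \<otimes> (p \<otimes> p)" by (rule inv_equality) (auto simp: rels)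
  show "inv q = q \<otimes> (q \<otimes> q)" by (rule inv_equality) (auto simp: rels)
  have "z [^] (M - 1) \<otimes> z = z [^] Suc (M - 1)" by (simp only: nat_pow_Suc)
  also have "Suc (M - 1) = M" by simp
  finally show "inv z = z [^] (M - 1)" by (intro inv_equality) (auto simp: zM)
qed

text \<open>The set of normal forms contains the unit and is stable under left multiplication by the
  generators and by their inverses, which are positive words.\<close>

lemma carrier_el_set: "carrier G = el_set"
proof
  have "x \<otimes> y \<in> el_set" if "x \<in> generate G {p, q, z}" "y \<in> el_set" for x y
    using that
  proof (induction x arbitrary: y rule: generate.induct)
    case one
    then have "y \<in> carrier G" by (auto simp: el_set_def)
    then show ?case using one by simp
  next
    case (incl h)
    then show ?case using el_set_mult by auto
  next
    case (inv h)
    then have "y \<in> carrier G" by (auto simp: el_set_def)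
    then show ?case using inv el_set_mult el_set_zpow_mult by (auto simp: inv_gens m_assoc)
  next
    case (eng h1 h2)
    then have "y \<in> carrier G" by (auto simp: el_set_def)
    moreover have "h1 \<in> carrier G" "h2 \<in> carrier G" using eng gen by auto
    ultimately show ?case using eng by (simp add: m_assoc)
  qed
  moreover have "\<one> \<in> el_set" using el_setI[of 0 0] by simp
  ultimately show "carrier G \<subseteq> el_set"
    using gen by (metis r_one subsetI)
  show "el_set \<subseteq> carrier G" by (auto simp: el_set_def)
qed

text \<open>Uniqueness of the normal form comes from counting: the 8 * 3^s normal forms fill a group
  of exactly that order.\<close>

lemma inj_el: "inj_on (\<lambda>(m, k). el m \<otimes> z [^] k) ({..<8} \<times> {..<M})"
proof (rule eq_card_imp_inj_on)
  show "card ((\<lambda>(m, k). el m \<otimes> z [^] k) ` ({..<8} \<times> {..<M})) = card ({..<8::nat} \<times> {..<M})"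
    using ord carrier_el_set by (simp add: order_def el_set_def)
qed simp

text \<open>The coordinates of the normal form. \<open>ph\<close> is the projection of G onto Z/3^s
  with kernel Q, with values taken in 0, ..., 3^s - 1; its failure to be additive over the integers
  produces the class in degree two.\<close>

definition ix :: "'a \<Rightarrow> nat" where
  "ix x = fst (inv_into ({..<8} \<times> {..<M}) (\<lambda>(m, k). el m \<otimes> z [^] k) x)"
definition ph :: "'a \<Rightarrow> nat" where
  "ph x = snd (inv_into ({..<8} \<times> {..<M}) (\<lambda>(m, k). el m \<otimes> z [^] k) x)"

lemma ix_ph:
  assumes "x \<in> carrier G"
  shows "ix x < 8" "ph x < M" "el (ix x) \<otimes> z [^] ph x = x"
proof -
  have x: "x \<in> (\<lambda>(m, k). el m \<otimes> z [^] k) ` ({..<8} \<times> {..<M})"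
    using assms carrier_el_set el_set_def by simp
  show "ix x < 8" "ph x < M" using inv_into_into[OF x] by (auto simp: ix_def ph_def)
  show "el (ix x) \<otimes> z [^] ph x = x" using f_inv_into_f[OF x] by (simp add: ix_def ph_def split_def)
qed

lemma ix_el: "m < 8 \<Longrightarrow> ix (el m \<otimes> z [^] k) = m"
  and ph_el: "m < 8 \<Longrightarrow> ph (el m \<otimes> z [^] k) = k mod M"
  using inv_into_f_f[OF inj_el, of "(m, k mod M)"] by (auto simp: ix_def ph_def zpow_mod)

lemma carrier_cases:
  assumes "x \<in> carrier G"
  obtains m k where "m < 8" "k < M" "x = el m \<otimes> z [^] k"
  using ix_ph[OF assms] by metis

lemma ph_gen:
  assumes "x \<in> carrier G"
  shows "ph (p \<otimes> x) = ph x" "ph (q \<otimes> x) = ph x" "ph (z \<otimes> x) = Suc (ph x) mod M"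
proof -
  obtain m k where mk: "m < 8" "k < M" "x = el m \<otimes> z [^] k" using carrier_cases assms by blast
  then have "z \<otimes> x = el (zl m) \<otimes> z [^] Suc k"
    by (simp add: el_mult zcomm)
  moreover have "p \<otimes> x = el (pl m) \<otimes> z [^] k" "q \<otimes> x = el (ql m) \<otimes> z [^] k" 
    using mk by (simp_all add: el_mult)
  ultimately show "ph (p \<otimes> x) = ph x" "ph (q \<otimes> x) = ph x" "ph (z \<otimes> x) = Suc (ph x) mod M"
    using mk by (simp_all only: ph_el table_lt mod_less)
qed

lemma ph_zpow: "x \<in> carrier G \<Longrightarrow> ph (z [^] (k::nat) \<otimes> x) = (k + ph x) mod M"
proof (induction k)
  case 0
  then show ?case using ix_ph(2)[of x] by simp
next
  case (Suc k)
  then show ?case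
    by (simp add: zcomm m_assoc ph_gen mod_Suc_eq)
qed

lemma ph_elm: "m < 8 \<Longrightarrow> x \<in> carrier G \<Longrightarrow> ph (el m \<otimes> x) = ph x"
  by (auto simp: lt8 m_assoc ph_gen)

lemma ph_mult: 
  assumes "x \<in> carrier G" "y \<in> carrier G"
  shows "ph (x \<otimes> y) = (ph x + ph y) mod M"
proof -
  obtain m k where mk: "m < 8" "k < M" "x = el m \<otimes> z [^] k" using carrier_cases assms by blast
  then have "ph x = k" by (simp add: ph_el)
  moreover have "ph (x \<otimes> y) = (k + ph y) mod M" 
    using mk assms(2) by (simp add: m_assoc ph_elm ph_zpow)
  ultimately show ?thesis by simp
qed

text \<open>Normality of Q, in the form needed to move its elements past the powers of z in the
  transfer.\<close>

lemma zpow_el: "m < 8 \<Longrightarrow> \<exists>m'<8. z [^] (k::nat) \<otimes> el m = el m' \<otimes> z [^] k"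
proof (induction k)
  case 0
  then show ?case by (intro exI[of _ m]) simp
next
  case (Suc k)
  then obtain m' where m': "m' < 8" "z [^] k \<otimes> el m = el m' \<otimes> z [^] k" by blast
  have "z [^] Suc k \<otimes> el m = z \<otimes> (z [^] k \<otimes> el m)"
    using Suc.prems by (metis el_carrier m_assoc nat_pow_Suc nat_pow_closed z zcomm(1))
  also have "\<dots> = z \<otimes> (el m' \<otimes> z [^] k)" by (simp only: m'(2))
  also have "\<dots> = el (zl m') \<otimes> z [^] Suc k"
    using m' by (metis el_mult(3) nat_pow_Suc nat_pow_closed z zcomm(1))
  finally show ?case using table_lt(3)[OF m'(1)] by blast
qed

end

section \<open>Invariant cochains and norms\<close>

context group
begin

text \<open>\<open>H\<close> is meant as a set of generators: \<open>{z}\<close>,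
  \<open>{p, q}\<close> and \<open>{p, q, z}\<close> stand for C, Q and G, and invariance under
  generators already gives invariance under the subgroup.\<close>

definition EI :: "'a set \<Rightarrow> nat \<Rightarrow> ('a list \<Rightarrow> int) set" where
  "EI H n = {F \<in> E n. \<forall>h\<in>H. act h F = F}"

lemma EI_E: "F \<in> EI H n \<Longrightarrow> F \<in> E n"
  by (simp add: EI_def)

lemma EI_act: "F \<in> EI H n \<Longrightarrow> h \<in> H \<Longrightarrow> act h F = F"
  by (simp add: EI_def)

lemma EI_mono: "H \<subseteq> K \<Longrightarrow> F \<in> EI K n \<Longrightarrow> F \<in> EI H n"
  by (auto simp: EI_def)

lemma EI_zero [simp]: "0 \<in> EI H n"
  by (simp add: EI_def)

lemma EI_add: "F \<in> EI H n \<Longrightarrow> K \<in> EI H n \<Longrightarrow> F + K \<in> EI H n"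
  by (simp add: EI_def act_add)

lemma EI_diff: "F \<in> EI H n \<Longrightarrow> K \<in> EI H n \<Longrightarrow> F - K \<in> EI H n"
  by (simp add: EI_def act_diff)

lemma EI_sc: "F \<in> EI H n \<Longrightarrow> sc c F \<in> EI H n"
  by (simp add: EI_def act_sc)

lemma EI_hcup: "H \<subseteq> carrier G \<Longrightarrow> F \<in> EI H n \<Longrightarrow> K \<in> EI H m \<Longrightarrow> hcup n F K \<in> EI H (n + m)"
  by (auto simp: EI_def act_hcup subset_iff)

lemma act_pow_inv:
  assumes "act h F = F" "h \<in> carrier G" "F \<in> E n"
  shows "act (h [^] (k::nat)) F = F"
proof (induction k)
  case 0
  show ?case using assms act_one by simp
next
  case (Suc k)
  have "act (h [^] Suc k) F = act h (act (h [^] k) F)" using assms by (simp add: act_act)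
  then show ?case using Suc assms by simp
qed

end

context q8_cyclic
begin

text \<open>Each of the two sums has two roles. It is the norm of its own group in the periodic
  resolution; and because Q and C are complements, the same elements represent the cosets of the
  other subgroup, so on invariants of that subgroup the sum is the transfer to G.\<close>

definition NQ :: "('a list \<Rightarrow> int) \<Rightarrow> 'a list \<Rightarrow> int" where
  "NQ F = (\<Sum>m<8. act (el m) F)"

definition NZ :: "('a list \<Rightarrow> int) \<Rightarrow> 'a list \<Rightarrow> int" where
  "NZ F = (\<Sum>k<M. act (z [^] k) F)"

lemma sum_eq_sc: "(\<And>i. i \<in> I \<Longrightarrow> F i = K) \<Longrightarrow> (\<Sum>i\<in>I. F i) = sc (int (card I)) K"
proof -
  assume "\<And>i. i \<in> I \<Longrightarrow> F i = K"
  then have "(\<Sum>i\<in>I. F i) = (\<Sum>i\<in>I. K)" by (intro sum.cong) auto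
  also have "\<dots> = sc (int (card I)) K"
    by (induction I rule: infinite_finite_induct) (auto simp: sc_def fun_eq_iff algebra_simps)
  finally show ?thesis .
qed

lemma NQ_E [simp]: "F \<in> E n \<Longrightarrow> NQ F \<in> E n"
  unfolding NQ_def by (rule E_sum) auto

lemma NZ_E [simp]: "F \<in> E n \<Longrightarrow> NZ F \<in> E n"
  unfolding NZ_def by (rule E_sum) auto

lemma NQ_add: "NQ (F + K) = NQ F + NQ K"
  and NQ_diff: "NQ (F - K) = NQ F - NQ K"
  and NQ_zero [simp]: "NQ 0 = 0"
  by (simp_all add: NQ_def act_add act_diff act_sc sum.distrib sum_subtractf lessThan8 sc_simps)

lemma sc_sum: "sc c (sum F I) = (\<Sum>i\<in>I. sc c (F i))"
  using sum_comp_morphism[of "sc c" F I] by (simp add: sc_simps comp_def)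

lemma NZ_diff: "NZ (F - K) = NZ F - NZ K"
  and NZ_sc: "NZ (sc c F) = sc c (NZ F)"
  and NZ_zero [simp]: "NZ 0 = 0"
  by (simp_all add: NZ_def act_add act_diff act_sc sum.distrib sum_subtractf sc_sum)

lemma d_NQ: "d (NQ F) = NQ (d F)"
  by (simp add: NQ_def d_sum d_act)

lemma d_NZ: "d (NZ F) = NZ (d F)"
  by (simp add: NZ_def d_sum d_act)

lemma NZ_inv:
  assumes "F \<in> EI {z} n" shows "NZ F = sc (int M) F"
proof -
  have "NZ F = sc (int (card {..<M})) F"
    unfolding NZ_def by (rule sum_eq_sc) (use assms in \<open>auto simp: EI_def intro: act_pow_inv\<close>)
  then show ?thesis by simp
qed

lemma el_act_inv:
  assumes "F \<in> EI {p, q} n" "m < 8" shows "act (el m) F = F"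
proof -
  have F: "F \<in> E n" "act p F = F" "act q F = F" using assms by (auto simp: EI_def)
  have *: "act (p \<otimes> g) F = act g F" if "g \<in> carrier G" for g
    using that F act_act[of g p F] by simp
  show ?thesis using assms(2) F act_one[of F n] by (auto simp: lt8 *)
qed

lemma NQ_inv:
  assumes "F \<in> EI {p, q} n" shows "NQ F = sc 8 F"
proof -
  have "NQ F = sc (int (card {..<8::nat})) F"
    unfolding NQ_def by (rule sum_eq_sc) (use assms in \<open>auto intro: el_act_inv\<close>)
  then show ?thesis by simp
qed

lemma sum_telescope_fun:
  fixes f :: "nat \<Rightarrow> 'c::ab_group_add"
  shows "(\<Sum>k<n. f (Suc k)) = (\<Sum>k<n. f k) + f n - f 0"
  by (induction n) auto

lemma NZ_act_z:
  assumes "F \<in> E n" shows "NZ (act z F) = NZ F" "act z (NZ F) = NZ F"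
proof -
  have "(\<Sum>k<M. act (z [^] Suc k) F) = NZ F"
    using sum_telescope_fun[of "\<lambda>k. act (z [^] k) F" M] zM act_one[OF assms] by (simp add: NZ_def)
  then show "NZ (act z F) = NZ F" "act z (NZ F) = NZ F"
    by (simp_all add: NZ_def act_act zcomm act_sum)
qed

lemma NZ_EI_z: "F \<in> E n \<Longrightarrow> NZ F \<in> EI {z} n"
  by (simp add: EI_def NZ_act_z)

lemma NQ_act:
  "NQ (act p F) = NQ F" "act p (NQ F) = NQ F" "NQ (act q F) = NQ F" "act q (NQ F) = NQ F"
  unfolding NQ_def lessThan8 by (simp_all add: act_add act_act rels algebra_simps)

lemma NQ_EI: "F \<in> E n \<Longrightarrow> NQ F \<in> EI {p, q} n"
  by (simp add: EI_def NQ_act)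

text \<open>The transfers from \<open>\<langle>z\<rangle>\<close> and from \<open>\<langle>p, q\<rangle>\<close> to the whole group.\<close>

lemma sum_zl:
  fixes f :: "nat \<Rightarrow> 'c::ab_group_add"
  shows "(\<Sum>m<8. f (zl m)) = (\<Sum>m<8. f m)"
  unfolding lessThan8 by (simp add: zl_def add_ac)

text \<open>Applying z turns the summand of \<open>el m\<close> into that of
  \<open>el m \<otimes> z\<close>. Reindexing by the permutation \<open>zl\<close> changes this into
  \<open>z \<otimes> el m\<close>, where z acts first, on the invariant \<open>F\<close>.\<close>

lemma NQ_EI_all:
  assumes "F \<in> EI {z} n" shows "NQ F \<in> EI {p, q, z} n"
proof -
  have F: "act z F = F" "F \<in> E n" using assms by (auto simp: EI_def)
  have "act z (NQ F) = (\<Sum>m<8. act (el m \<otimes> z) F)"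
    unfolding NQ_def act_sum by (intro sum.cong) (auto simp: act_act)
  also have "\<dots> = (\<Sum>m<8. act (el (zl m) \<otimes> z) F)"
    by (rule sum_zl[symmetric])
  also have "\<dots> = (\<Sum>m<8. act (el m) (act z F))"
    by (intro sum.cong) (auto simp: act_act z_el)
  also have "\<dots> = NQ F" unfolding NQ_def F(1) ..
  finally show ?thesis using NQ_EI[OF F(2)] by (auto simp: EI_def)
qed

text \<open>Every single summand is invariant under Q: moving \<open>el m\<close> past the power of
  z gives another element of Q, which \<open>F\<close> absorbs.\<close>

lemma NZ_EI_all:
  assumes "F \<in> EI {p, q} n" shows "NZ F \<in> EI {p, q, z} n"
proof -
  have *: "act (el m) (NZ F) = NZ F" if m: "m < 8" for m
  proof -
    have "act (el m) (act (z [^] k) F) = act (z [^] k) F" for k :: nat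
    proof -
      obtain m' where m': "m' < 8" "z [^] k \<otimes> el m = el m' \<otimes> z [^] k" using zpow_el[OF m] by blast
      have "act (el m) (act (z [^] k) F) = act (z [^] k) (act (el m') F)" using m m' by (simp add: act_act)
      then show ?thesis using el_act_inv[OF assms m'(1)] by simp
    qed
    then show ?thesis unfolding NZ_def act_sum by simp
  qed
  from *[of 1] *[of 4] show ?thesis
    using NZ_EI_z[OF EI_E[OF assms]] by (simp add: EI_def)
qed

subsection \<open>Exactness\<close>

lemma NZ_at:
  assumes "set xs \<subseteq> carrier G"
  shows "NZ F xs = (\<Sum>k<M. F (map ((\<otimes>) (z [^] k)) xs))"
proof -
  have "(\<Sum>k\<in>I. act (z [^] k) F) xs = (\<Sum>k\<in>I. act (z [^] k) F xs)" for I :: "nat set"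
    by (induction I rule: infinite_finite_induct) auto
  then show ?thesis using assms by (simp add: NZ_def act_def)
qed

lemma map_mult_map:
  "g \<in> carrier G \<Longrightarrow> h \<in> carrier G \<Longrightarrow> set xs \<subseteq> carrier G \<Longrightarrow>
    map ((\<otimes>) g) (map ((\<otimes>) h) xs) = map ((\<otimes>) (g \<otimes> h)) xs"
  by (auto simp: m_assoc)

lemma map_one: "set xs \<subseteq> carrier G \<Longrightarrow> map ((\<otimes>) \<one>) xs = xs"
  by (auto intro!: map_idI)

lemma hd_map_ph: "xs \<noteq> [] \<Longrightarrow> hd (map f xs) = f (hd xs)"
  by (cases xs) auto

text \<open>An orbit of C on tuples is a free cycle, numbered by \<open>ph\<close> of the first
  entry. At the point numbered k, \<open>a\<close> is the sum of \<open>F\<close> over the points of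
  the orbit with smaller number, so one step of z adds the value of \<open>F\<close>. At the wrap
  from M - 1 to 0 the difference is minus the sum of \<open>F\<close> over all other points, which
  is right because the norm vanishes.\<close>

lemma NZ_kernel:
  assumes F: "F \<in> E n" and "NZ F = 0"
  shows "\<exists>a\<in>E n. act z a - a = F"
proof -
  define a where "a = (\<lambda>xs. if length xs = Suc n \<and> set xs \<subseteq> carrier G then
     (\<Sum>j\<in>{M - ph (hd xs)..<M}. F (map ((\<otimes>) (z [^] j)) xs)) else 0)"
  have a: "a \<in> E n" by (rule E_I) (auto simp: a_def split: if_splits)
  have "act z a - a = F"
  proof (rule E_eqI[of _ n])
    fix xs assume xs: "length xs = Suc n" "set xs \<subseteq> carrier G"
    define f where "f j = F (map ((\<otimes>) (z [^] (j::nat))) xs)" for j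
    have ne: "xs \<noteq> []" and hd: "hd xs \<in> carrier G" using xs by (cases xs; simp)+
    define k where "k = ph (hd xs)"
    have k: "k < M" using ix_ph hd k_def by simp
    have f0: "f 0 = F xs" "f M = F xs" using map_one[OF xs(2)] by (simp_all add: f_def zM)
    have ax: "a xs = (\<Sum>j\<in>{M - k..<M}. f j)" using xs by (simp add: a_def f_def k_def)
    have "act z a xs = a (map ((\<otimes>) z) xs)" using xs by (simp add: act_def)
    also have "\<dots> = (\<Sum>j\<in>{M - Suc k mod M..<M}. F (map ((\<otimes>) (z [^] j)) (map ((\<otimes>) z) xs)))"
      using xs hd ne by (simp add: a_def hd_map_ph ph_gen k_def image_subset_iff subset_iff del: map_map)
    also have "\<dots> = (\<Sum>j\<in>{M - Suc k mod M..<M}. f (Suc j))"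
      using xs by (simp only: map_mult_map nat_pow_closed z f_def nat_pow_Suc)
    finally have zax: "act z a xs = (\<Sum>j\<in>{M - Suc k mod M..<M}. f (Suc j))" .
    show "(act z a - a) xs = F xs"
    proof (cases "Suc k = M")
      case True
      have "NZ F xs = (\<Sum>j<M. f j)" using xs by (simp add: NZ_at f_def)
      also have "\<dots> = f 0 + (\<Sum>j\<in>{1..<M}. f j)"
        by (metis (no_types, lifting) One_nat_def atLeast0LessThan sum.atLeast_Suc_lessThan zero_less_numeral zero_less_power)
      finally have "f 0 + (\<Sum>j\<in>{1..<M}. f j) = 0" using assms(2) by simp
      moreover have "M - k = 1" using True by simp
      ultimately show ?thesis using zax ax f0 True by simp
    next
      case False
      then have "Suc k mod M = Suc k" using k by simp
      then have "act z a xs = (\<Sum>j\<in>{M - Suc k..<M}. f (Suc j))" using zax by simp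
      also have "\<dots> = (\<Sum>j\<in>{Suc (M - Suc k)..<Suc M}. f j)" by (rule sum.shift_bounds_Suc_ivl[symmetric])
      also have "\<dots> = (\<Sum>j\<in>{M - k..<M}. f j) + f M" using k by (simp add: Suc_diff_Suc)
      finally show ?thesis using ax f0 by simp
    qed
  qed (use a F in auto)
  then show ?thesis using a by blast
qed

text \<open>Each orbit has one point whose first entry has \<open>ph\<close> equal to 0. Keeping
  \<open>F\<close> there and putting 0 elsewhere, the norm spreads the value over the orbit
  again.\<close>

lemma NZ_surj:
  assumes F: "F \<in> EI {z} n"
  shows "\<exists>a\<in>E n. NZ a = F"
proof -
  define a where "a = (\<lambda>xs. if length xs = Suc n \<and> set xs \<subseteq> carrier G \<and> ph (hd xs) = 0 then F xs else 0)"
  have a: "a \<in> E n" by (rule E_I) (auto simp: a_def split: if_splits)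
  have "NZ a = F"
  proof (rule E_eqI[of _ n])
    fix xs assume xs: "length xs = Suc n" "set xs \<subseteq> carrier G"
    have ne: "xs \<noteq> []" and hd: "hd xs \<in> carrier G" using xs by (cases xs; simp)+
    define k where "k = ph (hd xs)"
    have k: "k < M" using ix_ph hd k_def by simp
    have "a (map ((\<otimes>) (z [^] j)) xs) = (if (j + k) mod M = 0 then F xs else 0)" for j :: nat
    proof -
      have "act (z [^] j) F = F" using F by (intro act_pow_inv) (auto simp: EI_def)
      then have "F (map ((\<otimes>) (z [^] j)) xs) = F xs" using xs(2) by (metis act_def)
      then show ?thesis
        using xs hd ne by (simp add: a_def hd_map_ph ph_zpow k_def image_subset_iff subset_iff)
    qed
    then have "NZ a xs = (\<Sum>j<M. if (j + k) mod M = 0 then F xs else 0)"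
      using xs by (simp add: NZ_at)
    also have "\<dots> = (\<Sum>j<M. if j = (M - k) mod M then F xs else 0)"
    proof (rule sum.cong)
      fix j assume j: "j \<in> {..<M}"
      have "(j + k) mod M = 0 \<longleftrightarrow> j = (M - k) mod M"
      proof (cases "k = 0")
        case False
        then have "(M - k) mod M = M - k" using k by simp
        moreover have "(j + k) mod M = 0 \<longleftrightarrow> j + k = M"
        proof (cases "j + k < M")
          case True then show ?thesis using False by simp
        next
          case False
          then have "(j + k) mod M = j + k - M" using j k by (simp add: mod_if)
          then show ?thesis using False by simp
        qed
        ultimately show ?thesis using k by auto
      qed (use j in auto)
      then show "(if (j + k) mod M = 0 then F xs else 0) = (if j = (M - k) mod M then F xs else 0)" by simp
    qed simp
    also have "\<dots> = F xs" by simp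
    finally show "NZ a xs = F xs" .
  qed (use a F in \<open>auto simp: EI_def\<close>)
  then show ?thesis using a by blast
qed

text \<open>A transversal of the free orbits of Q on tuples: the first entry is a power of z.
  \<open>W F ys\<close> lists the values of \<open>F\<close> on the eight points of the orbit of
  \<open>ys\<close>. By \<open>W_eqI\<close> and \<open>W_lift\<close> cochains are arbitrary
  families of such lists, so exactness becomes linear algebra over the integers on eight
  points.\<close>

definition V :: "nat \<Rightarrow> 'a list set" where
  "V n = {ys. length ys = Suc n \<and> set ys \<subseteq> carrier G \<and> ix (hd ys) = 0}"

definition W :: "('a list \<Rightarrow> int) \<Rightarrow> 'a list \<Rightarrow> nat \<Rightarrow> int" where
  "W F ys m = F (map ((\<otimes>) (el m)) ys)"

lemma orbit_point:
  assumes "length xs = Suc n" "set xs \<subseteq> carrier G"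
  shows "map ((\<otimes>) (inv (el (ix (hd xs))))) xs \<in> V n"
    and "map ((\<otimes>) (el (ix (hd xs)))) (map ((\<otimes>) (inv (el (ix (hd xs))))) xs) = xs"
proof -
  have ne: "xs \<noteq> []" and hd: "hd xs \<in> carrier G" using assms by (cases xs; simp)+
  have m: "ix (hd xs) < 8" using ix_ph hd by simp
  have "inv (el (ix (hd xs))) \<otimes> hd xs = inv (el (ix (hd xs))) \<otimes> (el (ix (hd xs)) \<otimes> z [^] ph (hd xs))"
    using ix_ph[OF hd] by simp
  also have "\<dots> = el 0 \<otimes> z [^] ph (hd xs)" using m by (simp add: m_assoc[symmetric])
  finally have "ix (inv (el (ix (hd xs))) \<otimes> hd xs) = 0" using ix_el[of 0] by simp
  then show "map ((\<otimes>) (inv (el (ix (hd xs))))) xs \<in> V n"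
    using assms m ne by (auto simp: V_def hd_map_ph)
  show "map ((\<otimes>) (el (ix (hd xs)))) (map ((\<otimes>) (inv (el (ix (hd xs))))) xs) = xs"
    using assms m by (simp only: map_mult_map inv_closed el_carrier r_inv map_one)
qed

lemma W_eqI:
  assumes "F \<in> E n" "K \<in> E n" "\<And>ys m. ys \<in> V n \<Longrightarrow> m < 8 \<Longrightarrow> W F ys m = W K ys m"
  shows "F = K"
proof (rule E_eqI[OF assms(1,2)])
  fix xs assume xs: "length xs = Suc n" "set xs \<subseteq> carrier G"
  have "hd xs \<in> carrier G" using xs by (cases xs; simp)
  then show "F xs = K xs" 
    using assms(3)[OF orbit_point(1)[OF xs], of "ix (hd xs)"] orbit_point(2)[OF xs] ix_ph by (simp add: W_def del: map_map)
qed

lemma W_lift: "\<exists>F\<in>E n. \<forall>ys\<in>V n. \<forall>m<8. W F ys m = \<psi> ys m"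
proof -
  define F where "F = (\<lambda>xs. if length xs = Suc n \<and> set xs \<subseteq> carrier G
    then \<psi> (map ((\<otimes>) (inv (el (ix (hd xs))))) xs) (ix (hd xs)) else 0)"
  have "F \<in> E n" by (rule E_I) (auto simp: F_def split: if_splits)
  moreover have "W F ys m = \<psi> ys m" if ys: "ys \<in> V n" and m: "m < 8" for ys m
  proof -
    have y: "ys \<noteq> []" "set ys \<subseteq> carrier G" "length ys = Suc n" "ix (hd ys) = 0" "hd ys \<in> carrier G" 
      using ys by (cases ys; auto simp: V_def)+
    have "hd ys = z [^] ph (hd ys)" using ix_ph(3)[OF y(5)] y(4) by simp
    then have "ix (el m \<otimes> hd ys) = m" using ix_el m by metis
    then have ix: "ix (hd (map ((\<otimes>) (el m)) ys)) = m" using y by (simp add: hd_map_ph)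
    have "map ((\<otimes>) (inv (el m))) (map ((\<otimes>) (el m)) ys) = ys"
      using y m by (simp only: map_mult_map inv_closed el_carrier l_inv map_one)
    then show ?thesis unfolding W_def F_def using ix y m by (auto simp del: map_map)
  qed
  ultimately show ?thesis by blast
qed

lemma W_simps:
  "W (F + K) ys m = W F ys m + W K ys m" "W (F - K) ys m = W F ys m - W K ys m" "W 0 ys m = 0"
  "W (- F) ys m = - W F ys m"
  by (simp_all add: W_def)

lemma W_act:
  assumes "ys \<in> V n" "m < 8"
  shows "W (act p F) ys m = W F ys (pl m)" "W (act q F) ys m = W F ys (ql m)"
proof -
  have ys: "set ys \<subseteq> carrier G" using assms by (auto simp: V_def)
  have "map ((\<otimes>) p) (map ((\<otimes>) (el m)) ys) = map ((\<otimes>) (el (pl m))) ys" 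
       "map ((\<otimes>) q) (map ((\<otimes>) (el m)) ys) = map ((\<otimes>) (el (ql m))) ys" 
    using ys assms(2) by (simp_all only: map_mult_map p q el_carrier p_el q_el)
  then show "W (act p F) ys m = W F ys (pl m)" "W (act q F) ys m = W F ys (ql m)"
    using map_mult_carrier[OF el_carrier[OF assms(2)] ys]
    by (simp_all add: W_def act_def del: map_map set_map)
qed

lemma NQ_words: 
  assumes "F \<in> E n"
  shows "NQ F = F + act p F + act p (act p F) + act p (act p (act p F)) + act q F + act q (act p F)
     + act q (act p (act p F)) + act q (act p (act p (act p F)))"
  using act_one[OF assms] unfolding NQ_def lessThan8 by (simp add: act_act m_assoc algebra_simps)

text \<open>The differentials dual to the resolution of period four of the quaternion group: one generator in
degrees \<open>0\<close> and \<open>3\<close>, two in degree \<open>1\<close> for \<open>p\<close> and \<open>q\<close>, and two in degree \<open>2\<close>, whose rows are the Fox derivatives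
of the relations \<open>p\<^sup>2 = q\<^sup>2\<close> and \<open>p q p = q\<close>. Both relations are palindromic, so that they also hold for the right
action.\<close>

definition dp :: "('a list \<Rightarrow> int) \<Rightarrow> 'a list \<Rightarrow> int" where "dp F = act p F - F"
definition dq :: "('a list \<Rightarrow> int) \<Rightarrow> 'a list \<Rightarrow> int" where "dq F = act q F - F"
definition d1f :: "('a list \<Rightarrow> int) \<Rightarrow> ('a list \<Rightarrow> int) \<Rightarrow> 'a list \<Rightarrow> int" where
  "d1f b c = b + act p b - c - act q c"
definition d1g :: "('a list \<Rightarrow> int) \<Rightarrow> ('a list \<Rightarrow> int) \<Rightarrow> 'a list \<Rightarrow> int" where
  "d1g b c = b + act p (act q b) + act p c - c"
definition d2 :: "('a list \<Rightarrow> int) \<Rightarrow> ('a list \<Rightarrow> int) \<Rightarrow> 'a list \<Rightarrow> int" where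
  "d2 f g = act p f - f - act p (act q g) + g"

lemmas dops = dp_def dq_def d1f_def d1g_def d2_def

lemma dops_E [simp]:
  "F \<in> E n \<Longrightarrow> dp F \<in> E n" "F \<in> E n \<Longrightarrow> dq F \<in> E n" 
  "F \<in> E n \<Longrightarrow> K \<in> E n \<Longrightarrow> d1f F K \<in> E n" "F \<in> E n \<Longrightarrow> K \<in> E n \<Longrightarrow> d1g F K \<in> E n"
  "F \<in> E n \<Longrightarrow> K \<in> E n \<Longrightarrow> d2 F K \<in> E n"
  by (simp_all add: dops)

lemma W_table: 
  assumes "ys \<in> V n"
  shows "W (act p F) ys 0 = W F ys 1" "W (act p F) ys 1 = W F ys 2" "W (act p F) ys 2 = W F ys 3"
    "W (act p F) ys 3 = W F ys 0" "W (act p F) ys 4 = W F ys 5" "W (act p F) ys 5 = W F ys 6" 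
    "W (act p F) ys 6 = W F ys 7" "W (act p F) ys 7 = W F ys 4"
    "W (act q F) ys 0 = W F ys 4" "W (act q F) ys 1 = W F ys 7" "W (act q F) ys 2 = W F ys 6"
    "W (act q F) ys 3 = W F ys 5" "W (act q F) ys 4 = W F ys 2" "W (act q F) ys 5 = W F ys 1" 
    "W (act q F) ys 6 = W F ys 0" "W (act q F) ys 7 = W F ys 3"
  using W_act[OF assms] by (simp_all add: pl_def ql_def)

lemma exact0: 
  assumes "F \<in> E n" "dp F = 0" "dq F = 0" shows "F \<in> EI {p, q} n"
  using assms by (simp add: EI_def dops)

text \<open>The preimages below are given by the entries of an integral contracting homotopy, computed on the eight points of
an orbit by elimination with pivots \<open>\<plusminus>1\<close>.\<close>

lemma exact1:
  assumes E: "b \<in> E n" "c \<in> E n" and 0: "d1f b c = 0" "d1g b c = 0"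
  shows "\<exists>e\<in>E n. dp e = b \<and> dq e = c"
proof -
  obtain e where e: "e \<in> E n" and We: "\<And>ys m. ys \<in> V n \<Longrightarrow> m < 8 \<Longrightarrow> W e ys m = 
      [0, W b ys 0, - W b ys 2 - W b ys 3, - W b ys 3, W c ys 0, W b ys 0 - W c ys 5, - W c ys 6, 
       - W b ys 3 - W c ys 7] ! m"
    using W_lift[of n "\<lambda>ys m. [0, W b ys 0, - W b ys 2 - W b ys 3, - W b ys 3, W c ys 0, W b ys 0 - W c ys 5, - W c ys 6, 
       - W b ys 3 - W c ys 7] ! m"] by blast
  have *: "W (dp e) ys m = W b ys m \<and> W (dq e) ys m = W c ys m" if ys: "ys \<in> V n" and m: "m < 8" for ys m
  proof -
    have h: "W (d1f b c) ys m = 0 \<and> W (d1g b c) ys m = 0" for m by (simp add: 0 W_simps)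
    note h8 = h[of 0] h[of 1] h[of 2] h[of 3] h[of 4] h[of 5] h[of 6] h[of 7]
    note H = h8[unfolded dops W_simps W_table[OF ys]]
    show ?thesis using m unfolding lt8
      apply (elim disjE)
      apply (simp_all add: dops W_simps W_table[OF ys] We[OF ys] del: One_nat_def)
      using H apply linarith+
      done
  qed
  have "dp e = b" by (rule W_eqI[of _ n]) (use * e E in auto)
  moreover have "dq e = c" by (rule W_eqI[of _ n]) (use * e E in auto)
  ultimately show ?thesis using e by blast
qed

lemma exact2:
  assumes E: "f \<in> E n" "g \<in> E n" and 0: "d2 f g = 0"
  shows "\<exists>b\<in>E n. \<exists>c\<in>E n. d1f b c = f \<and> d1g b c = g"
proof -
  obtain b where b: "b \<in> E n" and Wb: "\<And>ys m. ys \<in> V n \<Longrightarrow> m < 8 \<Longrightarrow> W b ys m = 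
      [0, W f ys 0, - W f ys 7 + W g ys 7, W g ys 3, 0, W f ys 4, - W f ys 0 + W g ys 0 + W g ys 1, 0] ! m"
    using W_lift[of n "\<lambda>ys m. [0, W f ys 0, - W f ys 7 + W g ys 7, W g ys 3, 0, W f ys 4, - W f ys 0 + W g ys 0 + W g ys 1, 0] ! m"]
    by blast
  obtain c where c: "c \<in> E n" and Wc: "\<And>ys m. ys \<in> V n \<Longrightarrow> m < 8 \<Longrightarrow> W c ys m = 
      [0, W g ys 0, 0, 0, 0, - W f ys 3 + W g ys 3, - W f ys 0 - W f ys 6 + W g ys 0 + W g ys 1, - W f ys 7] ! m"
    using W_lift[of n "\<lambda>ys m. [0, W g ys 0, 0, 0, 0, - W f ys 3 + W g ys 3, - W f ys 0 - W f ys 6 + W g ys 0 + W g ys 1, - W f ys 7] ! m"]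
    by blast
  have *: "W (d1f b c) ys m = W f ys m \<and> W (d1g b c) ys m = W g ys m" if ys: "ys \<in> V n" and m: "m < 8" for ys m
  proof -
    have h: "W (d2 f g) ys m = 0" for m by (simp add: 0 W_simps)
    note h8 = h[of 0] h[of 1] h[of 2] h[of 3] h[of 4] h[of 5] h[of 6] h[of 7]
    note H = h8[unfolded dops W_simps W_table[OF ys]]
    show ?thesis using m unfolding lt8
      apply (elim disjE)
      apply (simp_all add: dops W_simps W_table[OF ys] Wb[OF ys] Wc[OF ys] del: One_nat_def)
      using H apply linarith+
      done
  qed
  have "d1f b c = f" by (rule W_eqI[of _ n]) (use * b c E in auto)
  moreover have "d1g b c = g" by (rule W_eqI[of _ n]) (use * b c E in auto)
  ultimately show ?thesis using b c by blast
qed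

lemma exact3:
  assumes E: "a \<in> E n" and 0: "NQ a = 0"
  shows "\<exists>f\<in>E n. \<exists>g\<in>E n. d2 f g = a"
proof -
  obtain f where f: "f \<in> E n" and Wf: "\<And>ys m. ys \<in> V n \<Longrightarrow> m < 8 \<Longrightarrow> W f ys m = 
      [0, 0, W a ys 1, - W a ys 3, - W a ys 4, 0, W a ys 5, W a ys 5 + W a ys 6] ! m"
    using W_lift[of n "\<lambda>ys m. [0, 0, W a ys 1, - W a ys 3, - W a ys 4, 0, W a ys 5, W a ys 5 + W a ys 6] ! m"]
    by blast
  obtain g where g: "g \<in> E n" and Wg: "\<And>ys m. ys \<in> V n \<Longrightarrow> m < 8 \<Longrightarrow> W g ys m = 
      [0, 0, W a ys 1 + W a ys 2 + W a ys 3, 0, 0, 0, 0, - W a ys 0] ! m"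
    using W_lift[of n "\<lambda>ys m. [0, 0, W a ys 1 + W a ys 2 + W a ys 3, 0, 0, 0, 0, - W a ys 0] ! m"]
    by blast
  have *: "W (d2 f g) ys m = W a ys m" if ys: "ys \<in> V n" and m: "m < 8" for ys m
  proof -
    \<comment> \<open>A norm is constant on orbits, so its value at the base point is the only
      equation.\<close>
    have h: "W (NQ a) ys 0 = 0" by (simp add: 0 W_simps)
    note H = h[unfolded NQ_words[OF E] W_simps W_table[OF ys]]
    show ?thesis using m unfolding lt8
      apply (elim disjE)
      apply (simp_all add: dops W_simps W_table[OF ys] Wf[OF ys] Wg[OF ys] del: One_nat_def)
      using H apply linarith+
      done
  qed
  have "d2 f g = a" by (rule W_eqI[of _ n]) (use * f g E in auto)
  then show ?thesis using f g by blast
qed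

text \<open>An invariant is constant on each orbit, hence the norm of its value placed at the base
  point alone.\<close>

lemma exact4:
  assumes F: "F \<in> EI {p, q} n"
  shows "\<exists>a\<in>E n. NQ a = F"
proof -
  have F': "act p F = F" "act q F = F" "F \<in> E n" using F by (auto simp: EI_def)
  obtain a where a: "a \<in> E n" and Wa: "\<And>ys m. ys \<in> V n \<Longrightarrow> m < 8 \<Longrightarrow> W a ys m = 
      [W F ys 0, 0, 0, 0, 0, 0, 0, 0] ! m"
    using W_lift[of n "\<lambda>ys m. [W F ys 0, 0, 0, 0, 0, 0, 0, 0] ! m"] by blast
  have *: "W (NQ a) ys m = W F ys m" if ys: "ys \<in> V n" and m: "m < 8" for ys m
  proof -
    note H = W_table(1-16)[OF ys, of F, unfolded F']
    show ?thesis using m unfolding lt8 NQ_words[OF a]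
      apply (elim disjE)
      apply (simp_all add: W_simps W_table[OF ys] Wa[OF ys] del: One_nat_def)
      using H apply linarith+
      done
  qed
  have "NQ a = F" by (rule W_eqI[of _ n]) (use * a F' in auto)
  then show ?thesis using a by blast
qed

text \<open>\<open>d2\<close> records the identity between the two defining relations: (p - 1) times
  the first agrees with (pq - 1) times the second, up to the reversal due to the right action. The
  tables verify it at the eight points of an orbit.\<close>

lemma d2_d1:
  assumes "b \<in> E n" "c \<in> E n" shows "d2 (d1f b c) (d1g b c) = 0"
proof (rule W_eqI[of _ n])
  fix ys :: "'a list" and m :: nat assume ys: "ys \<in> V n" and m: "m < 8"
  have "\<forall>m<8. W (d2 (d1f b c) (d1g b c)) ys m = 0"
    unfolding lt8 by (auto simp: dops act_add act_diff W_simps W_table[OF ys] simp del: One_nat_def)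
  then show "W (d2 (d1f b c) (d1g b c)) ys m = W 0 ys m" using m by (simp add: W_simps)
qed (use assms in auto)

lemma d1_d0:
  assumes "e \<in> E n" shows "d1f (dp e) (dq e) = 0" "d1g (dp e) (dq e) = 0"
proof -
  have "\<forall>m<8. W (d1f (dp e) (dq e)) ys m = 0 \<and> W (d1g (dp e) (dq e)) ys m = 0" if ys: "ys \<in> V n" for ys
    unfolding lt8 by (auto simp: dops act_add act_diff W_simps W_table[OF ys] simp del: One_nat_def)
  then show "d1f (dp e) (dq e) = 0" "d1g (dp e) (dq e) = 0" 
    using assms by (auto intro!: W_eqI[of _ n] simp: W_simps)
qed

lemma NQ_d2: "NQ (d2 f g) = 0"
  by (simp add: d2_def NQ_add NQ_diff NQ_act)

end

section \<open>Cocycles and coboundaries of invariant cochains\<close>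

context group
begin

lemma sc_sign: "sc ((-1) ^ n) (sc ((-1) ^ n) F) = F"
proof -
  have "(-1) ^ n * (-1) ^ n = (1::int)" by (simp add: power_mult_distrib[symmetric])
  then show ?thesis by (simp only: sc_simps)
qed

text \<open>Modulo \<open>Bd H n\<close> these represent the degree \<open>n\<close> cohomology of
  the subgroup generated by \<open>H\<close>. Since all subgroups share the complex
  \<open>E\<close>, restricting a class means regarding the same cochain as invariant under fewer
  elements.\<close>

definition Zc :: "'a set \<Rightarrow> nat \<Rightarrow> ('a list \<Rightarrow> int) set" where
  "Zc H n = {F \<in> EI H n. d F = 0}"

definition Bd :: "'a set \<Rightarrow> nat \<Rightarrow> ('a list \<Rightarrow> int) set" where
  "Bd H n = (case n of 0 \<Rightarrow> {0} | Suc m \<Rightarrow> d ` EI H m)"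

definition unit0 :: "'a list \<Rightarrow> int" where
  "unit0 xs = (if length xs = 1 \<and> set xs \<subseteq> carrier G then 1 else 0)"

lemma unit0_E [simp]: "unit0 \<in> E 0"
  by (rule E_I) (auto simp: unit0_def split: if_splits)

lemma hcup_unit0: "F \<in> E n \<Longrightarrow> hcup n F unit0 = F"
proof (rule E_eqI[of _ n])
  fix xs :: "'a list" assume F: "F \<in> E n" and xs: "length xs = Suc n" "set xs \<subseteq> carrier G"
  then have "set (drop n xs) \<subseteq> carrier G" by (meson order_trans set_drop_subset)
  then show "hcup n F unit0 xs = F xs" using xs by (simp add: hcup_def unit0_def)
qed (use E_hcup[of F n unit0 0] in auto)

lemma Bd_Suc: "Bd H (Suc n) = d ` EI H n"
  by (simp add: Bd_def)

lemma Bd_0: "Bd H 0 = {0}"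
  by (simp add: Bd_def)

lemma Bd_zero [simp]: "0 \<in> Bd H n"
proof (cases n)
  case (Suc m)
  have "0 = d 0" "0 \<in> EI H m" by simp_all
  then show ?thesis unfolding Suc Bd_Suc by blast
qed (simp add: Bd_0)

lemma Bd_add: "F \<in> Bd H n \<Longrightarrow> K \<in> Bd H n \<Longrightarrow> F + K \<in> Bd H n"
  by (cases n) (auto simp: Bd_def d_add[symmetric] intro: EI_add)

lemma Bd_diff: "F \<in> Bd H n \<Longrightarrow> K \<in> Bd H n \<Longrightarrow> F - K \<in> Bd H n"
  by (cases n) (auto simp: Bd_def d_diff[symmetric] intro: EI_diff)

lemma Bd_sc: "F \<in> Bd H n \<Longrightarrow> sc c F \<in> Bd H n"
  by (cases n) (auto simp: Bd_def d_sc[symmetric] sc_simps intro: EI_sc)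

lemma Bd_mono: "H \<subseteq> K \<Longrightarrow> F \<in> Bd K n \<Longrightarrow> F \<in> Bd H n"
  by (cases n) (auto simp: Bd_def dest: EI_mono)

lemma Zc_E: "F \<in> Zc H n \<Longrightarrow> F \<in> E n"
  and Zc_EI: "F \<in> Zc H n \<Longrightarrow> F \<in> EI H n"
  and Zc_d: "F \<in> Zc H n \<Longrightarrow> d F = 0"
  by (auto simp: Zc_def EI_E)

lemma Zc_diff: "F \<in> Zc H n \<Longrightarrow> K \<in> Zc H n \<Longrightarrow> F - K \<in> Zc H n"
  by (auto simp: Zc_def d_diff intro: EI_diff)

lemma Zc_add: "F \<in> Zc H n \<Longrightarrow> K \<in> Zc H n \<Longrightarrow> F + K \<in> Zc H n"
  by (auto simp: Zc_def d_add intro: EI_add)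

lemma Zc_sc: "F \<in> Zc H n \<Longrightarrow> sc c F \<in> Zc H n"
  by (auto simp: Zc_def d_sc sc_simps intro: EI_sc)

lemma Zc_mono: "H \<subseteq> K \<Longrightarrow> F \<in> Zc K n \<Longrightarrow> F \<in> Zc H n"
  by (auto simp: Zc_def dest: EI_mono)

lemma Zc_hcup: "H \<subseteq> carrier G \<Longrightarrow> F \<in> Zc H n \<Longrightarrow> K \<in> Zc H m \<Longrightarrow> hcup n F K \<in> Zc H (n + m)"
  by (auto simp: Zc_def d_hcup[OF EI_E EI_E] EI_hcup hcup_simps sc_simps)

lemma Bd_hcup_left:
  assumes "H \<subseteq> carrier G" "F \<in> Bd H n" "K \<in> Zc H m"
  shows "hcup n F K \<in> Bd H (n + m)"
proof (cases n)
  case 0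
  then show ?thesis using assms by (simp add: Bd_0 hcup_simps)
next
  case (Suc k)
  then obtain b where b: "b \<in> EI H k" "F = d b" using assms by (auto simp: Bd_Suc)
  have "hcup n F K = d (hcup k b K)"
    using d_hcup[OF EI_E[OF b(1)] Zc_E[OF assms(3)]] Zc_d[OF assms(3)] Suc b by (simp add: hcup_simps sc_simps)
  then show ?thesis using EI_hcup[OF assms(1) b(1) Zc_EI[OF assms(3)]] Suc by (simp add: Bd_Suc)
qed

lemma Bd_hcup_right:
  assumes "H \<subseteq> carrier G" "F \<in> Zc H n" "K \<in> Bd H m"
  shows "hcup n F K \<in> Bd H (n + m)"
proof (cases m)
  case 0
  then show ?thesis using assms by (simp add: Bd_0 hcup_simps)
next
  case (Suc k)
  then obtain b where b: "b \<in> EI H k" "K = d b" using assms by (auto simp: Bd_Suc)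
  have "d (sc ((-1) ^ n) (hcup n F b)) = hcup n F K"
    using d_hcup[OF Zc_E[OF assms(2)] EI_E[OF b(1)]] Zc_d[OF assms(2)] b 
    by (simp add: d_sc hcup_simps sc_simps(6) sc_sign)
  moreover have "sc ((-1) ^ n) (hcup n F b) \<in> EI H (n + k)"
    using EI_hcup[OF assms(1) Zc_EI[OF assms(2)] b(1)] by (rule EI_sc)
  ultimately have "hcup n F K \<in> d ` EI H (n + k)" by (metis image_eqI)
  then show ?thesis using Suc by (simp add: Bd_Suc)
qed

lemma contr_ex: "F \<in> E (Suc n) \<Longrightarrow> d F = 0 \<Longrightarrow> \<exists>a\<in>E n. d a = F"
  using contr_cocycle E_contr by metis

text \<open>A cocycle of degree 0 is constant, hence fixed by all of G. This is what ends the chases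
  below at degree 0, where a cocycle has no primitive.\<close>

lemma act_const:
  assumes "F \<in> E 0" "d F = 0" "h \<in> carrier G" shows "act h F = F"
proof (rule E_eqI[of _ 0])
  fix xs :: "'a list" assume "length xs = Suc 0" "set xs \<subseteq> carrier G"
  then obtain x where "xs = [x]" "x \<in> carrier G" by (cases xs) auto
  then show "act h F xs = F xs" 
    using assms(3) cocycle_0_const[OF assms(1,2), of x] cocycle_0_const[OF assms(1,2), of "h \<otimes> x"]
    by (simp add: act_def)
qed (use assms in auto)

lemma const_eq:
  assumes "F \<in> E 0" "d F = 0" shows "F = sc (F [\<one>]) unit0"
proof (rule E_eqI[of _ 0])
  fix xs :: "'a list" assume "length xs = Suc 0" "set xs \<subseteq> carrier G"
  then obtain x where "xs = [x]" "x \<in> carrier G" by (cases xs) auto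
  then show "F xs = sc (F [\<one>]) unit0 xs" 
    using cocycle_0_const[OF assms, of x] by (simp add: sc_def unit0_def)
qed (use assms in auto)

lemma unit0_Zc: "H \<subseteq> carrier G \<Longrightarrow> unit0 \<in> Zc H 0"
proof -
  assume H: "H \<subseteq> carrier G"
  have "d unit0 = 0"
  proof (rule E_eqI[of _ 1])
    fix xs :: "'a list" assume "length xs = Suc 1" "set xs \<subseteq> carrier G"
    then obtain x y where "xs = [x, y]" "x \<in> carrier G" "y \<in> carrier G" by (cases xs; cases "tl xs") auto
    then show "d unit0 xs = 0 xs" by (simp add: d_def unit0_def)
  qed (use E_d[of unit0 0] in auto)
  then show ?thesis using H act_const[of unit0] by (auto simp: Zc_def EI_def)
qed

end

context q8_cyclic
begin

section \<open>Periodicity of the cohomology of the cyclic group\<close>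

text \<open>A zigzag through the exact sequence of C that links a class \<open>h\<close> of degree n
  + 2 with a class \<open>f\<close> of degree n. Keeping it as a relation avoids choices of
  \<open>a\<close> and \<open>b\<close>; the lemmas below show that it induces the
  periodicity.\<close>

definition cchain :: "nat \<Rightarrow> ('a list \<Rightarrow> int) \<Rightarrow> ('a list \<Rightarrow> int) \<Rightarrow> bool" where
  "cchain n h f \<longleftrightarrow> (\<exists>a\<in>E (Suc n). \<exists>b\<in>E n. d a = h \<and> act z a - a = d b \<and> NZ b = f)"

lemma cchain_down:
  assumes h: "h \<in> Zc {z} (Suc (Suc n))"
  shows "\<exists>f\<in>Zc {z} n. cchain n h f"
proof -
  obtain a where a: "a \<in> E (Suc n)" "d a = h" using contr_ex[OF Zc_E[OF h] Zc_d[OF h]] by blast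
  have "d (act z a - a) = 0" using a EI_act[OF Zc_EI[OF h]] by (simp add: d_diff d_act)
  then obtain b where b: "b \<in> E n" "d b = act z a - a" using contr_ex[of "act z a - a" n] a by auto
  have "d (NZ b) = 0" using b a(1) by (simp add: d_NZ NZ_diff NZ_act_z)
  then have "NZ b \<in> Zc {z} n" using b NZ_EI_z by (simp add: Zc_def)
  then show ?thesis using a b unfolding cchain_def by metis
qed

lemma cchain_diff:
  assumes "cchain n h f" "cchain n h' f'" shows "cchain n (h - h') (f - f')"
proof -
  obtain a b a' b' where "a \<in> E (Suc n)" "b \<in> E n" "d a = h" "act z a - a = d b" "NZ b = f"
     "a' \<in> E (Suc n)" "b' \<in> E n" "d a' = h'" "act z a' - a' = d b'" "NZ b' = f'"
    using assms unfolding cchain_def by blast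
  then show ?thesis unfolding cchain_def
    by (intro bexI[of _ "a - a'"] bexI[of _ "b - b'"])
      (auto simp: d_diff NZ_diff act_diff algebra_simps)
qed

text \<open>If \<open>f\<close> bounds, it is the norm of a cocycle \<open>k\<close>, so
  \<open>b - k\<close> has norm 0 and equals (z - 1) e. Then \<open>a - d e\<close> is an invariant
  primitive of \<open>h\<close>.\<close>

lemma cchain_Bd_left:
  assumes "cchain n h f" "f \<in> Bd {z} n" shows "h \<in> Bd {z} (Suc (Suc n))"
proof -
  obtain a b where ab: "a \<in> E (Suc n)" "b \<in> E n" "d a = h" "act z a - a = d b" "NZ b = f"
    using assms unfolding cchain_def by blast
  obtain k where k: "k \<in> E n" "d k = 0" "NZ k = f"
  proof (cases n)
    case 0
    then show ?thesis using assms(2) that[of 0] by (simp add: Bd_0)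
  next
    case (Suc m)
    then obtain c where c: "c \<in> EI {z} m" "f = d c" using assms(2) by (auto simp: Bd_Suc)
    obtain e where "e \<in> E m" "NZ e = c" using NZ_surj[OF c(1)] by blast
    moreover from this have "NZ (d e) = f" using c(2) d_NZ[of e] by simp
    ultimately show ?thesis using that[of "d e"] Suc by simp
  qed
  have "NZ (b - k) = 0" using ab k by (simp add: NZ_diff)
  then obtain e where e: "e \<in> E n" "act z e - e = b - k" using NZ_kernel[of "b - k" n] ab k by auto
  have "act z a = d b + a" "act z e = b - k + e" using ab(4) e(2) by (simp_all add: diff_eq_eq)
  then have "act z (a - d e) = a - d e"
    using k(2) by (simp add: act_diff d_act[symmetric] d_add d_diff)
  then have "a - d e \<in> EI {z} (Suc n)" using ab e by (simp add: EI_def)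
  moreover have "d (a - d e) = h" using ab by (simp add: d_diff)
  ultimately show ?thesis by (auto simp: Bd_Suc)
qed

text \<open>Subtracting an invariant primitive \<open>k\<close> from \<open>a\<close> leaves a
  coboundary \<open>d c\<close>, and \<open>b\<close> corrected by (z - 1) c is a cocycle
  \<open>e\<close> that still has norm \<open>f\<close>. In positive degree \<open>e\<close> bounds,
  hence so does its norm. In degree 0 it is constant and its norm is M times it, which explains the
  separate case.\<close>

lemma cchain_Bd_right:
  assumes "cchain n h f" "h \<in> Bd {z} (Suc (Suc n))"
  shows "if n = 0 then int M dvd f [\<one>] else f \<in> Bd {z} n"
proof -
  obtain a b where ab: "a \<in> E (Suc n)" "b \<in> E n" "d a = h" "act z a - a = d b" "NZ b = f"
    using assms unfolding cchain_def by blast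
  obtain k where k: "k \<in> EI {z} (Suc n)" "d k = h" using assms(2) by (auto simp: Bd_Suc)
  have kE: "k \<in> E (Suc n)" "act z k = k" using k by (auto simp: EI_def)
  have "d (a - k) = 0" using ab k by (simp add: d_diff)
  then obtain c where c: "c \<in> E n" "d c = a - k" using contr_ex[of "a - k" n] ab kE by auto
  define e where "e = b - (act z c - c)"
  have e: "e \<in> E n" using ab c by (simp add: e_def)
  have "d (act z c - c) = act z a - a" using c kE by (simp add: d_diff d_act act_diff)
  then have de: "d e = 0" using ab by (simp add: e_def d_diff)
  have NZe: "NZ e = f" using ab c by (simp add: e_def NZ_diff NZ_act_z)
  show ?thesis
  proof (cases n)
    case 0
    then have "e \<in> EI {z} 0" using e de act_const by (simp add: EI_def)
    then have "f = sc (int M) e" using NZ_inv NZe by blast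
    then show ?thesis using 0 by (simp add: sc_def)
  next
    case (Suc m)
    then obtain g where "g \<in> E m" "d g = e" using contr_ex e de by blast
    then have "f = d (NZ g)" "NZ g \<in> EI {z} m" using NZe NZ_EI_z by (auto simp: d_NZ)
    then show ?thesis using Suc by (simp add: Bd_Suc)
  qed
qed

lemma hcup_act_right:
  "F \<in> E n \<Longrightarrow> K \<in> E m \<Longrightarrow> h \<in> carrier G \<Longrightarrow> act h F = F \<Longrightarrow> hcup n F (act h K) = act h (hcup n F K)"
  by (simp add: act_hcup)

lemma hcup_sum_right: "hcup n F (sum K I) = (\<Sum>i\<in>I. hcup n F (K i))"
  using sum_comp_morphism[of "hcup n F" K I] by (simp add: hcup_simps comp_def)

lemma hcup_sum_left: "hcup n (sum K I) F = (\<Sum>i\<in>I. hcup n (K i) F)"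
  using sum_comp_morphism[of "\<lambda>x. hcup n x F" K I] by (simp add: hcup_simps comp_def)

text \<open>Left multiplication by an invariant cocycle carries the zigzag of \<open>x\<close> to
  one for the product; the sign on \<open>a\<close> undoes the one from the Leibniz rule. Thus the
  periodicity is the cup product with any class linked to the unit.\<close>

lemma cchain_hcup:
  assumes F: "F \<in> Zc {z} n" and x: "cchain 0 x unit0"
  shows "cchain n (hcup n F x) F"
proof -
  obtain a b where ab: "a \<in> E 1" "b \<in> E 0" "d a = x" "act z a - a = d b" "NZ b = unit0"
    using x unfolding cchain_def by auto
  have FE: "F \<in> E n" "act z F = F" "d F = 0" using F by (auto simp: Zc_def EI_def)
  have Fk: "act (z [^] (k::nat)) F = F" for k using FE by (intro act_pow_inv) auto
  have "hcup n F a \<in> E (Suc n)" "hcup n F b \<in> E n" using E_hcup[OF FE(1) ab(1)] E_hcup[OF FE(1) ab(2)] by simp_all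
  moreover have "d (sc ((-1) ^ n) (hcup n F a)) = hcup n F x"
    using ab FE by (simp add: d_sc d_hcup[OF FE(1) ab(1)] hcup_simps sc_simps(6) sc_sign)
  moreover have "act z (sc ((-1) ^ n) (hcup n F a)) - sc ((-1) ^ n) (hcup n F a) = d (hcup n F b)"
  proof -
    have "act z (hcup n F a) = hcup n F (act z a)" using hcup_act_right[OF FE(1) ab(1) z FE(2)] by simp
    then have "act z (sc ((-1) ^ n) (hcup n F a)) - sc ((-1) ^ n) (hcup n F a) = sc ((-1) ^ n) (hcup n F (act z a - a))"
      by (simp add: act_sc hcup_simps(4) sc_simps(2))
    also have "\<dots> = d (hcup n F b)"
      using ab(4) d_hcup[OF FE(1) ab(2)] FE(3) by (simp add: hcup_simps(7))
    finally show ?thesis .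
  qed
  moreover have "NZ (hcup n F b) = F"
  proof -
    have "NZ (hcup n F b) = hcup n F (NZ b)"
      unfolding NZ_def hcup_sum_right using hcup_act_right[OF FE(1) ab(2) nat_pow_closed[OF z] Fk] by simp
    then show ?thesis using ab hcup_unit0 FE by simp
  qed
  ultimately show ?thesis unfolding cchain_def
    by (intro bexI[of _ "sc ((-1) ^ n) (hcup n F a)"] bexI[of _ "hcup n F b"]) auto
qed

lemma cyc_surj:
  assumes x: "cchain 0 x unit0" and h: "h \<in> Zc {z} (Suc (Suc n))"
  shows "\<exists>f\<in>Zc {z} n. h - hcup n f x \<in> Bd {z} (Suc (Suc n))"
proof -
  obtain f where f: "f \<in> Zc {z} n" "cchain n h f" using cchain_down[OF h] by blast
  have "cchain n (h - hcup n f x) (f - f)" using cchain_diff[OF f(2) cchain_hcup[OF f(1) x]] .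
  then show ?thesis using f(1) cchain_Bd_left[of n "h - hcup n f x" 0] by auto
qed

lemma cyc_inj:
  assumes x: "cchain 0 x unit0" and f: "f \<in> Zc {z} n" "hcup n f x \<in> Bd {z} (Suc (Suc n))"
  shows "if n = 0 then int M dvd f [\<one>] else f \<in> Bd {z} n"
  using cchain_Bd_right[OF cchain_hcup[OF f(1) x] f(2)] .

text \<open>For a primitive \<open>c\<close>, the cochain (z - 1) c is a constant whose norm
  telescopes to 0. Its norm is also M times it, so it vanishes and \<open>c\<close> is
  invariant.\<close>

lemma cyc_H1:
  assumes F: "F \<in> Zc {z} 1" shows "F \<in> Bd {z} 1"
proof -
  obtain c where c: "c \<in> E 0" "d c = F" using contr_ex Zc_E[OF F] Zc_d[OF F] by auto
  define e where "e = act z c - c"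
  have "d e = 0" using c EI_act[OF Zc_EI[OF F]] by (simp add: e_def d_diff d_act)
  moreover have "e \<in> E 0" using c by (simp add: e_def)
  ultimately have e: "e \<in> EI {z} 0" using act_const by (simp add: EI_def)
  have "sc (int M) e = 0" using NZ_inv[OF e] c by (simp add: e_def NZ_diff NZ_act_z)
  then have "e = 0" by (auto simp: sc_def fun_eq_iff)
  then have "c \<in> EI {z} 0" using c by (simp add: EI_def e_def)
  then show ?thesis using c by (auto simp: Bd_Suc)
qed

lemma cyc_H3:
  assumes F: "F \<in> Zc {z} 3" shows "F \<in> Bd {z} 3"
proof -
  have 3: "3 = Suc (Suc 1)" by simp
  obtain f where "f \<in> Zc {z} 1" "cchain 1 F f" using cchain_down[of F 1] F 3 by auto
  then show ?thesis using cchain_Bd_left cyc_H1 3 by metis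
qed

section \<open>Periodicity of the cohomology of the quaternion group\<close>

lemma d_dops: "d (dp F) = dp (d F)" "d (dq F) = dq (d F)" "d (d1f F K) = d1f (d F) (d K)"
  "d (d1g F K) = d1g (d F) (d K)" "d (d2 F K) = d2 (d F) (d K)"
  by (simp_all add: dops d_add d_diff d_act)

lemma dops_diff: "dp (F - F') = dp F - dp F'" "dq (F - F') = dq F - dq F'"
  "d1f (F - F') (K - K') = d1f F K - d1f F' K'" "d1g (F - F') (K - K') = d1g F K - d1g F' K'"
  "d2 (F - F') (K - K') = d2 F K - d2 F' K'"
  by (simp_all add: dops act_add act_diff algebra_simps)

lemma dops_sc: "dp (sc c F) = sc c (dp F)" "dq (sc c F) = sc c (dq F)"
  "d1f (sc c F) (sc c K) = sc c (d1f F K)" "d1g (sc c F) (sc c K) = sc c (d1g F K)"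
  "d2 (sc c F) (sc c K) = sc c (d2 F K)"
  by (simp_all add: dops act_sc sc_simps)

lemma dops_hcup:
  assumes "F \<in> EI {p, q} n" "K \<in> E m" "L \<in> E m"
  shows "dp (hcup n F K) = hcup n F (dp K)" "dq (hcup n F K) = hcup n F (dq K)"
    "d1f (hcup n F K) (hcup n F L) = hcup n F (d1f K L)" "d1g (hcup n F K) (hcup n F L) = hcup n F (d1g K L)"
    "d2 (hcup n F K) (hcup n F L) = hcup n F (d2 K L)"
proof -
  have F: "F \<in> E n" "act p F = F" "act q F = F" using assms by (auto simp: EI_def)
  have *: "act p (hcup n F K) = hcup n F (act p K)" "act q (hcup n F K) = hcup n F (act q K)" 
     if "K \<in> E m" for K
    using hcup_act_right[OF F(1) that] F by auto
  show "dp (hcup n F K) = hcup n F (dp K)" "dq (hcup n F K) = hcup n F (dq K)"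
    "d1f (hcup n F K) (hcup n F L) = hcup n F (d1f K L)" "d1g (hcup n F K) (hcup n F L) = hcup n F (d1g K L)"
    "d2 (hcup n F K) (hcup n F L) = hcup n F (d2 K L)"
    using assms by (simp_all add: dops * hcup_simps)
qed

text \<open>The analogue of \<open>cchain\<close> for the resolution of length four; the pairs
  \<open>b, b'\<close> and \<open>c, c'\<close> belong to its two generators and its two
  relations.\<close>

definition qchain :: "nat \<Rightarrow> ('a list \<Rightarrow> int) \<Rightarrow> ('a list \<Rightarrow> int) \<Rightarrow> bool" where
  "qchain n h f \<longleftrightarrow> (\<exists>a\<in>E (Suc (Suc (Suc n))). \<exists>b\<in>E (Suc (Suc n)). \<exists>b'\<in>E (Suc (Suc n)).
     \<exists>c\<in>E (Suc n). \<exists>c'\<in>E (Suc n). \<exists>e\<in>E n. d a = h \<and> dp a = d b \<and> dq a = d b' \<and>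
     d1f b b' = d c \<and> d1g b b' = d c' \<and> d2 c c' = d e \<and> NQ e = f)"

lemma qchainI:
  assumes "a \<in> E (Suc (Suc (Suc n)))" "b \<in> E (Suc (Suc n))" "b' \<in> E (Suc (Suc n))"
    "c \<in> E (Suc n)" "c' \<in> E (Suc n)" "e \<in> E n"
    "d a = h" "dp a = d b" "dq a = d b'" "d1f b b' = d c" "d1g b b' = d c'" "d2 c c' = d e" "NQ e = f"
  shows "qchain n h f"
  unfolding qchain_def using assms by blast

text \<open>The descent without its last lift. In degree 3 that lift does not exist, because
  \<open>d2 c c'\<close> is then a cocycle of degree 0; the two cases part here.\<close>

lemma qchain_down_aux:
  assumes h: "h \<in> Zc {p, q} (Suc (Suc (Suc k)))"
  obtains a b b' c c' where "a \<in> E (Suc (Suc k))" "b \<in> E (Suc k)" "b' \<in> E (Suc k)"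
     "c \<in> E k" "c' \<in> E k" "d a = h" "dp a = d b" "dq a = d b'"
     "d1f b b' = d c" "d1g b b' = d c'" "d (d2 c c') = 0"
proof -
  have hh: "dp h = 0" "dq h = 0" using Zc_EI[OF h] by (auto simp: EI_def dops)
  obtain a where a: "a \<in> E (Suc (Suc k))" "d a = h" using contr_ex[OF Zc_E[OF h] Zc_d[OF h]] by blast
  have "d (dp a) = 0" "d (dq a) = 0" using a hh by (simp_all add: d_dops)
  then obtain b b' where b: "b \<in> E (Suc k)" "d b = dp a" "b' \<in> E (Suc k)" "d b' = dq a"
    using contr_ex[of "dp a" "Suc k"] contr_ex[of "dq a" "Suc k"] a by auto
  have "d (d1f b b') = 0" "d (d1g b b') = 0" using a(1) b by (simp_all add: d_dops d1_d0)
  then obtain c c' where c: "c \<in> E k" "d c = d1f b b'" "c' \<in> E k" "d c' = d1g b b'"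
    using contr_ex[of "d1f b b'" k] contr_ex[of "d1g b b'" k] b by auto
  have "d (d2 c c') = 0" using b c by (simp add: d_dops d2_d1)
  then show ?thesis using that a b c by metis
qed

text \<open>Once \<open>d2 c c'\<close> vanishes, exactness climbs back: \<open>c, c'\<close> come
  from \<open>w, w'\<close>, then the corrected \<open>b, b'\<close> from \<open>v\<close>, and
  \<open>a - d v\<close> is invariant with the same coboundary as \<open>a\<close>.\<close>

lemma qchain_tail:
  assumes E: "a \<in> E (Suc (Suc k))" "b \<in> E (Suc k)" "b' \<in> E (Suc k)" "c \<in> E k" "c' \<in> E k"
    and "dp a = d b" "dq a = d b'" "d1f b b' = d c" "d1g b b' = d c'" "d2 c c' = 0"
  shows "d a \<in> Bd {p, q} (Suc (Suc (Suc k)))"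
proof -
  obtain w w' where w: "w \<in> E k" "w' \<in> E k" "d1f w w' = c" "d1g w w' = c'" 
    using exact2[OF E(4,5) assms(10)] by blast
  have "d1f (b - d w) (b' - d w') = 0" "d1g (b - d w) (b' - d w') = 0"
    using w assms by (simp_all add: dops_diff d_dops[symmetric])
  then obtain v where v: "v \<in> E (Suc k)" "dp v = b - d w" "dq v = b' - d w'"
    using exact1[of "b - d w" "Suc k" "b' - d w'"] E w by auto
  have "dp (a - d v) = 0" "dq (a - d v) = 0"
    using v assms by (simp_all add: dops_diff d_dops[symmetric] d_diff)
  then have "a - d v \<in> EI {p, q} (Suc (Suc k))" using exact0 E v by simp
  moreover have "d a = d (a - d v)" by (simp add: d_diff)
  ultimately show ?thesis by (auto simp: Bd_Suc)
qed

lemma NQ_const: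
  assumes "e \<in> E 0" "d e = 0" shows "NQ e = sc 8 e"
  using assms act_const[OF assms] NQ_inv[of e 0] by (simp add: EI_def)

text \<open>At the bottom of the descent \<open>d2 c c'\<close> is a constant. The norm kills it
  because it lies in the image of \<open>d2\<close>, and multiplies it by 8 because it is constant,
  so it is 0.\<close>

lemma q8_H3:
  assumes h: "h \<in> Zc {p, q} 3" shows "h \<in> Bd {p, q} 3"
proof -
  have 3: "3 = Suc (Suc (Suc 0))" by simp
  obtain a b b' c c' where *: "a \<in> E (Suc (Suc 0))" "b \<in> E (Suc 0)" "b' \<in> E (Suc 0)"
     "c \<in> E 0" "c' \<in> E 0" "d a = h" "dp a = d b" "dq a = d b'"
     "d1f b b' = d c" "d1g b b' = d c'" "d (d2 c c') = 0"
    using qchain_down_aux h unfolding 3 by metis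
  have "sc 8 (d2 c c') = 0" using NQ_const[of "d2 c c'"] * by (simp add: NQ_d2)
  then have "d2 c c' = 0" by (auto simp: sc_def fun_eq_iff)
  then show ?thesis using qchain_tail[OF *(1-5,7-10)] *(6) unfolding 3 by simp
qed

lemma qchain_down:
  assumes h: "h \<in> Zc {p, q} (Suc (Suc (Suc (Suc n))))"
  shows "\<exists>f\<in>Zc {p, q} n. qchain n h f"
proof -
  obtain a b b' c c' where *: "a \<in> E (Suc (Suc (Suc n)))" "b \<in> E (Suc (Suc n))" "b' \<in> E (Suc (Suc n))"
     "c \<in> E (Suc n)" "c' \<in> E (Suc n)" "d a = h" "dp a = d b" "dq a = d b'"
     "d1f b b' = d c" "d1g b b' = d c'" "d (d2 c c') = 0"
    using qchain_down_aux h by metis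
  then obtain e where e: "e \<in> E n" "d e = d2 c c'" using contr_ex[of "d2 c c'" n] by auto
  have "d (NQ e) = 0" using e by (simp add: d_NQ NQ_d2)
  then have "NQ e \<in> Zc {p, q} n" using e NQ_EI by (simp add: Zc_def)
  moreover have "qchain n h (NQ e)" by (rule qchainI[OF *(1-5) e(1) *(6-10)]) (simp_all add: e(2))
  ultimately show ?thesis by blast
qed

text \<open>The chase in the opposite direction, which supplies a generator of H^4(Q) above
  \<open>unit0\<close>. For Q no explicit cocycle is written down, whereas C has the explicit class
  \<open>xh\<close>.\<close>

lemma qchain_up:
  assumes f: "f \<in> Zc {p, q} n"
  shows "\<exists>h\<in>Zc {p, q} (Suc (Suc (Suc (Suc n)))). qchain n h f"
proof -
  obtain e where e: "e \<in> E n" "NQ e = f" using exact4 Zc_EI[OF f] by blast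
  have "NQ (d e) = 0" using Zc_d[OF f] e by (simp add: d_NQ[symmetric])
  then obtain c c' where c: "c \<in> E (Suc n)" "c' \<in> E (Suc n)" "d2 c c' = d e"
    using exact3[of "d e" "Suc n"] e by auto
  have "d2 (d c) (d c') = 0" using c by (simp add: d_dops[symmetric])
  then obtain b b' where b: "b \<in> E (Suc (Suc n))" "b' \<in> E (Suc (Suc n))" "d1f b b' = d c" "d1g b b' = d c'"
    using exact2[of "d c" "Suc (Suc n)" "d c'"] c by auto
  have "d1f (d b) (d b') = 0" "d1g (d b) (d b') = 0" using b by (simp_all add: d_dops[symmetric])
  then obtain a where a: "a \<in> E (Suc (Suc (Suc n)))" "dp a = d b" "dq a = d b'"
    using exact1[of "d b" "Suc (Suc (Suc n))" "d b'"] b by auto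
  have "dp (d a) = 0" "dq (d a) = 0" using a by (simp_all add: d_dops[symmetric])
  then have "d a \<in> Zc {p, q} (Suc (Suc (Suc (Suc n))))" using exact0 a by (simp add: Zc_def)
  moreover have "qchain n (d a) f" by (rule qchainI[OF a(1) b(1,2) c(1,2) e(1) refl a(2,3) b(3,4) c(3) e(2)])
  ultimately show ?thesis by blast
qed

lemma qchain_diff:
  assumes "qchain n h f" "qchain n h' f'" shows "qchain n (h - h') (f - f')"
proof -
  obtain a b c e k l where 1: "a \<in> E (Suc (Suc (Suc n)))" "b \<in> E (Suc (Suc n))" "k \<in> E (Suc (Suc n))"
    "c \<in> E (Suc n)" "l \<in> E (Suc n)" "e \<in> E n" "d a = h" "dp a = d b" "dq a = d k"
     "d1f b k = d c" "d1g b k = d l" "d2 c l = d e" "NQ e = f"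
    using assms(1) unfolding qchain_def by blast
  obtain a' b' c' e' k' l' where 2: "a' \<in> E (Suc (Suc (Suc n)))" "b' \<in> E (Suc (Suc n))" "k' \<in> E (Suc (Suc n))"
    "c' \<in> E (Suc n)" "l' \<in> E (Suc n)" "e' \<in> E n" "d a' = h'" "dp a' = d b'" "dq a' = d k'"
     "d1f b' k' = d c'" "d1g b' k' = d l'" "d2 c' l' = d e'" "NQ e' = f'"
    using assms(2) unfolding qchain_def by blast
  show ?thesis
    by (rule qchainI[of "a - a'" n "b - b'" "k - k'" "c - c'" "l - l'" "e - e'"])
      (simp_all add: 1 2 dops_diff d_diff NQ_diff)
qed

lemma qchain_Bd_left:
  assumes "qchain n h 0" shows "h \<in> Bd {p, q} (Suc (Suc (Suc (Suc n))))"
proof -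
  obtain a b c e b' c' where 1: "a \<in> E (Suc (Suc (Suc n)))" "b \<in> E (Suc (Suc n))" "b' \<in> E (Suc (Suc n))"
    "c \<in> E (Suc n)" "c' \<in> E (Suc n)" "e \<in> E n" "d a = h" "dp a = d b" "dq a = d b'"
     "d1f b b' = d c" "d1g b b' = d c'" "d2 c c' = d e" "NQ e = 0"
    using assms(1) unfolding qchain_def by blast
  obtain w w' where w: "w \<in> E n" "w' \<in> E n" "d2 w w' = e" using exact3 1 by blast
  have "d a \<in> Bd {p, q} (Suc (Suc (Suc (Suc n))))"
    \<comment> \<open>Since \<open>e\<close> is \<open>d2 w w'\<close>, subtracting
      \<open>d w\<close> and \<open>d w'\<close> makes \<open>d2\<close> vanish without changing the
      coboundaries of \<open>c\<close> and \<open>c'\<close>.\<close>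
    by (rule qchain_tail[of _ _ b b' "c - d w" "c' - d w'"])
      (use 1 w in \<open>simp_all add: d_diff dops_diff d_dops[symmetric]\<close>)
  then show ?thesis using 1 by simp
qed

text \<open>An invariant primitive of \<open>h\<close> is subtracted from \<open>a\<close>, and the
  difference is pushed down through \<open>r\<close>, \<open>u, u'\<close> and \<open>v, v'\<close>.
  What remains of \<open>e\<close> is a cocycle \<open>t\<close> of the same norm \<open>f\<close>:
  a coboundary in positive degree, a constant with norm 8 times itself in degree 0.\<close>

lemma qchain_Bd_right:
  assumes "qchain n h f" "h \<in> Bd {p, q} (Suc (Suc (Suc (Suc n))))"
  shows "if n = 0 then 8 dvd f [\<one>] else f \<in> Bd {p, q} n"
proof -
  obtain a b c e b' c' where 1: "a \<in> E (Suc (Suc (Suc n)))" "b \<in> E (Suc (Suc n))" "b' \<in> E (Suc (Suc n))"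
    "c \<in> E (Suc n)" "c' \<in> E (Suc n)" "e \<in> E n" "d a = h" "dp a = d b" "dq a = d b'"
     "d1f b b' = d c" "d1g b b' = d c'" "d2 c c' = d e" "NQ e = f"
    using assms(1) unfolding qchain_def by blast
  obtain k where k: "k \<in> EI {p, q} (Suc (Suc (Suc n)))" "d k = h" using assms(2) by (auto simp: Bd_Suc)
  have kE: "k \<in> E (Suc (Suc (Suc n)))" "dp k = 0" "dq k = 0" using k by (auto simp: EI_def dops)
  have "d (a - k) = 0" using 1 k by (simp add: d_diff)
  then obtain r where r: "r \<in> E (Suc (Suc n))" "d r = a - k" using contr_ex[of "a - k" "Suc (Suc n)"] 1 kE by auto
  have "d (b - dp r) = 0" "d (b' - dq r) = 0" using 1 r kE by (simp_all add: d_diff d_dops dops_diff)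
  then obtain u u' where u: "u \<in> E (Suc n)" "d u = b - dp r" "u' \<in> E (Suc n)" "d u' = b' - dq r"
    using contr_ex[of "b - dp r" "Suc n"] contr_ex[of "b' - dq r" "Suc n"] 1 r by auto
  have "d (c - d1f u u') = 0" "d (c' - d1g u u') = 0" 
    using 1 u r by (simp_all add: d_diff d_dops dops_diff d1_d0[of r "Suc (Suc n)"])
  then obtain v v' where v: "v \<in> E n" "d v = c - d1f u u'" "v' \<in> E n" "d v' = c' - d1g u u'"
    using contr_ex[of "c - d1f u u'" n] contr_ex[of "c' - d1g u u'" n] 1 u by auto
  define t where "t = e - d2 v v'"
  have t: "t \<in> E n" using 1 v by (simp add: t_def)
  have dt: "d t = 0" using 1 u v by (simp add: t_def d_diff d_dops dops_diff d2_d1[of u "Suc n"])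
  have NQt: "NQ t = f" using 1 by (simp add: t_def NQ_diff NQ_d2)
  show ?thesis
  proof (cases n)
    case 0
    then have "f = sc 8 t" using NQ_const t dt NQt by simp
    then show ?thesis using 0 by (simp add: sc_def)
  next
    case (Suc m)
    then obtain g where "g \<in> E m" "d g = t" using contr_ex t dt by blast
    then have "f = d (NQ g)" "NQ g \<in> EI {p, q} m" using NQt NQ_EI by (auto simp: d_NQ)
    then show ?thesis using Suc by (simp add: Bd_Suc)
  qed
qed

lemma qchain_hcup:
  assumes F: "F \<in> Zc {p, q} n" and x: "qchain 0 y unit0"
  shows "qchain n (hcup n F y) F"
proof -
  obtain a b c e b' c' where 1: "a \<in> E 3" "b \<in> E 2" "b' \<in> E 2"
    "c \<in> E 1" "c' \<in> E 1" "e \<in> E 0" "d a = y" "dp a = d b" "dq a = d b'"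
     "d1f b b' = d c" "d1g b b' = d c'" "d2 c c' = d e" "NQ e = unit0"
    using x unfolding qchain_def by (auto simp: numeral_eq_Suc)
  have FE: "F \<in> E n" "d F = 0" "F \<in> EI {p, q} n" using F by (auto simp: Zc_def EI_def)
  \<comment> \<open>Each \<open>d\<close> moved past the factor \<open>F\<close> costs the sign
    (-1)^n, so signed and unsigned products must alternate down the zigzag: \<open>S\<close> for
    \<open>a\<close> and the pair \<open>c, c'\<close>, \<open>T\<close> for \<open>b, b'\<close>
    and \<open>e\<close>.\<close>
  define S where "S K = sc ((-1) ^ n) (hcup n F K)" for K
  define T where "T K = hcup n F K" for K
  have dS: "d (S K) = T (d K)" and dT: "d (T K) = S (d K)" if "K \<in> E m" for K m
    using that FE by (simp_all add: S_def T_def d_sc d_hcup[OF FE(1) that] hcup_simps sc_simps(6) sc_sign)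
  have E: "S a \<in> E (Suc (Suc (Suc n)))" "T b \<in> E (Suc (Suc n))" "T b' \<in> E (Suc (Suc n))"
    "S c \<in> E (Suc n)" "S c' \<in> E (Suc n)" "T e \<in> E n"
    using E_hcup[OF FE(1) 1(1)] E_hcup[OF FE(1) 1(2)] E_hcup[OF FE(1) 1(3)] E_hcup[OF FE(1) 1(4)] 
      E_hcup[OF FE(1) 1(5)] E_hcup[OF FE(1) 1(6)]
    by (simp_all add: S_def T_def numeral_eq_Suc)
  have "NQ (T e) = F"
  proof -
    have "NQ (T e) = hcup n F (NQ e)"
      unfolding NQ_def hcup_sum_right T_def
      using hcup_act_right[OF FE(1) 1(6) el_carrier el_act_inv[OF FE(3)]] by simp
    then show ?thesis using 1 hcup_unit0 FE by simp
  qed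
  moreover have "d (S a) = hcup n F y" using dS[OF 1(1)] 1(7) by (simp add: T_def)
  moreover have "dp (S a) = d (T b)" "dq (S a) = d (T b')"
    using dops_hcup(1,2)[OF FE(3) 1(1) 1(1)] dT[OF 1(2)] dT[OF 1(3)] 1(8,9) by (simp_all add: S_def dops_sc)
  moreover have "d1f (T b) (T b') = d (S c)" "d1g (T b) (T b') = d (S c')"
    using dops_hcup(3,4)[OF FE(3) 1(2,3)] dS[OF 1(4)] dS[OF 1(5)] 1(10,11) by (simp_all add: T_def)
  moreover have "d2 (S c) (S c') = d (T e)"
    using dops_hcup(5)[OF FE(3) 1(4,5)] dT[OF 1(6)] 1(12) by (simp add: S_def dops_sc)
  ultimately show ?thesis by (intro qchainI[OF E])
qed

lemma q8_surj:
  assumes y: "qchain 0 y unit0" and h: "h \<in> Zc {p, q} (Suc (Suc (Suc (Suc n))))"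
  shows "\<exists>f\<in>Zc {p, q} n. h - hcup n f y \<in> Bd {p, q} (Suc (Suc (Suc (Suc n))))"
proof -
  obtain f where f: "f \<in> Zc {p, q} n" "qchain n h f" using qchain_down[OF h] by blast
  have "qchain n (h - hcup n f y) (f - f)" using qchain_diff[OF f(2) qchain_hcup[OF f(1) y]] .
  then show ?thesis using f(1) qchain_Bd_left by auto
qed

lemma q8_inj:
  assumes y: "qchain 0 y unit0" and f: "f \<in> Zc {p, q} n" "hcup n f y \<in> Bd {p, q} (Suc (Suc (Suc (Suc n))))"
  shows "if n = 0 then 8 dvd f [\<one>] else f \<in> Bd {p, q} n"
  using qchain_Bd_right[OF qchain_hcup[OF f(1) y] f(2)] .

end

context q8_cyclic
begin

section \<open>Transfer to the whole group\<close>

declare of_nat_power [simp del]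

abbreviation A :: "'a set" where "A \<equiv> {p, q, z}"

lemma gens_carrier [simp]: "{p, q} \<subseteq> carrier G" "{z} \<subseteq> carrier G" "A \<subseteq> carrier G"
  by auto

lemma A_sub: "{p, q} \<subseteq> A" "{z} \<subseteq> A"
  by auto

lemma EI_A_act:
  assumes "F \<in> EI A n" "g \<in> carrier G" shows "act g F = F"
proof -
  obtain m and k :: nat where g: "m < 8" "g = el m \<otimes> z [^] k" by (rule carrier_cases[OF assms(2)]) blast
  have "act (el m) F = F" using el_act_inv[OF EI_mono[OF A_sub(1) assms(1)] g(1)] .
  moreover have "act (z [^] k) F = F" using assms(1) by (intro act_pow_inv) (auto simp: EI_def)
  moreover have "act g F = act (z [^] k) (act (el m) F)" using g by (simp add: act_act)
  ultimately show ?thesis by simp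
qed

lemma tr_NQ_Bd: "F \<in> Bd {z} n \<Longrightarrow> NQ F \<in> Bd A n"
  by (cases n) (auto simp: Bd_def d_NQ[symmetric] intro!: imageI NQ_EI_all)

lemma tr_NZ_Bd: "F \<in> Bd {p, q} n \<Longrightarrow> NZ F \<in> Bd A n"
  by (cases n) (auto simp: Bd_def d_NZ[symmetric] intro!: imageI NZ_EI_all)

lemma tr_NQ_Zc: "F \<in> Zc {z} n \<Longrightarrow> NQ F \<in> Zc A n"
  by (auto simp: Zc_def d_NQ intro: NQ_EI_all)

lemma tr_NZ_Zc: "F \<in> Zc {p, q} n \<Longrightarrow> NZ F \<in> Zc A n"
  by (auto simp: Zc_def d_NZ intro: NZ_EI_all)

lemma NQ_A: "F \<in> Zc A n \<Longrightarrow> NQ F = sc 8 F"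
  by (rule NQ_inv) (auto dest: Zc_EI EI_mono[OF A_sub(1)])

lemma NZ_A: "F \<in> Zc A n \<Longrightarrow> NZ F = sc (int M) F"
  by (rule NZ_inv) (auto dest: Zc_EI EI_mono[OF A_sub(2)])

lemma coprime_M: "coprime (8::int) (int M)"
proof -
  have "coprime (8::int) 3"
  proof (rule coprimeI)
    fix c :: int assume "c dvd 8" "c dvd 3"
    then have "c dvd 3 * 3 - 8" by (intro dvd_diff dvd_mult)
    then show "is_unit c" by simp
  qed
  then have "coprime (8::int) (3 ^ s)" by (simp only: coprime_power_right_iff simp_thms)
  then show ?thesis by (simp only: of_nat_power of_nat_numeral)
qed

lemma bezout_split:
  assumes "coprime (c::int) e"
  obtains a b where "F = sc a (sc c F) + sc b (sc e F)"
proof -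
  obtain a b where "a * c + b * e = 1" using bezout_int[of c e] assms by auto
  then have "F = sc (a * c + b * e) F" by (simp add: sc_simps)
  then have "F = sc a (sc c F) + sc b (sc e F)" by (simp only: sc_simps(3,7))
  then show ?thesis using that by blast
qed

lemma Bd_coprime:
  assumes "coprime (c::int) e" "sc c F \<in> Bd H n" "sc e F \<in> Bd H n"
  shows "F \<in> Bd H n"
proof -
  obtain a b where "F = sc a (sc c F) + sc b (sc e F)" using bezout_split[OF assms(1)] .
  then show ?thesis using assms Bd_add Bd_sc by metis
qed

text \<open>Transfer after restriction multiplies by the index: 8 F bounds since \<open>F\<close>
  bounds over C, of index 8, and M F bounds since \<open>F\<close> bounds over Q, of index
  M.\<close>

lemma Bd_combine:
  assumes F: "F \<in> Zc A n" and "F \<in> Bd {p, q} n" "F \<in> Bd {z} n"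
  shows "F \<in> Bd A n"
  using Bd_coprime[OF coprime_M] tr_NQ_Bd[OF assms(3)] tr_NZ_Bd[OF assms(2)] NQ_A[OF F] NZ_A[OF F] by metis

text \<open>Projection formula: a factor invariant under G passes through the transfer.\<close>

lemma NQ_hcup:
  assumes "F \<in> E n" "K \<in> EI A m" shows "NQ (hcup n F K) = hcup n (NQ F) K"
  unfolding NQ_def hcup_sum_left
  by (intro sum.cong refl) (use assms EI_A_act[OF assms(2)] in \<open>simp add: act_hcup[OF _ EI_E[OF assms(2)]]\<close>)

lemma NZ_hcup:
  assumes "F \<in> E n" "K \<in> EI A m" shows "NZ (hcup n F K) = hcup n (NZ F) K"
  unfolding NZ_def hcup_sum_left
  by (intro sum.cong refl) (use assms EI_A_act[OF assms(2)] in \<open>simp add: act_hcup[OF _ EI_E[OF assms(2)]]\<close>)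

lemma sc_cancel: "c \<noteq> 0 \<Longrightarrow> sc c F = sc c K \<Longrightarrow> F = K"
  by (auto simp: sc_def fun_eq_iff)

section \<open>The generator in degree two\<close>

text \<open>The class \<open>xh\<close> is the Bockstein of \<open>ph\<close>, that is \<open>M xh = d ud\<close> where \<open>ud\<close> is \<open>ph\<close> as a homogeneous cochain. On the
quaternion subgroup it bounds \<open>wd\<close>, and \<open>td\<close> is the next term of the chase over the cyclic subgroup.\<close>

definition ud :: "'a list \<Rightarrow> int" where
  "ud xs = (if length xs = 2 \<and> set xs \<subseteq> carrier G then int (ph (inv (xs ! 0) \<otimes> xs ! 1)) else 0)"
definition vd :: "'a list \<Rightarrow> int" where
  "vd xs = (if length xs = 1 \<and> set xs \<subseteq> carrier G then int (ph (xs ! 0)) else 0)"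
definition wd :: "'a list \<Rightarrow> int" where
  "wd xs = (ud xs - d vd xs) div int M"
definition td :: "'a list \<Rightarrow> int" where
  "td xs = (if length xs = 1 \<and> set xs \<subseteq> carrier G \<and> Suc (ph (xs ! 0)) = M then 1 else 0)"
definition xh :: "'a list \<Rightarrow> int" where "xh = d wd"

lemma list1: "length xs = Suc 0 \<Longrightarrow> set xs \<subseteq> carrier G \<Longrightarrow> \<exists>a\<in>carrier G. xs = [a]"
  by (cases xs) auto

lemma list2: "length xs = Suc (Suc 0) \<Longrightarrow> set xs \<subseteq> carrier G \<Longrightarrow> \<exists>a\<in>carrier G. \<exists>b\<in>carrier G. xs = [a, b]"
  by (cases xs; cases "tl xs") auto

lemma ud_E [simp]: "ud \<in> E (Suc 0)" and vd_E [simp]: "vd \<in> E 0" and td_E [simp]: "td \<in> E 0"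
  by (rule E_I; auto simp: ud_def vd_def td_def split: if_splits)+

text \<open>\<open>ph\<close> is additive modulo M, so \<open>ud - d vd\<close> takes values
  divisible by M and the division in \<open>wd\<close> is exact.\<close>

lemma ud_vd_wd: "sc (int M) wd = ud - d vd" and wd_E [simp]: "wd \<in> E (Suc 0)"
proof -
  have *: "length xs = 2 \<and> set xs \<subseteq> carrier G \<and> int M dvd ud xs - d vd xs \<or> ud xs - d vd xs = 0" for xs
  proof (cases "length xs = Suc 1 \<and> set xs \<subseteq> carrier G")
    case True
    then obtain a b where ab: "a \<in> carrier G" "b \<in> carrier G" "xs = [a, b]" using list2[of xs] by auto
    have "ph b = (ph a + ph (inv a \<otimes> b)) mod M"
      using ph_mult[of a "inv a \<otimes> b"] ab by (simp add: m_assoc[symmetric])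
    then have "int (ph b) = (int (ph a) + int (ph (inv a \<otimes> b))) mod int M"
      by (metis of_nat_add zmod_int)
    then have "int M dvd int (ph a) + int (ph (inv a \<otimes> b)) - int (ph b)" by (simp add: mod_eq_dvd_iff[symmetric])
    moreover have "ud xs - d vd xs = int (ph a) + int (ph (inv a \<otimes> b)) - int (ph b)"
      using ab by (simp add: ud_def vd_def d_def)
    ultimately show ?thesis using True by simp
  next
    case False
    moreover have "ud - d vd \<in> E 1" using E_diff[OF ud_E, of "d vd"] E_d[OF vd_E] by simp
    ultimately show ?thesis using E_outside[of "ud - d vd" 1 xs] by auto
  qed
  show "sc (int M) wd = ud - d vd"
  proof
    fix xs show "sc (int M) wd xs = (ud - d vd) xs" using *[of xs] by (auto simp: sc_def wd_def)
  qed
  show "wd \<in> E (Suc 0)"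
  proof (rule E_I)
    fix xs assume "wd xs \<noteq> 0"
    then have "ud xs - d vd xs \<noteq> 0" by (auto simp: wd_def)
    then show "length xs = Suc (Suc 0) \<and> set xs \<subseteq> carrier G" using *[of xs] by auto
  qed
qed

text \<open>p and q do not change \<open>ph\<close>. z raises it by 1, except where it wraps from M
  - 1 to 0; \<open>td\<close> marks exactly those points, of which \<open>NZ_td\<close> finds one in
  every orbit.\<close>

lemma vd_act: "act p vd = vd" "act q vd = vd" "act z vd - vd = unit0 - sc (int M) td"
proof -
  have z1: "int (Suc (ph a) mod M) = int (ph a) + 1 - (if Suc (ph a) = M then int M else 0)" 
    if "a \<in> carrier G" for a
    using ix_ph(2)[OF that] by (cases "Suc (ph a) = M") auto
  show "act p vd = vd"
  proof (rule E_eqI[of _ 0])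
    fix xs :: "'a list" assume "length xs = Suc 0" "set xs \<subseteq> carrier G"
    then obtain a where "a \<in> carrier G" "xs = [a]" using list1 by blast
    then show "(act p vd) xs = (vd) xs"
      by (simp add: act_def vd_def ph_gen unit0_def sc_def td_def z1)
  qed simp_all
  show "act q vd = vd"
  proof (rule E_eqI[of _ 0])
    fix xs :: "'a list" assume "length xs = Suc 0" "set xs \<subseteq> carrier G"
    then obtain a where "a \<in> carrier G" "xs = [a]" using list1 by blast
    then show "(act q vd) xs = (vd) xs"
      by (simp add: act_def vd_def ph_gen unit0_def sc_def td_def z1)
  qed simp_all
  show "act z vd - vd = unit0 - sc (int M) td"
  proof (rule E_eqI[of _ 0])
    fix xs :: "'a list" assume "length xs = Suc 0" "set xs \<subseteq> carrier G"
    then obtain a where "a \<in> carrier G" "xs = [a]" using list1 by blast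
    then show "(act z vd - vd) xs = (unit0 - sc (int M) td) xs"
      by (simp add: act_def vd_def ph_gen unit0_def sc_def td_def z1)
  qed simp_all
qed

lemma ud_act: 
  assumes "g \<in> carrier G" shows "act g ud = ud"
proof (rule E_eqI[of _ 1])
  fix xs :: "'a list" assume "length xs = Suc 1" "set xs \<subseteq> carrier G"
  then obtain a b where ab: "a \<in> carrier G" "b \<in> carrier G" "xs = [a, b]" using list2[of xs] by auto
  have "inv g \<otimes> (g \<otimes> b) = b" using ab assms by (simp add: m_assoc[symmetric])
  then have "inv (g \<otimes> a) \<otimes> (g \<otimes> b) = inv a \<otimes> b"
    using ab assms by (simp add: inv_mult_group m_assoc)
  then show "act g ud xs = ud xs" using ab assms by (simp add: act_def ud_def)
qed auto

lemma M_nz: "int M \<noteq> 0" by simp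

lemma wd_Q: "wd \<in> EI {p, q} 1"
proof -
  have "act g wd = wd" if "g = p \<or> g = q" for g
  proof (rule sc_cancel[OF M_nz])
    have "act g vd = vd" "g \<in> carrier G" using that vd_act by auto
    then show "sc (int M) (act g wd) = sc (int M) wd"
      by (simp add: act_sc[symmetric] ud_vd_wd act_diff ud_act d_act[symmetric])
  qed
  then show ?thesis by (simp add: EI_def)
qed

lemma d_unit0: "d unit0 = 0"
  using unit0_Zc[of "{}"] by (simp add: Zc_def)

lemma wd_z: "act z wd - wd = d td"
proof (rule sc_cancel[OF M_nz])
  have "sc (int M) (act z wd - wd) = d vd - d (act z vd)"
    by (simp add: sc_simps act_sc[symmetric] ud_vd_wd act_diff ud_act d_act)
  also have "\<dots> = - d (act z vd - vd)" by (simp add: d_diff)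
  also have "\<dots> = sc (int M) (d td)" by (simp add: vd_act d_diff d_unit0 d_sc)
  finally show "sc (int M) (act z wd - wd) = sc (int M) (d td)" .
qed

lemma NZ_td: "NZ td = unit0"
proof (rule E_eqI[of _ 0])
  fix xs :: "'a list" assume xs: "length xs = Suc 0" "set xs \<subseteq> carrier G"
  then obtain a where a: "a \<in> carrier G" "xs = [a]" using list1 by blast
  define k where "k = ph a"
  have k: "k < M" using ix_ph a k_def by simp
  have "NZ td xs = (\<Sum>j<M. if Suc ((j + k) mod M) = M then 1 else 0)"
    using a by (simp add: NZ_at td_def ph_zpow k_def)
  also have "\<dots> = (\<Sum>j<M. if j = M - Suc k then 1 else 0)"
  proof (rule sum.cong)
    fix j assume "j \<in> {..<M}"
    then have "Suc ((j + k) mod M) = M \<longleftrightarrow> j = M - Suc k"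
      using k by (cases "j + k < M") (auto simp: mod_if)
    then show "(if Suc ((j + k) mod M) = M then 1 else 0) = (if j = M - Suc k then 1 else (0::int))" by simp
  qed simp
  also have "\<dots> = 1" by simp
  finally show "NZ td xs = unit0 xs" using xs by (simp add: unit0_def)
qed auto

text \<open>The zigzag is \<open>wd, td\<close>: over C the Bockstein class is the periodicity
  class.\<close>

lemma xh_cchain: "cchain 0 xh unit0"
  unfolding cchain_def xh_def using wd_E td_E wd_z NZ_td by (metis One_nat_def)

lemma xh_Q: "xh \<in> Bd {p, q} 2"
  using wd_Q by (simp add: xh_def numeral_2_eq_2 Bd_Suc)

lemma xh_M: "sc (int M) xh = d ud"
  by (simp add: xh_def d_sc[symmetric] ud_vd_wd d_diff)

lemma xh_Zc: "xh \<in> Zc A 2"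
proof -
  have "act g xh = xh" if "g \<in> carrier G" for g
    by (rule sc_cancel[OF M_nz]) (simp add: act_sc[symmetric] xh_M d_act[OF that, symmetric] ud_act[OF that])
  then show ?thesis using E_d[OF wd_E] by (simp add: Zc_def EI_def xh_def numeral_2_eq_2)
qed

lemma xh_M_Bd: "sc (int M) xh \<in> Bd A 2"
proof -
  have "ud \<in> EI A 1" by (simp add: EI_def ud_act)
  then show ?thesis by (simp add: xh_M numeral_2_eq_2 Bd_Suc)
qed

lemma sc_unit0_hcup: "K \<in> E m \<Longrightarrow> hcup 0 (sc c unit0) K = sc c K"
proof (rule E_eqI[of _ m])
  fix xs :: "'a list" assume K: "K \<in> E m" and xs: "length xs = Suc m" "set xs \<subseteq> carrier G"
  then show "hcup 0 (sc c unit0) K xs = sc c K xs" by (cases xs) (auto simp: hcup_def sc_def unit0_def)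
qed (use E_hcup[of "sc c unit0" 0 K m] in auto)

lemma Zc_0_const: "F \<in> Zc H 0 \<Longrightarrow> F = sc (F [\<one>]) unit0"
  using const_eq Zc_E Zc_d by blast

lemma xh_order: "sc c xh \<in> Bd A 2 \<longleftrightarrow> int M dvd c"
proof
  assume "sc c xh \<in> Bd A 2"
  then have "hcup 0 (sc c unit0) xh \<in> Bd {z} (Suc (Suc 0))"
    using Bd_mono[OF A_sub(2)] sc_unit0_hcup[OF Zc_E[OF xh_Zc]] by (simp add: numeral_2_eq_2)
  then show "int M dvd c"
    using cyc_inj[OF xh_cchain, of "sc c unit0" 0] Zc_sc[OF unit0_Zc] by (simp add: sc_def unit0_def)
next
  assume "int M dvd c"
  then obtain k where "c = k * int M" by (auto simp: dvd_def mult.commute)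
  then show "sc c xh \<in> Bd A 2" using Bd_sc[OF xh_M_Bd, of k] by (simp add: sc_simps)
qed

text \<open>Let 8 F = d g with \<open>g\<close> invariant. Then a(x) = g(1, x) is additive modulo 8.
  The relation zp = qz gives a(p) = a(q), zq = pqz gives a(p) = 0, and M a(z) = 0 with M odd gives
  a(z) = 0. Hence \<open>g\<close> is divisible by 8, and g / 8 is a primitive of \<open>F\<close>
  because there is no torsion in the cochains.\<close>

lemma H2_mod8:
  assumes F: "F \<in> Zc A 2" and 8: "sc 8 F \<in> Bd A 2"
  shows "F \<in> Bd A 2"
proof -
  obtain g where g: "g \<in> EI A 1" "d g = sc 8 F" using 8 by (auto simp: numeral_2_eq_2 Bd_Suc)
  define a where "a x = g [\<one>, x]" for x
  have ga: "g [x, y] = a (inv x \<otimes> y)" if "x \<in> carrier G" "y \<in> carrier G" for x y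
  proof -
    have "act (inv x) g [x, y] = g [x, y]" using EI_A_act[OF g(1)] that by simp
    then show ?thesis using that by (simp add: act_def a_def)
  qed
  have hom: "8 dvd a x + a y - a (x \<otimes> y)" if "x \<in> carrier G" "y \<in> carrier G" for x y
  proof -
    have "d g [\<one>, x, x \<otimes> y] = g [x, x \<otimes> y] - (g [\<one>, x \<otimes> y] - g [\<one>, x])" using that by (simp add: d_def)
    moreover have "g [x, x \<otimes> y] = a y" using ga[of x "x \<otimes> y"] that by (simp add: m_assoc[symmetric])
    ultimately have "a x + a y - a (x \<otimes> y) = 8 * F [\<one>, x, x \<otimes> y]" using g(2) by (simp add: a_def sc_def)
    then show ?thesis by simp
  qed
  have a1: "8 dvd a \<one>" using hom[of \<one> \<one>] by simp
  have "8 dvd (a z + a p - a (z \<otimes> p)) - (a q + a z - a (q \<otimes> z))" by (intro dvd_diff hom) simp_all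
  then have aq: "8 dvd a p - a q" by (simp add: zp)
  have "8 dvd (a z + a q - a (z \<otimes> q)) - (a p + a (q \<otimes> z) - a (p \<otimes> (q \<otimes> z))) - (a q + a z - a (q \<otimes> z))"
    by (intro dvd_diff hom) simp_all
  then have ap: "8 dvd a p" by (simp add: zq)
  have ak: "8 dvd int k * a z - a (z [^] k)" for k :: nat
  proof (induction k)
    case (Suc k)
    then show ?case using hom[of "z [^] k" z] dvd_add[of 8 "int k * a z - a (z [^] k)" "a (z [^] k) + a z - a (z [^] k \<otimes> z)"]
      by (simp add: algebra_simps)
  qed (use a1 in simp)
  have "8 dvd int M * a z" using dvd_add[OF ak[of M] a1] zM by simp
  then have az: "8 dvd a z" using coprime_M by (simp add: coprime_dvd_mult_right_iff)
  have "8 dvd a x" if x: "x \<in> carrier G" for x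
  proof -
    obtain m and k :: nat where mk: "m < 8" "x = el m \<otimes> z [^] k" by (rule carrier_cases[OF x]) blast
    have aq': "8 dvd a q" using dvd_diff[OF ap aq] by simp
    have *: "8 dvd a (x \<otimes> y)" if "8 dvd a x" "8 dvd a y" "x \<in> carrier G" "y \<in> carrier G" for x y
      using dvd_diff[OF dvd_add[OF that(1,2)] hom[OF that(3,4)]] by simp
    have "8 dvd a (el m)" using mk(1) by (auto simp: lt8 a1 ap aq' intro!: *)
    moreover have "8 dvd a (z [^] k)" using dvd_diff[OF dvd_mult[OF az, of "int k"] ak[of k]] by simp
    ultimately show ?thesis using * mk by simp
  qed
  note a8 = this
  define e where "e xs = g xs div 8" for xs
  have ge: "g = sc 8 e"
  proof
    fix xs
    have "8 dvd g xs"
    proof (cases "length xs = Suc 1 \<and> set xs \<subseteq> carrier G")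
      case True
      then obtain x y where "x \<in> carrier G" "y \<in> carrier G" "xs = [x, y]" using list2[of xs] by auto
      then show ?thesis using ga a8 by simp
    next
      case False
      then show ?thesis using E_outside[OF EI_E[OF g(1)], of xs] by simp
    qed
    then show "g xs = sc 8 e xs" by (simp add: sc_def e_def)
  qed
  have "e \<in> E 1"
  proof (rule E_I)
    fix xs assume "e xs \<noteq> 0"
    then have "g xs \<noteq> 0" by (auto simp: e_def)
    then show "length xs = Suc 1 \<and> set xs \<subseteq> carrier G" using E_D[OF EI_E[OF g(1)]] by blast
  qed
  moreover have "act h e = e" if "h \<in> A" for h
  proof (rule sc_cancel)
    show "sc 8 (act h e) = sc 8 e" using EI_act[OF g(1) that] by (simp only: act_sc[symmetric] ge[symmetric])
  qed simp
  ultimately have eA: "e \<in> EI A (Suc 0)" by (simp add: EI_def)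
  have dF: "d e = F"
  proof (rule sc_cancel)
    show "sc 8 (d e) = sc 8 F" using g(2) d_sc[of 8 e] ge by simp
  qed simp
  show ?thesis unfolding numeral_2_eq_2 Bd_Suc by (rule image_eqI[of F d e, OF dF[symmetric] eA])
qed

text \<open>A multiple of \<open>xh\<close> is split off over C. The remainder need not bound over Q
  a priori, so \<open>Bd_combine\<close> does not apply; but its transfer from C shows that 8 times
  it bounds, which suffices by \<open>H2_mod8\<close>.\<close>

lemma H2_generated:
  assumes F: "F \<in> Zc A 2" shows "\<exists>c. F - sc c xh \<in> Bd A 2"
proof -
  have 2: "2 = Suc (Suc 0)" by simp
  obtain f where f: "f \<in> Zc {z} 0" "F - hcup 0 f xh \<in> Bd {z} 2"
    using cyc_surj[OF xh_cchain, of F 0] Zc_mono[OF A_sub(2) F] unfolding 2 by blast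
  define c where "c = f [\<one>]"
  have "hcup 0 f xh = sc c xh" 
    using Zc_0_const[OF f(1)] sc_unit0_hcup[OF Zc_E[OF xh_Zc]] c_def by metis
  then have "F - sc c xh \<in> Bd {z} 2" using f by simp
  moreover have Z: "F - sc c xh \<in> Zc A 2" using F xh_Zc by (intro Zc_diff Zc_sc)
  ultimately have "sc 8 (F - sc c xh) \<in> Bd A 2" using tr_NQ_Bd NQ_A by metis
  then show ?thesis using H2_mod8[OF Z] by blast
qed

text \<open>For a primitive \<open>c\<close> and g = p or q, the difference
  \<open>act g c - c\<close> is a constant with norm 0, hence 0.\<close>

lemma q8_H1:
  assumes F: "F \<in> Zc {p, q} 1" shows "F \<in> Bd {p, q} 1"
proof -
  obtain c where c: "c \<in> E 0" "d c = F" using contr_ex Zc_E[OF F] Zc_d[OF F] by auto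
  have Fi: "act p F = F" "act q F = F" using Zc_EI[OF F] by (auto simp: EI_def)
  have *: "act g c = c" if "g = p \<or> g = q" for g
  proof -
    have g: "g \<in> carrier G" "act g F = F" "NQ (act g c) = NQ c" using that Fi NQ_act by auto
    have "d (act g c - c) = 0" using c g by (simp add: d_diff d_act)
    then have "sc 8 (act g c - c) = 0" using NQ_const[of "act g c - c"] c g by (simp add: NQ_diff)
    then show ?thesis by (auto simp: sc_def fun_eq_iff)
  qed
  then have "c \<in> EI {p, q} 0" using c by (simp add: EI_def)
  then show ?thesis using c by (auto simp: Bd_Suc)
qed

lemma H1: "F \<in> Zc A 1 \<Longrightarrow> F \<in> Bd A 1"
  using Bd_combine q8_H1 cyc_H1 Zc_mono[OF A_sub(1)] Zc_mono[OF A_sub(2)] by metis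

lemma H3: "F \<in> Zc A 3 \<Longrightarrow> F \<in> Bd A 3"
  using Bd_combine q8_H3 cyc_H3 Zc_mono[OF A_sub(1)] Zc_mono[OF A_sub(2)] by metis

end

context q8_cyclic
begin

section \<open>The generator in degree four\<close>

lemma EI_Q_act_z:
  assumes "F \<in> EI {p, q} n" shows "act z F \<in> EI {p, q} n"
proof -
  have F: "F \<in> E n" "act p F = F" "act q F = F" using assms by (auto simp: EI_def)
  have "act p (act z F) = act z (act q F)" by (simp add: act_act zp)
  moreover have "act q (act z F) = act z (act q (act p F))" by (simp add: act_act zq m_assoc)
  ultimately show ?thesis using F by (simp add: EI_def)
qed

lemma Bd_Q_act_z: "F \<in> Bd {p, q} n \<Longrightarrow> act z F \<in> Bd {p, q} n"
  by (cases n) (auto simp: Bd_def d_act[symmetric] intro!: imageI EI_Q_act_z)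

lemma Zc_Q_act_z: "F \<in> Zc {p, q} n \<Longrightarrow> act z F \<in> Zc {p, q} n"
  by (simp add: Zc_def EI_Q_act_z d_act)

lemma Bd_zero_fun [simp]: "(\<lambda>xs. 0) \<in> Bd H n"
  using Bd_zero[of H n] by (simp add: zero_fun_def)

lemma plus4: "n + 4 = Suc (Suc (n + 2))" "n + 4 = Suc (Suc (Suc (Suc n)))"
  by simp_all

lemma four: "(4::nat) = Suc (Suc (Suc (Suc 0)))"
  by simp

text \<open>8 F is the norm of \<open>F\<close>, and the norm of any primitive of \<open>F\<close>
  in \<open>E\<close> is an invariant primitive of it.\<close>

lemma q8_class_8:
  assumes "F \<in> Zc {p, q} (Suc n)"
  obtains e where "e \<in> EI {p, q} n" "sc 8 F = d e"
proof -
  obtain a where a: "a \<in> E n" "d a = F" using contr_ex Zc_E[OF assms] Zc_d[OF assms] by blast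
  have "sc 8 F = d (NQ a)" using NQ_inv[OF Zc_EI[OF assms]] a by (simp add: d_NQ)
  then show ?thesis using that NQ_EI[OF a(1)] by blast
qed

lemma qgen_order:
  assumes y: "y \<in> Zc {p, q} 4" "qchain 0 y unit0"
  shows "sc c y \<in> Bd {p, q} 4 \<longleftrightarrow> 8 dvd c"
proof
  assume "sc c y \<in> Bd {p, q} 4"
  then have "hcup 0 (sc c unit0) y \<in> Bd {p, q} (Suc (Suc (Suc (Suc 0))))"
    using sc_unit0_hcup[OF Zc_E[OF y(1)]] by (simp add: four)
  then show "8 dvd c"
    using q8_inj[OF y(2), of "sc c unit0" 0] Zc_sc[OF unit0_Zc] by (simp add: sc_def unit0_def)
next
  assume "8 dvd c"
  then obtain k where "c = k * 8" by (auto simp: dvd_def mult.commute)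
  moreover obtain e where "e \<in> EI {p, q} 3" "sc 8 y = d e" using q8_class_8[of y 3] y(1) by auto
  ultimately have "sc c y = d (sc k e)" "sc k e \<in> EI {p, q} 3" by (simp_all add: d_sc EI_sc flip: sc_simps(3))
  then show "sc c y \<in> Bd {p, q} 4" by (simp add: Bd_def)
qed

text \<open>Such a c is odd, so its square is 1 modulo 8, and c^M = c modulo 8 as M is odd.\<close>

lemma pow_M_mod8:
  assumes "8 dvd c ^ M - (1::int)" shows "8 dvd c - 1"
proof -
  have oddM: "odd M" by simp
  have "odd c"
  proof
    assume "even c"
    then have "even (c ^ M)" by simp
    moreover have "even (c ^ M - 1)" using assms by (meson dvd_trans even_numeral dvd_triv_left even_mult_iff
      numeral_Bit0_eq_double)
    ultimately show False by simp
  qed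
  then have c2: "8 dvd c ^ 2 - 1"
  proof -
    obtain k where k: "c = 2 * k + 1" using \<open>odd c\<close> oddE by blast
    have "even (k * (k + 1))" by simp
    then obtain l where "k * (k + 1) = 2 * l" by (rule evenE)
    then have "c ^ 2 - 1 = 8 * l" using k by (simp add: power2_eq_square algebra_simps)
    then show ?thesis by simp
  qed
  obtain m where m: "M = Suc (2 * m)" using oddE[OF oddM] by (metis Suc_eq_plus1)
  have "c ^ 2 - 1 dvd (c ^ 2) ^ m - 1" by (metis power_diff_1_eq dvd_triv_left)
  then have "8 dvd c * ((c ^ 2) ^ m - 1)" using c2 by (meson dvd_mult dvd_trans)
  moreover have "c * ((c ^ 2) ^ m - 1) = c ^ M - c"
    by (simp only: m power_Suc power_mult right_diff_distrib mult_1_right)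
  ultimately have "8 dvd c ^ M - c" by simp
  then have "8 dvd (c ^ M - 1) - (c ^ M - c)" by (rule dvd_diff[OF assms])
  then show ?thesis by simp
qed

text \<open>The action of \<open>z\<close> on \<open>H\<^sup>4\<close> of the quaternion group is a unit of \<open>\<int>/8\<close> of odd order, hence trivial.\<close>

lemma qgen_act_z:
  assumes y: "y \<in> Zc {p, q} 4" "qchain 0 y unit0"
  shows "act z y - y \<in> Bd {p, q} 4"
proof -
  obtain f where f: "f \<in> Zc {p, q} 0" "act z y - hcup 0 f y \<in> Bd {p, q} 4"
    using q8_surj[OF y(2), of "act z y" 0] Zc_Q_act_z[OF y(1)] by (auto simp: four)
  define c where "c = f [\<one>]"
  have "hcup 0 f y = sc c y" 
    using Zc_0_const[OF f(1)] sc_unit0_hcup[OF Zc_E[OF y(1)]] c_def by metis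
  then have *: "act z y - sc c y \<in> Bd {p, q} 4" using f by simp
  have "act (z [^] k) y - sc (c ^ k) y \<in> Bd {p, q} 4" for k :: nat
  proof (induction k)
    case 0
    show "act (z [^] (0::nat)) y - sc (c ^ 0) y \<in> Bd {p, q} 4"
      using act_one[OF Zc_E[OF y(1)]] by (simp add: sc_simps)
  next
    case (Suc k)
    have "act (z [^] Suc k) y - sc (c ^ Suc k) y = act z (act (z [^] k) y - sc (c ^ k) y) + sc (c ^ k) (act z y - sc c y)"
      by (simp add: act_act act_diff act_sc sc_simps zcomm mult.commute)
    moreover have "act (z [^] k) y - sc (c ^ k) y \<in> Bd {p, q} 4" by (rule Suc)
    ultimately show "act (z [^] Suc k) y - sc (c ^ Suc k) y \<in> Bd {p, q} 4"
      using Bd_add[OF Bd_Q_act_z Bd_sc[OF *]] by metis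
  qed
  from this[of M] have "y - sc (c ^ M) y \<in> Bd {p, q} 4" using zM act_one[OF Zc_E[OF y(1)]] by simp
  then have "sc (-1) (y - sc (c ^ M) y) \<in> Bd {p, q} 4" by (rule Bd_sc)
  moreover have "sc (-1) (y - sc (c ^ M) y) = sc (c ^ M - 1) y" by (simp add: sc_def fun_eq_iff algebra_simps)
  ultimately have "8 dvd c ^ M - 1" using qgen_order[OF y] by simp
  then have "8 dvd c - 1" by (rule pow_M_mod8)
  then have "sc (c - 1) y \<in> Bd {p, q} 4" using qgen_order[OF y] by simp
  then have "(act z y - sc c y) + sc (c - 1) y \<in> Bd {p, q} 4" using * by (intro Bd_add)
  moreover have "(act z y - sc c y) + sc (c - 1) y = act z y - y" by (simp add: sc_simps)
  ultimately show ?thesis by simp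
qed

text \<open>Transfer from the normal subgroup Q followed by restriction is the sum of the M
  conjugates by powers of z, each cohomologous to \<open>y\<close>.\<close>

lemma qgen_NZ:
  assumes y: "y \<in> Zc {p, q} 4" "qchain 0 y unit0"
  shows "NZ y - sc (int M) y \<in> Bd {p, q} 4"
proof -
  have *: "act (z [^] k) y - y \<in> Bd {p, q} 4" for k :: nat
  proof (induction k)
    case 0
    show "act (z [^] (0::nat)) y - y \<in> Bd {p, q} 4" using act_one[OF Zc_E[OF y(1)]] by simp
  next
    case (Suc k)
    have "act (z [^] Suc k) y - y = act z (act (z [^] k) y - y) + (act z y - y)"
      by (simp add: act_act act_diff zcomm)
    moreover have "act (z [^] k) y - y \<in> Bd {p, q} 4" by (rule Suc)
    ultimately show "act (z [^] Suc k) y - y \<in> Bd {p, q} 4"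
      using Bd_add[OF Bd_Q_act_z qgen_act_z[OF y]] by metis
  qed
  have "(\<Sum>k<N. act (z [^] k) y) - sc (int N) y \<in> Bd {p, q} 4" for N :: nat
  proof (induction N)
    case (Suc N)
    have "(\<Sum>k<Suc N. act (z [^] k) y) - sc (int (Suc N)) y
      = ((\<Sum>k<N. act (z [^] k) y) - sc (int N) y) + (act (z [^] N) y - y)"
      by (simp add: sc_simps algebra_simps)
    moreover have "(\<Sum>k<N. act (z [^] k) y) - sc (int N) y \<in> Bd {p, q} 4" by (rule Suc)
    ultimately show "(\<Sum>k<Suc N. act (z [^] k) y) - sc (int (Suc N)) y \<in> Bd {p, q} 4"
      using Bd_add[OF _ *] by metis
  next
    case 0
    show "(\<Sum>k<(0::nat). act (z [^] k) y) - sc (int 0) y \<in> Bd {p, q} 4" by (simp add: sc_simps)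
  qed
  then show ?thesis by (simp add: NZ_def)
qed

abbreviation x2 :: "'a list \<Rightarrow> int" where "x2 \<equiv> hcup 2 xh xh"

lemma x2_Zc: "x2 \<in> Zc A 4"
  using Zc_hcup[OF gens_carrier(3) xh_Zc xh_Zc] by simp

lemma x2_Q: "x2 \<in> Bd {p, q} 4"
  using Bd_hcup_left[OF gens_carrier(1) xh_Q Zc_mono[OF A_sub(1) xh_Zc]] by simp

lemma x2_M: "sc (int M) x2 \<in> Bd A 4"
  using Bd_hcup_left[OF gens_carrier(3) xh_M_Bd xh_Zc] by (simp add: hcup_simps)

text \<open>The second condition controls \<open>y\<close> over C, where \<open>x2\<close> is the
  square of the periodicity class. The third controls it over Q, where \<open>x2\<close> bounds and
  the transfer becomes M times the generator \<open>yq\<close>.\<close>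

definition is_gen4 :: "('a list \<Rightarrow> int) \<Rightarrow> bool" where
  "is_gen4 y \<longleftrightarrow> y \<in> Zc A 4 \<and> sc 8 y - x2 \<in> Bd A 4 \<and>
     (\<exists>yq \<alpha>. yq \<in> Zc {p, q} 4 \<and> qchain 0 yq unit0 \<and> y - NZ yq - sc \<alpha> x2 \<in> Bd A 4)"

lemma gen4_ex: "\<exists>y. is_gen4 y"
proof -
  obtain yq where yq: "yq \<in> Zc {p, q} 4" "qchain 0 yq unit0"
    using qchain_up[OF unit0_Zc[OF gens_carrier(1)]] by (auto simp: four)
  \<comment> \<open>In 8 y the transfer term bounds, being killed by 8, and 8 \<alpha>
    \<open>x2\<close> differs from \<open>x2\<close> by \<beta> M \<open>x2\<close>, which bounds as
    well.\<close>
  obtain \<alpha> \<beta> where ab: "\<alpha> * 8 + \<beta> * int M = 1" using bezout_int[of 8 "int M"] coprime_M by auto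
  define y where "y = NZ yq + sc \<alpha> x2"
  have Zy: "y \<in> Zc A 4" unfolding y_def by (intro Zc_add tr_NZ_Zc yq Zc_sc x2_Zc)
  obtain e where e: "e \<in> EI {p, q} 3" "sc 8 yq = d e" using q8_class_8[of yq 3] yq(1) by auto
  then have "sc 8 yq \<in> Bd {p, q} 4" by (simp add: Bd_def)
  then have 1: "sc 8 (NZ yq) \<in> Bd A 4" using tr_NZ_Bd by (simp add: NZ_sc[symmetric])
  have "\<alpha> * 8 = 1 - \<beta> * int M" using ab by simp
  then have "sc 8 y - x2 = sc 8 (NZ yq) - sc \<beta> (sc (int M) x2)"
    by (simp add: y_def sc_simps mult.commute[of 8])
  then have "sc 8 y - x2 \<in> Bd A 4" using Bd_diff[OF 1 Bd_sc[OF x2_M]] by simp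
  moreover have "y - NZ yq - sc \<alpha> x2 \<in> Bd A 4" by (simp add: y_def)
  ultimately show ?thesis using Zy yq unfolding is_gen4_def by blast
qed

lemma Bd_hcup_cong_right:
  assumes "H \<subseteq> carrier G" "F \<in> Zc H n" "K - L \<in> Bd H m" "hcup n F K \<in> Bd H (n + m)"
  shows "hcup n F L \<in> Bd H (n + m)"
  using Bd_diff[OF assms(4) Bd_hcup_right[OF assms(1-3)]] by (simp add: hcup_simps)

lemma gen4_Q:
  assumes "y - NZ yq - sc \<alpha> x2 \<in> Bd A 4" "yq \<in> Zc {p, q} 4" "qchain 0 yq unit0"
  shows "y - sc (int M) yq \<in> Bd {p, q} 4"
proof -
  have "y - sc (int M) yq = (y - NZ yq - sc \<alpha> x2) + sc \<alpha> x2 + (NZ yq - sc (int M) yq)" by simp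
  then show ?thesis
    using Bd_add[OF Bd_add[OF Bd_mono[OF A_sub(1) assms(1)] Bd_sc[OF x2_Q]] qgen_NZ[OF assms(2,3)]] by metis
qed

text \<open>Over C, F y bounding gives that F x^2 bounds, and the periodicity class is cancelled
  twice. Over Q, M F \<open>yq\<close> bounds because \<open>y\<close> is M \<open>yq\<close> there,
  and 8 F \<open>yq\<close> always bounds, so F \<open>yq\<close> bounds and \<open>yq\<close> is
  cancelled. Coprimality joins the two conclusions.\<close>

lemma gen4_inj:
  assumes y: "is_gen4 y" and F: "F \<in> Zc A n" "hcup n F y \<in> Bd A (n + 4)"
  shows "if n = 0 then 8 * int M dvd F [\<one>] else F \<in> Bd A n"
proof -
  obtain yq \<alpha> where yq: "yq \<in> Zc {p, q} 4" "qchain 0 yq unit0" "y - NZ yq - sc \<alpha> x2 \<in> Bd A 4"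
    using y by (auto simp: is_gen4_def)
  have FC: "F \<in> Zc {z} n" and FQ: "F \<in> Zc {p, q} n" using F Zc_mono A_sub by blast+
  have "hcup n F (sc 8 y) \<in> Bd A (n + 4)" using Bd_sc[OF F(2)] by (simp add: hcup_simps)
  then have "hcup n F x2 \<in> Bd A (n + 4)"
    using Bd_hcup_cong_right[OF gens_carrier(3) F(1)] y unfolding is_gen4_def by blast
  then have "hcup (n + 2) (hcup n F xh) xh \<in> Bd {z} (Suc (Suc (n + 2)))"
    using Bd_mono[OF A_sub(2)] by (simp only: hcup_assoc plus4(1))
  moreover have Fx: "hcup n F xh \<in> Zc {z} (n + 2)" 
    using Zc_hcup[OF gens_carrier(2) FC Zc_mono[OF A_sub(2) xh_Zc]] .
  \<comment> \<open>The first cancellation takes place in degree n + 2, hence always yields a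
    coboundary; only the second meets the exception in degree 0.\<close>
  ultimately have "hcup n F xh \<in> Bd {z} (Suc (Suc n))" using cyc_inj[OF xh_cchain Fx] by auto
  then have C: "if n = 0 then int M dvd F [\<one>] else F \<in> Bd {z} n" by (rule cyc_inj[OF xh_cchain FC])
  have 2: "hcup n F (sc (int M) yq) \<in> Bd {p, q} (n + 4)"
    using Bd_hcup_cong_right[OF gens_carrier(1) FQ gen4_Q[OF yq(3,1,2)]] Bd_mono[OF A_sub(1) F(2)] by blast
  have 8: "hcup n F (sc 8 yq) \<in> Bd {p, q} (n + 4)"
    using Bd_hcup_right[OF gens_carrier(1) FQ] qgen_order[OF yq(1,2), of 8] by simp
  have "hcup n F yq \<in> Bd {p, q} (n + 4)" 
    by (rule Bd_coprime[OF coprime_M]) (use 2 8 in \<open>simp_all add: hcup_simps\<close>)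
  then have "hcup n F yq \<in> Bd {p, q} (Suc (Suc (Suc (Suc n))))" by (simp only: plus4(2))
  then have Q: "if n = 0 then 8 dvd F [\<one>] else F \<in> Bd {p, q} n" by (rule q8_inj[OF yq(2) FQ])
  show ?thesis
  proof (cases "n = 0")
    case True
    then show ?thesis using C Q divides_mult[OF _ _ coprime_M] by simp
  next
    case False
    then show ?thesis using C Q Bd_combine[OF F(1)] by simp
  qed
qed

text \<open>Over C, h is f2 x^2, and the transfer turns this into 8 h = tr(f2) x^2 = 8 tr(f2) y over
  G. Over Q, h is f3 \<open>yq\<close>, so M h is f3 y, and the transfer gives M^2 h = tr(f3)
  y.\<close>

lemma gen4_surj:
  assumes y: "is_gen4 y" and h: "h \<in> Zc A (n + 4)"
  shows "\<exists>f\<in>Zc A n. h - hcup n f y \<in> Bd A (n + 4)"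
proof -
  obtain yq \<alpha> where yq: "yq \<in> Zc {p, q} 4" "qchain 0 yq unit0" "y - NZ yq - sc \<alpha> x2 \<in> Bd A 4"
    and yZ: "y \<in> Zc A 4" and y8: "sc 8 y - x2 \<in> Bd A 4"
    using y by (auto simp: is_gen4_def)
  have hC: "h \<in> Zc {z} (Suc (Suc (n + 2)))" and hQ: "h \<in> Zc {p, q} (Suc (Suc (Suc (Suc n))))"
    using h Zc_mono[OF A_sub(1)] Zc_mono[OF A_sub(2)] by (auto simp: eval_nat_numeral)
  have xC: "xh \<in> Zc {z} 2" using Zc_mono[OF A_sub(2) xh_Zc] .

  obtain f1 where f1: "f1 \<in> Zc {z} (n + 2)" "h - hcup (n + 2) f1 xh \<in> Bd {z} (n + 4)"
    using cyc_surj[OF xh_cchain hC] by (auto simp: eval_nat_numeral)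
  obtain f2 where f2: "f2 \<in> Zc {z} n" "f1 - hcup n f2 xh \<in> Bd {z} (n + 2)"
    using cyc_surj[OF xh_cchain, of f1 n] f1(1) by auto
  have "hcup (n + 2) (f1 - hcup n f2 xh) xh \<in> Bd {z} (n + 4)"
    using Bd_hcup_left[OF gens_carrier(2) f2(2) xC] by (metis add.assoc numeral_Bit0)
  then have "(h - hcup (n + 2) f1 xh) + hcup (n + 2) (f1 - hcup n f2 xh) xh \<in> Bd {z} (n + 4)"
    using f1(2) by (intro Bd_add)
  then have "h - hcup n f2 x2 \<in> Bd {z} (n + 4)" by (simp add: hcup_simps flip: hcup_assoc)
  then have "NQ (h - hcup n f2 x2) \<in> Bd A (n + 4)" by (rule tr_NQ_Bd)
  then have "sc 8 h - hcup n (NQ f2) x2 \<in> Bd A (n + 4)"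
    using NQ_A[OF h] NQ_hcup[OF Zc_E[OF f2(1)] Zc_EI[OF x2_Zc]] by (simp add: NQ_diff)
  moreover have "hcup n (NQ f2) (sc 8 y - x2) \<in> Bd A (n + 4)"
    using Bd_hcup_right[OF gens_carrier(3) tr_NQ_Zc[OF f2(1)] y8] .
  ultimately have C: "sc 8 h - hcup n (sc 8 (NQ f2)) y \<in> Bd A (n + 4)"
    using Bd_diff[of "sc 8 h - hcup n (NQ f2) x2" A "n + 4" "hcup n (NQ f2) (sc 8 y - x2)"] 
    by (simp add: hcup_simps)

  define m where "m = int M"
  obtain f3 where f3: "f3 \<in> Zc {p, q} n" "h - hcup n f3 yq \<in> Bd {p, q} (n + 4)"
    using q8_surj[OF yq(2) hQ] by (auto simp: eval_nat_numeral)
  have "sc m (h - hcup n f3 yq) - hcup n f3 (y - sc m yq) \<in> Bd {p, q} (n + 4)"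
    using Bd_diff[OF Bd_sc[OF f3(2)] Bd_hcup_right[OF gens_carrier(1) f3(1) gen4_Q[OF yq(3,1,2)]]] m_def by blast
  then have "sc m h - hcup n f3 y \<in> Bd {p, q} (n + 4)" by (simp add: hcup_simps sc_simps)
  then have "NZ (sc m h - hcup n f3 y) \<in> Bd A (n + 4)" by (rule tr_NZ_Bd)
  then have Q: "sc (m * m) h - hcup n (NZ f3) y \<in> Bd A (n + 4)"
    using NZ_A[OF h] NZ_hcup[OF Zc_E[OF f3(1)] Zc_EI[OF yZ]] by (simp add: NZ_diff NZ_sc sc_simps m_def)

  \<comment> \<open>One factor M comes from comparing \<open>y\<close> with \<open>yq\<close>, the
    other from the transfer.\<close>
  have "coprime 8 (m * m)" using coprime_M by (simp add: m_def)
  then obtain a b where ab: "a * 8 + b * (m * m) = 1" using bezout_int[of 8 "m * m"] by auto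
  define f where "f = sc a (sc 8 (NQ f2)) + sc b (NZ f3)"
  have "f \<in> Zc A n" unfolding f_def by (intro Zc_add Zc_sc tr_NQ_Zc tr_NZ_Zc f2 f3)
  moreover have "h - hcup n f y = sc a (sc 8 h - hcup n (sc 8 (NQ f2)) y) + sc b (sc (m * m) h - hcup n (NZ f3) y)"
  proof -
    have "h = sc (a * 8 + b * (m * m)) h" by (simp add: ab sc_simps)
    also have "\<dots> = sc a (sc 8 h) + sc b (sc (m * m) h)" by (simp only: sc_simps(3,7))
    finally show ?thesis by (simp add: f_def hcup_simps sc_simps(2))
  qed
  ultimately show ?thesis using Bd_add[OF Bd_sc[OF C] Bd_sc[OF Q]] by metis
qed

lemma gen4_order:
  assumes y: "is_gen4 y" shows "sc (8 * int M) y \<in> Bd A 4"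
proof -
  have "sc 8 y - x2 \<in> Bd A 4" using y by (simp add: is_gen4_def)
  then have "sc (int M) (sc 8 y - x2) + sc (int M) x2 \<in> Bd A 4" by (rule Bd_add[OF Bd_sc x2_M])
  moreover have "sc (int M) (sc 8 y - x2) + sc (int M) x2 = sc (8 * int M) y"
    by (simp add: sc_simps(2,3) mult.commute)
  ultimately show ?thesis by simp
qed

section \<open>The additive structure\<close>

lemma Zc_0_A: "F \<in> Zc A 0 \<Longrightarrow> \<exists>c. F = sc c unit0"
  using Zc_0_const by blast

lemma const_inj: "sc c unit0 = sc c' unit0 \<longleftrightarrow> c = c'"
proof
  assume "sc c unit0 = sc c' unit0"
  then have "sc c unit0 [\<one>] = sc c' unit0 [\<one>]" by simp
  then show "c = c'" by (simp add: sc_def unit0_def)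
qed simp

text \<open>x^e y^b for e = 0 or 1. The factors \<open>y\<close> are appended on the right, the side
  on which \<open>gen4_inj\<close> and \<open>gen4_surj\<close> multiply.\<close>

fun mon :: "('a list \<Rightarrow> int) \<Rightarrow> nat \<Rightarrow> nat \<Rightarrow> 'a list \<Rightarrow> int" where
  "mon y e 0 = (if e = 0 then unit0 else xh)"
| "mon y e (Suc b) = hcup (2 * e + 4 * b) (mon y e b) y"

lemma mon_Zc:
  assumes "is_gen4 y" "e \<le> 1" shows "mon y e b \<in> Zc A (2 * e + 4 * b)"
proof (induction b)
  case 0
  have "e = 0 \<or> e = 1" using assms(2) by auto
  then show ?case using unit0_Zc[OF gens_carrier(3)] xh_Zc by auto
next
  case (Suc b)
  have "y \<in> Zc A 4" using assms by (simp add: is_gen4_def)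
  then show ?case using Zc_hcup[OF gens_carrier(3) Suc] by (simp add: algebra_simps)
qed

lemma mon_generates:
  assumes "is_gen4 y" "e \<le> 1"
  shows "F \<in> Zc A (2 * e + 4 * b) \<Longrightarrow> \<exists>c. F - sc c (mon y e b) \<in> Bd A (2 * e + 4 * b)"
proof (induction b arbitrary: F)
  case 0
  show "\<exists>c. F - sc c (mon y e 0) \<in> Bd A (2 * e + 4 * 0)"
  proof (cases "e = 0")
    case True
    then obtain c where "F = sc c unit0" using Zc_0_A 0 by auto
    then show ?thesis using True by (intro exI[of _ c]) simp
  next
    case False
    then have "e = 1" using assms(2) by simp
    then show ?thesis using H2_generated[of F] 0 by simp
  qed
next
  case (Suc b)
  let ?n = "2 * e + 4 * b"
  have n: "2 * e + 4 * Suc b = ?n + 4" by simp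
  obtain f where f: "f \<in> Zc A ?n" "F - hcup ?n f y \<in> Bd A (?n + 4)"
    using gen4_surj[OF assms(1), of F ?n] Suc.prems unfolding n by blast
  obtain c where c: "f - sc c (mon y e b) \<in> Bd A ?n" using Suc.IH[OF f(1)] by blast
  have "y \<in> Zc A 4" using assms by (simp add: is_gen4_def)
  then have "hcup ?n (f - sc c (mon y e b)) y \<in> Bd A (?n + 4)"
    using Bd_hcup_left[OF gens_carrier(3) c] by blast
  then have "(F - hcup ?n f y) + hcup ?n (f - sc c (mon y e b)) y \<in> Bd A (?n + 4)"
    using f(2) by (intro Bd_add)
  then have "F - sc c (mon y e (Suc b)) \<in> Bd A (?n + 4)" by (simp add: hcup_simps)
  then show "\<exists>c. F - sc c (mon y e (Suc b)) \<in> Bd A (2 * e + 4 * Suc b)" unfolding n by blast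
qed

text \<open>Multiplication by \<open>y\<close> is injective in positive degree, so orders are
  inherited from the lowest degree. The exception is the step from the unit to \<open>y\<close>,
  where infinite order drops to 8 M.\<close>

lemma mon_order:
  assumes "is_gen4 y" "e \<le> 1"
  shows "sc c (mon y e b) \<in> Bd A (2 * e + 4 * b) \<longleftrightarrow>
    (if e = 1 then int M dvd c else if b = 0 then c = 0 else 8 * int M dvd c)"
proof (induction b)
  case 0
  show ?case
  proof (cases "e = 0")
    case True
    then show ?thesis using const_inj[of c 0] by (simp add: Bd_0 sc_simps)
  next
    case False
    then have "e = 1" using assms(2) by simp
    then show ?thesis using xh_order by simp
  qed
next
  case (Suc b)
  let ?n = "2 * e + 4 * b"
  have n: "2 * e + 4 * Suc b = ?n + 4" by simp
  have yZ: "y \<in> Zc A 4" using assms by (simp add: is_gen4_def)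
  have eq: "sc c (mon y e (Suc b)) = hcup ?n (sc c (mon y e b)) y" by (simp add: hcup_simps)
  have Z: "sc c (mon y e b) \<in> Zc A ?n" using mon_Zc[OF assms] by (rule Zc_sc)
  show ?case
  proof (cases "?n = 0")
    case True
    then have eb: "e = 0" "b = 0" by auto
    have "hcup 0 (sc c unit0) y \<in> Bd A 4 \<longleftrightarrow> 8 * int M dvd c"
    proof
      assume "hcup 0 (sc c unit0) y \<in> Bd A 4"
      then show "8 * int M dvd c"
        using gen4_inj[OF assms(1), of "sc c unit0" 0] Zc_sc[OF unit0_Zc[OF gens_carrier(3)]]
        by (simp add: sc_def unit0_def)
    next
      assume "8 * int M dvd c"
      then obtain k where "c = k * (8 * int M)" by (auto simp: dvd_def mult.commute)
      then show "hcup 0 (sc c unit0) y \<in> Bd A 4"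
        using Bd_sc[OF gen4_order[OF assms(1)], of k] sc_unit0_hcup[OF Zc_E[OF yZ], of c] by (simp add: sc_simps)
    qed
    then show ?thesis unfolding eq n using eb by simp
  next
    case False
    have "hcup ?n (sc c (mon y e b)) y \<in> Bd A (?n + 4) \<longleftrightarrow> sc c (mon y e b) \<in> Bd A ?n"
      using gen4_inj[OF assms(1) Z] Bd_hcup_left[OF gens_carrier(3) _ yZ] False by auto
    moreover have "e = 0 \<or> e = 1" using assms(2) by auto
    ultimately show ?thesis unfolding eq n Suc using False by auto
  qed
qed

lemma odd_degree:
  assumes "is_gen4 y" shows "F \<in> Zc A (2 * k + 1) \<Longrightarrow> F \<in> Bd A (2 * k + 1)"
proof (induction k arbitrary: F rule: less_induct)
  case (less k)
  consider "k = 0" | "k = 1" | j where "k = Suc (Suc j)" by (metis One_nat_def old.nat.exhaust)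
  then show ?case
  proof cases
    case 1
    then show ?thesis using less.prems H1 by simp
  next
    case 2
    then show ?thesis using less.prems H3 by simp
  next
    case 3
    let ?n = "2 * j + 1"
    have n: "2 * k + 1 = ?n + 4" using 3 by simp
    obtain f where f: "f \<in> Zc A ?n" "F - hcup ?n f y \<in> Bd A (?n + 4)"
      using gen4_surj[OF assms, of F ?n] less.prems unfolding n by blast
    have "f \<in> Bd A ?n" using less.IH[of j] f 3 by simp
    moreover have "y \<in> Zc A 4" using assms by (simp add: is_gen4_def)
    ultimately have "hcup ?n f y \<in> Bd A (?n + 4)" using Bd_hcup_left[OF gens_carrier(3)] by blast
    then have "(F - hcup ?n f y) + hcup ?n f y \<in> Bd A (?n + 4)" using f(2) by (intro Bd_add)
    then show ?thesis unfolding n by simp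
  qed
qed

end

section \<open>The ideal of relations\<close>

text \<open>Modulo \<open>X\<^sup>2 = 8 Y\<close> the monomial \<open>X\<^sup>a Y\<^sup>b\<close> is \<open>8\<^bsup>a div 2\<^esup>\<close> times \<open>Y\<^sup>k\<close> or \<open>X Y\<^sup>k\<close>, depending on
the parity of \<open>a\<close>; the following coefficient determines the degree \<open>n\<close> part of a polynomial modulo this relation.\<close>

definition nf_coeff :: "nat \<Rightarrow> poly2 \<Rightarrow> int" where
  "nf_coeff n P = (\<Sum>m | wdeg m = n. Poly_Mapping.lookup P m * 8 ^ (fst m div 2))"

lemma finite_wdeg: "finite {m. wdeg m = n}"
proof (rule finite_subset)
  show "{m. wdeg m = n} \<subseteq> {..n} \<times> {..n}" by (auto simp: wdeg_def)
qed simp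

lemma nf_coeff_add: "nf_coeff n (P + Q) = nf_coeff n P + nf_coeff n Q"
  by (simp add: nf_coeff_def lookup_add algebra_simps sum.distrib)

lemma nf_coeff_zero [simp]: "nf_coeff n 0 = 0"
  by (simp add: nf_coeff_def)

lemma nf_coeff_sum: "nf_coeff n (sum P I) = (\<Sum>i\<in>I. nf_coeff n (P i))"
  by (induction I rule: infinite_finite_induct) (auto simp: nf_coeff_add)

lemma nf_coeff_single:
  "nf_coeff n (Poly_Mapping.single m v) = (if wdeg m = n then v * 8 ^ (fst m div 2) else 0)"
proof -
  have "nf_coeff n (Poly_Mapping.single m v) = (\<Sum>k | wdeg k = n. if k = m then v * 8 ^ (fst m div 2) else 0)"
    unfolding nf_coeff_def by (rule sum.cong) (auto simp: lookup_single when_def)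
  then show ?thesis using finite_wdeg by (simp add: sum.delta)
qed

lemma sum_single: "P = (\<Sum>m\<in>Poly_Mapping.keys P. Poly_Mapping.single m (Poly_Mapping.lookup P m))"
proof (rule poly_mapping_eqI)
  fix k
  show "Poly_Mapping.lookup P k =
    Poly_Mapping.lookup (\<Sum>m\<in>Poly_Mapping.keys P. Poly_Mapping.single m (Poly_Mapping.lookup P m)) k"
    by (simp add: lookup_sum lookup_single when_def in_keys_iff)
qed

lemma mult_sum_single:
  "Q * P = (\<Sum>m\<in>Poly_Mapping.keys P. Q * Poly_Mapping.single m (Poly_Mapping.lookup P m))"
  for P :: poly2
  by (subst sum_single[of P]) (rule sum_distrib_left)

lemma const_mult_single:
  "of_nat c * Poly_Mapping.single m v = (Poly_Mapping.single m (int c * v) :: poly2)"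
  "8 * Poly_Mapping.single m v = (Poly_Mapping.single m (8 * v) :: poly2)"
proof -
  have *: "of_nat c * Poly_Mapping.single m v = (Poly_Mapping.single m (int c * v) :: poly2)" for c
    using mult_single[of 0 "of_nat c" m v] by simp
  show "of_nat c * Poly_Mapping.single m v = (Poly_Mapping.single m (int c * v) :: poly2)" by (rule *)
  show "8 * Poly_Mapping.single m v = (Poly_Mapping.single m (8 * v) :: poly2)" using *[of 8] by simp
qed

lemma varX_single: "varX * Poly_Mapping.single (a, b) v = Poly_Mapping.single (Suc a, b) v"
  and varY_single: "varY * Poly_Mapping.single (a, b) v = Poly_Mapping.single (a, Suc b) v"
  by (simp_all add: varX_def varY_def mult_single)

lemma relation_single: "(varX ^ 2 - 8 * varY) * Poly_Mapping.single (a, b) v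
    = Poly_Mapping.single (a + 2, b) v - Poly_Mapping.single (a, Suc b) (8 * v)"
  by (simp add: left_diff_distrib power2_eq_square mult.assoc varX_single varY_single const_mult_single)

lemma nf_coeff_relation: "nf_coeff n ((varX ^ 2 - 8 * varY) * C) = 0"
proof -
  have "nf_coeff n ((varX ^ 2 - 8 * varY) * Poly_Mapping.single (a, b) v) = 0" for a b v
  proof -
    have "(varX ^ 2 - 8 * varY) * Poly_Mapping.single (a, b) v
      = Poly_Mapping.single (a + 2, b) v + Poly_Mapping.single (a, Suc b) (- 8 * v)"
      unfolding relation_single by (simp add: single_uminus)
    then show ?thesis by (simp only: nf_coeff_add nf_coeff_single) (simp add: wdeg_def)
  qed
  then show ?thesis by (subst mult_sum_single) (simp add: nf_coeff_sum split_paired_all)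
qed

text \<open>In a degree divisible by 4 a monomial divisible by X has a positive even exponent of X,
  so its reduction contains at least one factor 8.\<close>

lemma nf_coeff_varX:
  "(if n = 0 then nf_coeff n (varX * P) = 0 else if 4 dvd n then 8 dvd nf_coeff n (varX * P) else True)"
proof -
  have "nf_coeff 0 (varX * Poly_Mapping.single m v) = 0" for m v
    by (cases m) (simp add: varX_single nf_coeff_single wdeg_def)
  then have 1: "nf_coeff 0 (varX * P) = 0" by (subst mult_sum_single) (simp add: nf_coeff_sum)
  have "8 dvd nf_coeff n (varX * Poly_Mapping.single (a, b) v)" if "4 dvd n" for a b v
  proof (cases "2 * Suc a + 4 * b = n")
    case True
    then have "4 dvd 2 * Suc a" using that by (metis dvd_add_left_iff dvd_triv_left)
    then obtain k where "2 * Suc a = 4 * k" by (rule dvdE)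
    then have "Suc a = 2 * k" by simp
    then have "Suc a div 2 = Suc (k - 1)" by auto
    then show ?thesis by (simp add: varX_single nf_coeff_single)
  qed (simp add: varX_single nf_coeff_single wdeg_def)
  then have "8 dvd nf_coeff n (varX * P)" if "4 dvd n"
    using that by (subst mult_sum_single) (auto simp: nf_coeff_sum split_paired_all intro!: dvd_sum)
  then show ?thesis using 1 by auto
qed

lemma nf_coeff_varY: "nf_coeff 0 (varY * P) = 0"
proof -
  have "nf_coeff 0 (varY * Poly_Mapping.single m v) = 0" for m v
    by (cases m) (simp add: varY_single nf_coeff_single wdeg_def)
  then show ?thesis by (subst mult_sum_single) (simp add: nf_coeff_sum)
qed

lemma nf_coeff_const: "nf_coeff n (of_nat c * P) = int c * nf_coeff n P"
proof -
  have "nf_coeff n (of_nat c * Poly_Mapping.single m v) = int c * nf_coeff n (Poly_Mapping.single m v)" for m v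
    by (simp add: nf_coeff_single const_mult_single)
  then have "nf_coeff n (of_nat c * P) =
    (\<Sum>m\<in>Poly_Mapping.keys P. int c * nf_coeff n (Poly_Mapping.single m (Poly_Mapping.lookup P m)))"
    by (subst mult_sum_single) (simp add: nf_coeff_sum)
  also have "\<dots> = int c * nf_coeff n P"
    by (subst (3) sum_single) (simp only: nf_coeff_sum sum_distrib_left)
  finally show ?thesis .
qed

text \<open>The coefficient vanishes in Z, Z/(8 * 3^s) or Z/3^s, the groups spanned by the one
  reduced monomial in degree 0, in positive degrees divisible by 4 and in degrees that are 2 modulo
  4.\<close>

definition nf_zero :: "nat \<Rightarrow> nat \<Rightarrow> int \<Rightarrow> bool" where
  "nf_zero s n c \<longleftrightarrow> (if n = 0 then c = 0 else if 4 dvd n then 8 * 3 ^ s dvd c else 3 ^ s dvd c)"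

lemma in_ideal_imp_nf_zero:
  assumes "in_ideal s P" shows "nf_zero s n (nf_coeff n P)"
proof -
  obtain A B C where P: "P = of_nat (3 ^ s) * (varX * A) + of_nat (8 * 3 ^ s) * (varY * B) + (varX ^ 2 - 8 * varY) * C"
    using assms by (auto simp: in_ideal_def mult.assoc)
  have P': "nf_coeff n P = 3 ^ s * nf_coeff n (varX * A) + 8 * 3 ^ s * nf_coeff n (varY * B)"
    unfolding P nf_coeff_add nf_coeff_const nf_coeff_relation by simp
  show ?thesis
    using nf_coeff_varX[of n A] nf_coeff_varY[of B] unfolding nf_zero_def P'
    by (auto intro!: dvd_add simp: mult.commute[of 8] mult.assoc intro: mult_dvd_mono)
qed

lemma in_ideal_zero: "in_ideal s 0"
  unfolding in_ideal_def by (intro exI[of _ 0]) simp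

lemma in_ideal_add:
  assumes "in_ideal s P" "in_ideal s Q" shows "in_ideal s (P + Q)"
proof -
  obtain A B C A' B' C' where
    "P = of_nat (3 ^ s) * varX * A + of_nat (8 * 3 ^ s) * varY * B + (varX ^ 2 - 8 * varY) * C"
    "Q = of_nat (3 ^ s) * varX * A' + of_nat (8 * 3 ^ s) * varY * B' + (varX ^ 2 - 8 * varY) * C'"
    using assms unfolding in_ideal_def by blast
  then have "P + Q = of_nat (3 ^ s) * varX * (A + A') + of_nat (8 * 3 ^ s) * varY * (B + B') 
      + (varX ^ 2 - 8 * varY) * (C + C')"
    by (simp only: distrib_left) (simp only: add_ac)
  then show ?thesis unfolding in_ideal_def by blast
qed

lemma in_ideal_sum: "(\<And>i. i \<in> I \<Longrightarrow> in_ideal s (P i)) \<Longrightarrow> in_ideal s (sum P I)"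
  by (induction I rule: infinite_finite_induct) (auto simp: in_ideal_zero in_ideal_add)

lemma in_ideal_relation: "in_ideal s ((varX ^ 2 - 8 * varY) * C)"
  unfolding in_ideal_def by (rule exI[of _ 0], rule exI[of _ 0], rule exI[of _ C]) simp

lemma in_ideal_single:
  "in_ideal s (Poly_Mapping.single (a, b) v - Poly_Mapping.single (a mod 2, b + a div 2) (8 ^ (a div 2) * v))"
proof (induction a arbitrary: b v rule: less_induct)
  case (less a)
  show ?case
  proof (cases "a < 2")
    case True
    then show ?thesis using in_ideal_zero by simp
  next
    case False
    define c where "c = a - 2"
    have a: "a = c + 2" using False c_def by simp
    have 1: "Poly_Mapping.single (a, b) v - Poly_Mapping.single (c, Suc b) (8 * v) = (varX ^ 2 - 8 * varY) * Poly_Mapping.single (c, b) v"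
      by (simp only: a relation_single)
    have "in_ideal s (Poly_Mapping.single (c, Suc b) (8 * v) - 
       Poly_Mapping.single (c mod 2, Suc b + c div 2) (8 ^ (c div 2) * (8 * v)))"
      by (rule less) (simp add: a)
    moreover have "Poly_Mapping.single (c mod 2, Suc b + c div 2) (8 ^ (c div 2) * (8 * v))
       = Poly_Mapping.single (a mod 2, b + a div 2) (8 ^ (a div 2) * v)"
      by (simp add: a mult.commute mult.assoc)
    ultimately have "in_ideal s ((varX ^ 2 - 8 * varY) * Poly_Mapping.single (c, b) v 
      + (Poly_Mapping.single (c, Suc b) (8 * v) - Poly_Mapping.single (a mod 2, b + a div 2) (8 ^ (a div 2) * v)))"
      using in_ideal_add in_ideal_relation by metis
    then show ?thesis unfolding 1[symmetric] by simp
  qed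
qed

lemma wdeg_normal:
  assumes "wdeg (a, b) = n"
  shows "even n" "a mod 2 = n div 2 mod 2" "b + a div 2 = n div 4"
proof -
  have n: "n = 2 * (a + 2 * b)" using assms by (simp add: wdeg_def)
  show "even n" using n by simp
  show "a mod 2 = n div 2 mod 2" by (simp add: n)
  have "n div 4 = (a + 2 * b) div 2" unfolding n by (metis div_mult2_eq nonzero_mult_div_cancel_left numeral_Bit0_eq_double zero_neq_numeral)
  then show "b + a div 2 = n div 4" by simp
qed

lemma nf_zero_imp_in_ideal:
  assumes P: "homogeneous n P" and n: "even n" and 0: "nf_zero s n (nf_coeff n P)"
  shows "in_ideal s P"
proof -
  \<comment> \<open>The only monomial of degree n in which X has exponent at most 1.\<close>
  let ?m = "(n div 2 mod 2, n div 4)"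
  have keys: "wdeg m = n" if "m \<in> Poly_Mapping.keys P" for m using P that by (simp add: homogeneous_def)
  have "in_ideal s (Poly_Mapping.single m (Poly_Mapping.lookup P m) - 
     Poly_Mapping.single ?m (8 ^ (fst m div 2) * Poly_Mapping.lookup P m))" if "m \<in> Poly_Mapping.keys P" for m
  proof -
    obtain a b where m: "m = (a, b)" by (cases m)
    have "wdeg (a, b) = n" using keys that m by simp
    then show ?thesis using in_ideal_single[of s a b] wdeg_normal[of a b n] m by simp
  qed
  then have "in_ideal s (\<Sum>m\<in>Poly_Mapping.keys P. Poly_Mapping.single m (Poly_Mapping.lookup P m) - 
     Poly_Mapping.single ?m (8 ^ (fst m div 2) * Poly_Mapping.lookup P m))"
    by (rule in_ideal_sum)
  moreover have "(\<Sum>m\<in>Poly_Mapping.keys P. Poly_Mapping.single ?m (8 ^ (fst m div 2) * Poly_Mapping.lookup P m))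
    = Poly_Mapping.single ?m (nf_coeff n P)"
  proof -
    have "nf_coeff n P = (\<Sum>m\<in>Poly_Mapping.keys P. nf_coeff n (Poly_Mapping.single m (Poly_Mapping.lookup P m)))"
      by (subst sum_single) (rule nf_coeff_sum)
    also have "\<dots> = (\<Sum>m\<in>Poly_Mapping.keys P. 8 ^ (fst m div 2) * Poly_Mapping.lookup P m)"
      by (rule sum.cong) (simp_all add: nf_coeff_single keys)
    finally have *: "nf_coeff n P = (\<Sum>m\<in>Poly_Mapping.keys P. 8 ^ (fst m div 2) * Poly_Mapping.lookup P m)" .
    have "Poly_Mapping.single k (sum f I) = (\<Sum>i\<in>I. Poly_Mapping.single k (f i :: int))" 
      for k :: "nat \<times> nat" and f :: "nat \<times> nat \<Rightarrow> int" and I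
      by (induction I rule: infinite_finite_induct) (auto simp: single_add)
    then show ?thesis unfolding * by simp
  qed
  ultimately have 1: "in_ideal s (P - Poly_Mapping.single ?m (nf_coeff n P))"
    using sum_single[of P] by (simp add: sum_subtractf)
  have 2: "in_ideal s (Poly_Mapping.single ?m (nf_coeff n P))"
  proof (cases "n = 0")
    case True
    then show ?thesis using 0 in_ideal_zero by (simp add: nf_zero_def)
  next
    case n0: False
    show ?thesis
    proof (cases "4 dvd n")
      case True
      then obtain k where k: "nf_coeff n P = 8 * 3 ^ s * k" using 0 n0 by (auto simp: nf_zero_def)
      \<comment> \<open>A positive multiple of 4 leaves a factor Y to be split off, as the generator
        8 * 3^s Y of the ideal requires.\<close>
      have m: "?m = (0, Suc (n div 4 - 1))" using True n0 by (auto elim!: dvdE)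
      have "Poly_Mapping.single ?m (nf_coeff n P) = of_nat (8 * 3 ^ s) * varY * Poly_Mapping.single (0, n div 4 - 1) k"
        unfolding m k by (simp only: mult.assoc varY_single const_mult_single) (simp add: mult.assoc)
      then show ?thesis unfolding in_ideal_def
        by (intro exI[of _ 0] exI[of _ "Poly_Mapping.single (0, n div 4 - 1) k"]) simp
    next
      case False
      then obtain k where k: "nf_coeff n P = 3 ^ s * k" using 0 n0 by (auto simp: nf_zero_def)
      have "odd (n div 2)" using False n by (auto elim!: evenE)
      then have m: "?m = (1, n div 4)" by (simp add: odd_iff_mod_2_eq_one)
      have "Poly_Mapping.single ?m (nf_coeff n P) = of_nat (3 ^ s) * varX * Poly_Mapping.single (0, n div 4) k"
        unfolding m k by (simp only: mult.assoc varX_single const_mult_single) (simp add: mult.assoc)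
      then show ?thesis unfolding in_ideal_def
        by (intro exI[of _ "Poly_Mapping.single (0, n div 4) k"] exI[of _ 0]) simp
    qed
  qed
  show ?thesis using in_ideal_add[OF 1 2] by simp
qed

section \<open>Inhomogeneous cochains\<close>

lemma alt_omit: "alt xs F = (\<Sum>i<length xs. (-1) ^ i * F (take i xs @ drop (Suc i) xs))"
proof (induction xs arbitrary: F)
  case (Cons x xs)
  have "alt (x # xs) F = F xs - (\<Sum>i<length xs. (-1) ^ i * F (x # take i xs @ drop (Suc i) xs))"
    by (simp add: Cons)
  also have "\<dots> = (\<Sum>i<length (x # xs). (-1) ^ i * F (take i (x # xs) @ drop (Suc i) (x # xs)))"
    by (simp add: sum.lessThan_Suc_shift sum_negf del: sum.lessThan_Suc)
  finally show ?case .
qed simp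

context group
begin

text \<open>The passage between homogeneous tuples x0, ..., xn and bar symbols x0^-1 x1, ...,
  x(n-1)^-1 xn; \<open>partials\<close> inverts it once the first entry is prescribed.\<close>

fun diffs :: "'a list \<Rightarrow> 'a list" where
  "diffs (x # y # ys) = (inv x \<otimes> y) # diffs (y # ys)"
| "diffs xs = []"

fun partials :: "'a \<Rightarrow> 'a list \<Rightarrow> 'a list" where
  "partials a [] = [a]"
| "partials a (g # gs) = a # partials (a \<otimes> g) gs"

definition homog :: "nat \<Rightarrow> ('a list \<Rightarrow> int) \<Rightarrow> 'a list \<Rightarrow> int" where
  "homog n f xs = (if length xs = Suc n \<and> set xs \<subseteq> carrier G then f (diffs xs) else 0)"

lemma length_diffs [simp]: "length (diffs xs) = length xs - 1"
  by (induction xs rule: diffs.induct) auto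

lemma diffs_nth: "Suc i < length xs \<Longrightarrow> diffs xs ! i = inv (xs ! i) \<otimes> xs ! Suc i"
proof (induction xs arbitrary: i rule: diffs.induct)
  case (1 x y ys)
  then show ?case by (cases i) auto
qed auto

lemma diffs_carrier: "set xs \<subseteq> carrier G \<Longrightarrow> set (diffs xs) \<subseteq> carrier G"
  by (induction xs rule: diffs.induct) auto

lemma nth_in_carrier: "set xs \<subseteq> carrier G \<Longrightarrow> i < length xs \<Longrightarrow> xs ! i \<in> carrier G"
  by auto

lemma diffs_map: 
  assumes "h \<in> carrier G" "set xs \<subseteq> carrier G" shows "diffs (map ((\<otimes>) h) xs) = diffs xs"
  using assms(2)
proof (induction xs rule: diffs.induct)
  case (1 x y ys)
  have "inv h \<otimes> (h \<otimes> y) = y" using assms 1 by (simp add: m_assoc[symmetric])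
  then have "inv (h \<otimes> x) \<otimes> (h \<otimes> y) = inv x \<otimes> y" using assms 1 by (simp add: inv_mult_group m_assoc)
  then show ?case using 1 by simp
qed auto

lemma diffs_partials: "a \<in> carrier G \<Longrightarrow> set gs \<subseteq> carrier G \<Longrightarrow> diffs (partials a gs) = gs"
proof (induction gs arbitrary: a)
  case (Cons g gs)
  have "diffs (partials a (g # gs)) = (inv a \<otimes> (a \<otimes> g)) # diffs (partials (a \<otimes> g) gs)"
    by (cases gs) auto
  then show ?case using Cons by (simp add: m_assoc[symmetric])
qed auto

lemma partials_props: "a \<in> carrier G \<Longrightarrow> set gs \<subseteq> carrier G \<Longrightarrow>
   length (partials a gs) = Suc (length gs) \<and> set (partials a gs) \<subseteq> carrier G"
  by (induction gs arbitrary: a) auto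

lemma partials_diffs: 
  "x \<in> carrier G \<Longrightarrow> set ys \<subseteq> carrier G \<Longrightarrow> partials x (diffs (x # ys)) = x # ys"
proof (induction ys arbitrary: x)
  case (Cons y ys)
  have "x \<otimes> (inv x \<otimes> y) = y" using Cons.prems by (simp add: m_assoc[symmetric])
  then show ?case using Cons by simp
qed simp

lemma diffs_take: "diffs (take (Suc n) xs) = take n (diffs xs)"
proof (rule nth_equalityI)
  fix i assume "i < length (diffs (take (Suc n) xs))"
  then have "Suc i < length (take (Suc n) xs)" "Suc i < length xs" "i < n" by auto
  then show "diffs (take (Suc n) xs) ! i = take n (diffs xs) ! i" by (simp add: diffs_nth del: length_take)
qed auto

lemma diffs_drop: "diffs (drop n xs) = drop n (diffs xs)"
proof (rule nth_equalityI)
  fix i assume "i < length (diffs (drop n xs))"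
  then have "Suc i < length (drop n xs)" "Suc (n + i) < length xs" by auto
  then show "diffs (drop n xs) ! i = drop n (diffs xs) ! i" by (simp add: diffs_nth del: length_drop)
qed auto

text \<open>Omitting an inner vertex y between x and w merges two neighbours, (x^-1 y)(y^-1 w) =
  x^-1 w. The two outer faces instead drop an end of the list of differences, which gives the end
  terms of the bar coboundary.\<close>

lemma diffs_omit:
  assumes xs: "set xs \<subseteq> carrier G" "length xs = Suc (Suc n)" and i: "1 \<le> i" "i \<le> n"
  shows "diffs (take i xs @ drop (Suc i) xs) = merge_at G i (diffs xs)"
proof (rule nth_equalityI)
  show "length (diffs (take i xs @ drop (Suc i) xs)) = length (merge_at G i (diffs xs))"
    using assms by (simp add: merge_at_def)
next
  fix j assume "j < length (diffs (take i xs @ drop (Suc i) xs))"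
  then have j: "j < n" using assms by simp
  let ?o = "take i xs @ drop (Suc i) xs"
  have o: "?o ! k = (if k < i then xs ! k else xs ! Suc k)" if "k \<le> n" for k
    using that assms by (auto simp: nth_append)
  have l: "diffs ?o ! j = inv (?o ! j) \<otimes> ?o ! Suc j" using j assms by (intro diffs_nth) simp
  have m: "merge_at G i (diffs xs) ! j = (if j < i - 1 then diffs xs ! j else if j = i - 1 
     then diffs xs ! (i - 1) \<otimes> diffs xs ! i else diffs xs ! Suc j)"
    using assms j by (auto simp: merge_at_def nth_append nth_Cons')
  consider "j < i - 1" | "j = i - 1" | "i \<le> j" by linarith
  then show "diffs ?o ! j = merge_at G i (diffs xs) ! j"
  proof cases
    case 1
    then have "j < i" "Suc j < i" by auto
    then show ?thesis unfolding l m using 1 j i xs by (simp add: o diffs_nth)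
  next
    case 2
    define x y w where "x = xs ! j" and "y = xs ! Suc j" and "w = xs ! Suc (Suc j)"
    have c: "x \<in> carrier G" "y \<in> carrier G" "w \<in> carrier G"
      using xs j unfolding x_def y_def w_def by (intro nth_in_carrier; simp)+
    have i': "i = Suc j" using 2 i by simp
    have "y \<otimes> (inv y \<otimes> w) = w" using c by (simp add: m_assoc[symmetric])
    then have "inv x \<otimes> w = (inv x \<otimes> y) \<otimes> (inv y \<otimes> w)" using c by (simp add: m_assoc)
    moreover have "?o ! j = x" "?o ! Suc j = w" using o[of j] o[of "Suc j"] j i' by (simp_all add: x_def w_def)
    moreover have "merge_at G i (diffs xs) ! j = (inv x \<otimes> y) \<otimes> (inv y \<otimes> w)"
      unfolding m using j i' xs by (simp add: diffs_nth x_def y_def w_def)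
    ultimately show ?thesis unfolding l by simp
  next
    case 3
    then have "\<not> j < i - 1" "j \<noteq> i - 1" "\<not> j < i" "\<not> Suc j < i" using i by auto
    then show ?thesis unfolding l m using j i xs by (simp add: o diffs_nth)
  qed
qed

lemma homog_E [simp]: "homog n f \<in> E n"
  by (rule E_I) (auto simp: homog_def split: if_splits)

lemma homog_act:
  assumes "h \<in> carrier G" shows "act h (homog n f) = homog n f"
proof
  fix xs show "act h (homog n f) xs = homog n f xs"
    using assms diffs_map[OF assms, of xs] by (auto simp: act_def homog_def)
qed

lemma homog_EI: "H \<subseteq> carrier G \<Longrightarrow> homog n f \<in> EI H n"
  using homog_act by (auto simp: EI_def)

lemma homog_d: "d (homog n f) = homog (Suc n) (cobound G n f)"
proof (rule E_eqI[of _ "Suc n"])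
  fix xs :: "'a list" assume xs: "length xs = Suc (Suc n)" "set xs \<subseteq> carrier G"
  have S: "set (take i xs @ drop (Suc i) xs) \<subseteq> carrier G" for i
    using xs(2) set_take_subset[of i xs] set_drop_subset[of "Suc i" xs] by auto
  have t: "homog n f (take i xs @ drop (Suc i) xs) = f (diffs (take i xs @ drop (Suc i) xs))" if "i \<le> Suc n" for i
    using that xs(1) S[of i] by (simp add: homog_def)
  define u where "u i = (-1) ^ i * f (diffs (take i xs @ drop (Suc i) xs))" for i
  have "d (homog n f) xs = (\<Sum>i<Suc (Suc n). u i)"
    unfolding d_def alt_omit xs(1) u_def using xs t by simp
  also have "\<dots> = u 0 + (\<Sum>i<n. u (Suc i)) + u (Suc n)"
    by (simp only: sum.lessThan_Suc[of _ "Suc n"] sum.lessThan_Suc_shift[of _ n])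
  also have "\<dots> = f (diffs (tl xs)) + (\<Sum>i<n. (-1) ^ Suc i * f (diffs (take (Suc i) xs @ drop (Suc (Suc i)) xs)))
      + (-1) ^ Suc n * f (diffs (take (Suc n) xs))"
    using xs by (simp add: u_def drop_Suc)
  also have "(\<Sum>i<n. (-1) ^ Suc i * f (diffs (take (Suc i) xs @ drop (Suc (Suc i)) xs)))
     = (\<Sum>i = 1..n. (-1) ^ i * f (merge_at G i (diffs xs)))"
  proof -
    have "(\<Sum>i<n. (-1) ^ Suc i * f (diffs (take (Suc i) xs @ drop (Suc (Suc i)) xs))) 
      = (\<Sum>i<n. (-1) ^ Suc i * f (merge_at G (Suc i) (diffs xs)))"
      by (rule sum.cong) (use diffs_omit[OF xs(2,1)] in auto)
    also have "\<dots> = (\<Sum>i = 1..n. (-1) ^ i * f (merge_at G i (diffs xs)))"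
      by (rule sum.reindex_bij_witness[of _ "\<lambda>i. i - 1" Suc]) auto
    finally show ?thesis .
  qed
  also have "diffs (tl xs) = tl (diffs xs)" using diffs_drop[of 1 xs] by (simp add: drop_Suc)
  also have "diffs (take (Suc n) xs) = butlast (diffs xs)" using xs by (simp add: diffs_take butlast_conv_take)
  also have "f (tl (diffs xs)) + (\<Sum>i = 1..n. (-1) ^ i * f (merge_at G i (diffs xs))) + (-1) ^ Suc n * f (butlast (diffs xs))
    = homog (Suc n) (cobound G n f) xs"
    using xs diffs_carrier[OF xs(2)] by (simp add: homog_def cobound_def)
  finally show "d (homog n f) xs = homog (Suc n) (cobound G n f) xs" .
qed (use E_d[OF homog_E] in auto)

lemma homog_hcup: "homog (n + m) (cup n m f g) = hcup n (homog n f) (homog m g)"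
proof (rule E_eqI[of _ "n + m"])
  fix xs :: "'a list" assume xs: "length xs = Suc (n + m)" "set xs \<subseteq> carrier G"
  have "set (take (Suc n) xs) \<subseteq> carrier G" "set (drop n xs) \<subseteq> carrier G"
    using xs by (meson order_trans set_take_subset set_drop_subset)+
  then show "homog (n + m) (cup n m f g) xs = hcup n (homog n f) (homog m g) xs"
    using xs by (simp add: homog_def cup_def hcup_def diffs_take diffs_drop)
qed (use E_hcup[OF homog_E homog_E] in auto)

lemma homog_diff: "homog n (\<lambda>gs. f gs - g gs) = homog n f - homog n g"
  by (auto simp: homog_def fun_eq_iff)

lemma homog_lincomb: "homog n (\<lambda>gs. \<Sum>i\<in>I. c i * f i gs) = (\<Sum>i\<in>I. sc (c i) (homog n (f i)))"
proof
  fix xs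
  have "(\<Sum>i\<in>I. sc (c i) (homog n (f i))) xs = (\<Sum>i\<in>I. sc (c i) (homog n (f i)) xs)"
    by (induction I rule: infinite_finite_induct) auto
  then show "homog n (\<lambda>gs. \<Sum>i\<in>I. c i * f i gs) xs = (\<Sum>i\<in>I. sc (c i) (homog n (f i))) xs"
    by (cases "length xs = Suc n"; cases "set xs \<subseteq> carrier G") (simp_all add: homog_def sc_def)
qed

lemma homog_cunit: "homog 0 cunit = unit0"
proof (rule E_eqI[of _ 0])
  fix xs :: "'a list" assume "length xs = Suc 0" "set xs \<subseteq> carrier G"
  then show "homog 0 cunit xs = unit0 xs" by (cases xs) (auto simp: homog_def cunit_def unit0_def)
qed auto

lemma cochains_outside: "f \<in> cochains G n \<Longrightarrow> \<not> (length gs = n \<and> set gs \<subseteq> carrier G) \<Longrightarrow> f gs = 0"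
  unfolding cochains_def by blast

lemma cobound_cochains: "cobound G n f \<in> cochains G (Suc n)"
  by (auto simp: cochains_def cobound_def)

lemma cochains_diff: "f \<in> cochains G n \<Longrightarrow> g \<in> cochains G n \<Longrightarrow> (\<lambda>gs. f gs - g gs) \<in> cochains G n"
  unfolding cochains_def by (smt (verit) mem_Collect_eq)

lemma homog_inj:
  assumes f: "f \<in> cochains G n" and "homog n f = 0" shows "f = (\<lambda>_. 0)"
proof
  fix gs show "f gs = 0"
  proof (cases "length gs = n \<and> set gs \<subseteq> carrier G")
    case True
    then have "homog n f (partials \<one> gs) = f gs"
      using partials_props[of \<one> gs] diffs_partials[of \<one> gs] by (simp add: homog_def)
    then show ?thesis using assms(2) by simp
  qed (use cochains_outside[OF f] in auto)
qed

lemma homog_surj: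
  assumes F: "F \<in> E n" "\<And>h. h \<in> carrier G \<Longrightarrow> act h F = F"
  shows "\<exists>f\<in>cochains G n. homog n f = F"
proof -
  define f where "f gs = (if length gs = n \<and> set gs \<subseteq> carrier G then F (partials \<one> gs) else 0)" for gs
  have "f \<in> cochains G n" by (auto simp: cochains_def f_def)
  moreover have "homog n f = F"
  proof (rule E_eqI[of _ n])
    fix xs :: "'a list" assume xs: "length xs = Suc n" "set xs \<subseteq> carrier G"
    then obtain x ys where xy: "xs = x # ys" "x \<in> carrier G" "set ys \<subseteq> carrier G" by (cases xs) auto
    \<comment> \<open>By invariance the tuple may be translated so that it starts with the unit,
      where \<open>f\<close> was read off.\<close>
    let ?xs = "map ((\<otimes>) (inv x)) xs"
    have "?xs = \<one> # map ((\<otimes>) (inv x)) ys" using xy by simp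
    moreover have "set (map ((\<otimes>) (inv x)) ys) \<subseteq> carrier G" using xy by auto
    ultimately have "partials \<one> (diffs ?xs) = ?xs" using partials_diffs[of \<one>] by simp
    moreover have "diffs ?xs = diffs xs" using diffs_map[of "inv x" xs] xy xs by simp
    ultimately have "homog n f xs = F ?xs" using xs diffs_carrier[OF xs(2)] by (simp add: homog_def f_def)
    also have "\<dots> = act (inv x) F xs" using xs by (simp add: act_def)
    finally show "homog n f xs = F xs" using F(2)[of "inv x"] xy by simp
  qed (use F in auto)
  ultimately show ?thesis by blast
qed

end

section \<open>The ring presentation\<close>

context q8_cyclic
begin

lemma cocycles_iff: "f \<in> cochains G n \<Longrightarrow> f \<in> cocycles G n \<longleftrightarrow> homog n f \<in> Zc A n"
proof
  assume "f \<in> cocycles G n"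
  then have "cobound G n f = (\<lambda>_. 0)" by (simp add: cocycles_def)
  then have "homog (Suc n) (cobound G n f) = 0" by (auto simp: homog_def fun_eq_iff)
  then show "homog n f \<in> Zc A n" using homog_d[of n f] homog_EI[of A n f] by (simp add: Zc_def)
next
  assume f: "f \<in> cochains G n" "homog n f \<in> Zc A n"
  then have "homog (Suc n) (cobound G n f) = 0" using homog_d[of n f] by (simp add: Zc_def)
  then show "f \<in> cocycles G n" using homog_inj[OF cobound_cochains] f by (simp add: cocycles_def)
qed

lemma homog_surj_A: "F \<in> EI A n \<Longrightarrow> \<exists>f\<in>cochains G n. homog n f = F"
  using homog_surj EI_E EI_A_act by blast

lemma coboundaries_iff:
  assumes f: "f \<in> cochains G n" shows "f \<in> coboundaries G n \<longleftrightarrow> homog n f \<in> Bd A n"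
proof (cases n)
  case 0
  have "homog 0 (\<lambda>_. 0) = 0" by (auto simp: homog_def fun_eq_iff)
  then show ?thesis using homog_inj[OF f] 0 by (auto simp: coboundaries_def Bd_0)
next
  case (Suc m)
  show ?thesis
  proof
    assume "f \<in> coboundaries G n"
    then obtain g where "f = cobound G m g" using Suc by (auto simp: coboundaries_def)
    then have "homog n f = d (homog m g)" using Suc homog_d by simp
    then show "homog n f \<in> Bd A n" using homog_EI[of A m g] Suc by (simp add: Bd_Suc)
  next
    assume "homog n f \<in> Bd A n"
    then obtain K where K: "K \<in> EI A m" "homog n f = d K" using Suc by (auto simp: Bd_Suc)
    then obtain g where g: "g \<in> cochains G m" "homog m g = K" using homog_surj_A by blast
    have "homog n (\<lambda>gs. f gs - cobound G m g gs) = 0" using K g Suc by (simp add: homog_diff homog_d[symmetric])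
    then have "(\<lambda>gs. f gs - cobound G m g gs) = (\<lambda>_. 0)"
      using homog_inj[OF cochains_diff[OF f]] cobound_cochains[of m g] Suc by blast
    then have "f = cobound G m g" by (auto simp: fun_eq_iff)
    then show "f \<in> coboundaries G n" using g Suc by (simp add: coboundaries_def)
  qed
qed

lemma cup_cochains:
  assumes "f \<in> cochains G n" "g \<in> cochains G m" shows "cup n m f g \<in> cochains G (n + m)"
proof -
  have "length gs = n + m \<and> set gs \<subseteq> carrier G" if "cup n m f g gs \<noteq> 0" for gs
  proof -
    have "length gs = n + m" "f (take n gs) \<noteq> 0" "g (drop n gs) \<noteq> 0"
      using that by (auto simp: cup_def split: if_splits)
    moreover from this have "set (take n gs) \<subseteq> carrier G" "set (drop n gs) \<subseteq> carrier G"
      using assms by (auto simp: cochains_def)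
    moreover have "set gs = set (take n gs) \<union> set (drop n gs)" by (metis append_take_drop_id set_append)
    ultimately show ?thesis by blast
  qed
  then show ?thesis by (auto simp: cochains_def)
qed

lemma cup_power_cochains: "f \<in> cochains G k \<Longrightarrow> cup_power k f a \<in> cochains G (k * a)"
proof (induction a)
  case 0
  then show ?case by (auto simp: cochains_def cunit_def)
next
  case (Suc a)
  then show ?case using cup_cochains[of f k "cup_power k f a" "k * a"] by (simp add: algebra_simps)
qed

abbreviation hpow :: "nat \<Rightarrow> ('a list \<Rightarrow> int) \<Rightarrow> nat \<Rightarrow> 'a list \<Rightarrow> int" where
  "hpow k f a \<equiv> homog (k * a) (cup_power k f a)"

lemma hpow_Suc: "hpow k f (Suc a) = hcup k (homog k f) (hpow k f a)"
  using homog_hcup[of k "k * a" f "cup_power k f a"] by (simp add: algebra_simps)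

lemma hpow_0: "hpow k f 0 = unit0"
  by (simp add: homog_cunit)

lemma unit0_hcup: "F \<in> E n \<Longrightarrow> hcup 0 unit0 F = F"
  using sc_unit0_hcup[of F n 1] by (simp add: sc_simps)

text \<open>\<open>cup_power\<close> adds factors on the left and \<open>mon\<close> on the right;
  since the product is strictly associative, both give the same cochain.\<close>

lemma hpow_Suc_right: "hpow k f (Suc a) = hcup (k * a) (hpow k f a) (homog k f)"
proof (induction a)
  case 0
  show ?case unfolding hpow_Suc hpow_0 using hcup_unit0[OF homog_E] unit0_hcup[OF homog_E] by simp
next
  case (Suc a)
  have "hpow k f (Suc (Suc a)) = hcup k (homog k f) (hcup (k * a) (hpow k f a) (homog k f))"
    by (simp only: hpow_Suc[of k "Suc a" f] Suc)
  also have "\<dots> = hcup (k + k * a) (hpow k f (Suc a)) (homog k f)"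
    by (simp only: hcup_assoc[symmetric] hpow_Suc[of k a f])
  finally show ?case by (simp only: mult_Suc_right)
qed

lemma hpow_Zc: "homog k f \<in> Zc A k \<Longrightarrow> hpow k f a \<in> Zc A (k * a)"
proof (induction a)
  case 0
  then show ?case using unit0_Zc[OF gens_carrier(3)] hpow_0 by simp
next
  case (Suc a)
  have "hpow k f (Suc a) \<in> Zc A (k + k * a)"
    unfolding hpow_Suc by (rule Zc_hcup[OF gens_carrier(3) Suc.prems Suc.IH[OF Suc.prems]])
  then show ?case by simp
qed

definition hmon :: "('a list \<Rightarrow> int) \<Rightarrow> ('a list \<Rightarrow> int) \<Rightarrow> nat \<Rightarrow> nat \<Rightarrow> 'a list \<Rightarrow> int" where
  "hmon x y a b = hcup (2 * a) (hpow 2 x a) (hpow 4 y b)"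

lemma hmon_Suc: "hmon x y a (Suc b) = hcup (2 * a + 4 * b) (hmon x y a b) (homog 4 y)"
  unfolding hmon_def hpow_Suc_right[of 4] hcup_assoc ..

lemma hmon_mon:
  assumes x: "homog 2 x = xh" and e: "e = 0 \<or> e = 1"
  shows "hmon x y e b = mon (homog 4 y) e b"
proof (induction b)
  case 0
  have "hmon x y e 0 = hpow 2 x e" unfolding hmon_def hpow_0 by (rule hcup_unit0) simp
  also have "\<dots> = mon (homog 4 y) e 0"
  proof (cases "e = 0")
    case True
    then show ?thesis using hpow_0 by simp
  next
    case False
    then have "e = Suc 0" using e by simp
    then show ?thesis using hpow_Suc[of 2 0 x] hpow_0[of 2 x] hcup_unit0[OF homog_E, of 2 x] x by simp
  qed
  finally show ?case .
next
  case (Suc b)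
  then show ?case by (simp add: hmon_Suc)
qed

text \<open>In x^(c+2) y^b = x^c (x^2) y^b the square stands next to y^b, so replacing it by 8 y
  gives 8 x^c y^(b+1) with no factor moved past another.\<close>

lemma hmon_normal:
  assumes x: "homog 2 x = xh" and y: "is_gen4 (homog 4 y)"
  shows "hmon x y a b - sc (8 ^ (a div 2)) (mon (homog 4 y) (a mod 2) (b + a div 2)) \<in> Bd A (2 * a + 4 * b)"
proof (induction a arbitrary: b rule: less_induct)
  case (less a)
  show ?case
  proof (cases "a < 2")
    case True
    then have "a mod 2 = a" "a div 2 = 0" "a = 0 \<or> a = 1" by auto
    then show ?thesis using hmon_mon[OF x] by (simp add: sc_simps)
  next
    case False
    define c where "c = a - 2"
    have a: "a = Suc (Suc c)" using False c_def by simp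
    let ?y = "homog 4 y" and ?xc = "hpow 2 x c" and ?yb = "hpow 4 y b"
    have yZ: "?y \<in> Zc A 4" "sc 8 ?y - x2 \<in> Bd A 4" using y by (auto simp: is_gen4_def)
    have xZ: "homog 2 x \<in> Zc A 2" using x xh_Zc by simp
    have "hmon x y a b = hcup (2 * c) ?xc (hcup 4 x2 ?yb)"
    proof -
      have "hmon x y a b = hcup (2 * c + 2 + 2) (hcup (2 * c + 2) (hcup (2 * c) ?xc xh) xh) ?yb"
        unfolding hmon_def a hpow_Suc_right[of 2] x by (simp add: algebra_simps)
      also have "\<dots> = hcup (2 * c) ?xc (hcup (2 + 2) x2 ?yb)"
        by (simp only: hcup_assoc[of "2 * c" 2] hcup_assoc[of "2 * c" "2 + 2"] add.assoc[of "2 * c" 2 2])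
      finally show ?thesis by simp
    qed
    moreover have "hmon x y c (Suc b) = hcup (2 * c) ?xc (hcup 4 ?y ?yb)"
      unfolding hmon_def hpow_Suc ..
    ultimately have eq: "sc 8 (hmon x y c (Suc b)) - hmon x y a b = hcup (2 * c) ?xc (hcup 4 (sc 8 ?y - x2) ?yb)"
      by (simp add: hcup_simps)
    have "hcup 4 (sc 8 ?y - x2) ?yb \<in> Bd A (4 + 4 * b)"
      by (rule Bd_hcup_left[OF gens_carrier(3) yZ(2) hpow_Zc[OF yZ(1)]])
    then have "hcup (2 * c) ?xc (hcup 4 (sc 8 ?y - x2) ?yb) \<in> Bd A (2 * c + (4 + 4 * b))"
      by (rule Bd_hcup_right[OF gens_carrier(3) hpow_Zc[OF xZ]])
    moreover have "2 * c + (4 + 4 * b) = 2 * a + 4 * b" by (simp add: a)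
    ultimately have 1: "sc 8 (hmon x y c (Suc b)) - hmon x y a b \<in> Bd A (2 * a + 4 * b)"
      unfolding eq by (simp only:)
    let ?m = "mon ?y (a mod 2) (b + a div 2)"
    have m: "c mod 2 = a mod 2" "Suc b + c div 2 = b + a div 2" "8 * 8 ^ (c div 2) = (8::int) ^ (a div 2)"
      "2 * c + 4 * Suc b = 2 * a + 4 * b"
      by (simp_all add: a)
    have "hmon x y c (Suc b) - sc (8 ^ (c div 2)) (mon ?y (c mod 2) (Suc b + c div 2)) \<in> Bd A (2 * c + 4 * Suc b)"
      by (rule less) (simp add: a)
    then have "hmon x y c (Suc b) - sc (8 ^ (c div 2)) ?m \<in> Bd A (2 * a + 4 * b)"
      unfolding m .
    then have "sc 8 (hmon x y c (Suc b) - sc (8 ^ (c div 2)) ?m) - (sc 8 (hmon x y c (Suc b)) - hmon x y a b)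
      \<in> Bd A (2 * a + 4 * b)"
      by (intro Bd_diff[OF _ 1] Bd_sc)
    moreover have "sc 8 (hmon x y c (Suc b) - sc (8 ^ (c div 2)) ?m) - (sc 8 (hmon x y c (Suc b)) - hmon x y a b)
      = hmon x y a b - sc (8 ^ (a div 2)) ?m"
      by (simp add: sc_simps(2,3) m(3))
    ultimately show "hmon x y a b - sc (8 ^ (a div 2)) ?m \<in> Bd A (2 * a + 4 * b)" by metis
  qed
qed

lemma eval_deg_homog:
  "homog n (eval_deg n x y P) = (\<Sum>m \<in> {m \<in> Poly_Mapping.keys P. wdeg m = n}.
     sc (Poly_Mapping.lookup P m) (hmon x y (fst m) (snd m)))"
proof -
  have "homog n (cup (2 * fst m) (4 * snd m) (cup_power 2 x (fst m)) (cup_power 4 y (snd m))) = hmon x y (fst m) (snd m)"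
    if "wdeg m = n" for m
    using that homog_hcup[of "2 * fst m" "4 * snd m"] by (auto simp: wdeg_def hmon_def)
  then show ?thesis unfolding eval_deg_def homog_lincomb by (intro sum.cong) auto
qed

lemma eval_deg_cochains:
  assumes "x \<in> cochains G 2" "y \<in> cochains G 4"
  shows "eval_deg n x y P \<in> cochains G n"
proof -
  have *: "cup (2 * a) (4 * b) (cup_power 2 x a) (cup_power 4 y b) gs = 0"
    if "\<not> (length gs = n \<and> set gs \<subseteq> carrier G)" "wdeg (a, b) = n" for a b gs
    using cochains_outside[OF cup_cochains[OF cup_power_cochains[OF assms(1)] cup_power_cochains[OF assms(2)]], of gs a b] that
    by (simp add: wdeg_def)
  have "eval_deg n x y P gs = 0" if "\<not> (length gs = n \<and> set gs \<subseteq> carrier G)" for gs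
    unfolding eval_deg_def by (rule sum.neutral) (use *[OF that] in auto)
  then show ?thesis unfolding cochains_def by blast
qed

lemma nf_coeff_keys:
  "nf_coeff n P = (\<Sum>m \<in> {m \<in> Poly_Mapping.keys P. wdeg m = n}. Poly_Mapping.lookup P m * 8 ^ (fst m div 2))"
  unfolding nf_coeff_def by (rule sum.mono_neutral_right) (auto simp: finite_wdeg in_keys_iff)

lemma Bd_cong:
  assumes "F - K \<in> Bd H n" shows "F \<in> Bd H n \<longleftrightarrow> K \<in> Bd H n"
proof
  assume "F \<in> Bd H n"
  then have "F - (F - K) \<in> Bd H n" using assms by (rule Bd_diff)
  then show "K \<in> Bd H n" by simp
next
  assume "K \<in> Bd H n"
  then have "(F - K) + K \<in> Bd H n" using assms by (intro Bd_add)
  then show "F \<in> Bd H n" by simp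
qed

lemma eval_deg_normal:
  assumes x: "homog 2 x = xh" and y: "is_gen4 (homog 4 y)"
  shows "homog n (eval_deg n x y P) - sc (nf_coeff n P) (mon (homog 4 y) (n div 2 mod 2) (n div 4)) \<in> Bd A n"
proof -
  let ?K = "{m \<in> Poly_Mapping.keys P. wdeg m = n}" and ?m = "mon (homog 4 y) (n div 2 mod 2) (n div 4)"
  have *: "sc (Poly_Mapping.lookup P m) (hmon x y (fst m) (snd m)) - sc (Poly_Mapping.lookup P m * 8 ^ (fst m div 2)) ?m \<in> Bd A n"
    if "m \<in> ?K" for m
  proof -
    obtain a b where m: "m = (a, b)" by (cases m)
    then have w: "wdeg (a, b) = n" using that by simp
    then have "hmon x y a b - sc (8 ^ (a div 2)) ?m \<in> Bd A n"
      using hmon_normal[OF x y, of a b] wdeg_normal[OF w] by (simp add: wdeg_def)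
    then show ?thesis using Bd_sc[of "hmon x y a b - sc (8 ^ (a div 2)) ?m" A n "Poly_Mapping.lookup P m"] m
      by (simp add: sc_simps(2,3))
  qed
  have sum_Bd: "sum F I \<in> Bd A n" if "\<And>i. i \<in> I \<Longrightarrow> F i \<in> Bd A n" "finite I" 
    for F :: "nat \<times> nat \<Rightarrow> 'a list \<Rightarrow> int" and I
    using that(2,1) by (induction I rule: finite_induct) (simp_all add: Bd_add)
  have "(\<Sum>m\<in>?K. sc (Poly_Mapping.lookup P m) (hmon x y (fst m) (snd m)) - sc (Poly_Mapping.lookup P m * 8 ^ (fst m div 2)) ?m) \<in> Bd A n"
    by (rule sum_Bd[OF *]) auto
  moreover have "sc (sum c I) F = (\<Sum>i\<in>I. sc (c i) F)" for c :: "nat \<times> nat \<Rightarrow> int" and I and F :: "'a list \<Rightarrow> int"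
    by (induction I rule: infinite_finite_induct) (simp_all add: sc_simps(5,7))
  ultimately show ?thesis by (simp add: eval_deg_homog nf_coeff_keys sum_subtractf)
qed

lemma cohomology_ring:
  "\<exists>x y. x \<in> cocycles G 2 \<and> y \<in> cocycles G 4 \<and>
     (\<forall>n. \<forall>f \<in> cocycles G n. \<exists>P. (\<lambda>gs. f gs - eval_deg n x y P gs) \<in> coboundaries G n) \<and>
     (\<forall>n P. homogeneous n P \<longrightarrow> (eval_deg n x y P \<in> coboundaries G n \<longleftrightarrow> in_ideal s P))"
proof -
  obtain yh where yh: "is_gen4 yh" using gen4_ex by blast
  have yhZ: "yh \<in> Zc A 4" using yh by (simp add: is_gen4_def)
  obtain x where x: "x \<in> cochains G 2" "homog 2 x = xh" using homog_surj_A[OF Zc_EI[OF xh_Zc]] by blast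
  obtain y where y: "y \<in> cochains G 4" "homog 4 y = yh" using homog_surj_A[OF Zc_EI[OF yhZ]] by blast
  have gy: "is_gen4 (homog 4 y)" using yh y by simp
  note normal = eval_deg_normal[OF x(2) gy]
  have ev: "eval_deg n x y P \<in> cochains G n" for n P by (rule eval_deg_cochains[OF x(1) y(1)])
  have e1: "n div 2 mod 2 \<le> 1" for n :: nat by simp
  have deg: "2 * (n div 2 mod 2) + 4 * (n div 4) = n" if "even n" for n :: nat
    using that by (metis (no_types, lifting) div_mult2_eq evenE mult_2 mod_mult_div_eq nonzero_mult_div_cancel_left numeral_Bit0_eq_double zero_neq_numeral distrib_left mult.assoc)
  have 1: "\<exists>P. (\<lambda>gs. f gs - eval_deg n x y P gs) \<in> coboundaries G n" if f: "f \<in> cocycles G n" for n f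
  proof -
    have fc: "f \<in> cochains G n" using f by (simp add: cocycles_def)
    then have fZ: "homog n f \<in> Zc A n" using cocycles_iff f by simp
    have *: "?thesis" if "homog n f - homog n (eval_deg n x y P) \<in> Bd A n" for P
      using that coboundaries_iff[OF cochains_diff[OF fc ev]] by (auto simp: homog_diff)
    show ?thesis
    proof (cases "even n")
      case True
      let ?e = "n div 2 mod 2" and ?b = "n div 4"
      obtain c where c: "homog n f - sc c (mon (homog 4 y) ?e ?b) \<in> Bd A n"
        using mon_generates[OF gy e1, of "homog n f" n ?b] fZ unfolding deg[OF True] by blast
      \<comment> \<open>A polynomial with only the reduced monomial of degree n, whose coefficient
        is then its \<open>nf_coeff\<close>.\<close>
      define P where "P = Poly_Mapping.single (?e, ?b) c"
      have "wdeg (?e, ?b) = n" using deg[OF True] by (simp add: wdeg_def)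
      then have "nf_coeff n P = c" by (simp add: P_def nf_coeff_single)
      then have "(homog n f - sc c (mon (homog 4 y) ?e ?b)) - (homog n (eval_deg n x y P) - sc c (mon (homog 4 y) ?e ?b)) \<in> Bd A n"
        using normal[of n P] by (intro Bd_diff[OF c]) (simp only:)
      then show ?thesis by (intro *[of P]) simp
    next
      case False
      then obtain k where k: "n = 2 * k + 1" by (rule oddE)
      have "homog n f \<in> Bd A n" using odd_degree[OF gy, of "homog n f" k] fZ k by simp
      moreover have "homog n (eval_deg n x y 0) = 0" by (simp add: eval_deg_homog)
      ultimately show ?thesis by (intro *[of 0]) simp
    qed
  qed
  have 2: "eval_deg n x y P \<in> coboundaries G n \<longleftrightarrow> in_ideal s P" if P: "homogeneous n P" for n P
  proof (cases "even n")
    case True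
    let ?e = "n div 2 mod 2" and ?b = "n div 4"
    have "eval_deg n x y P \<in> coboundaries G n \<longleftrightarrow> homog n (eval_deg n x y P) \<in> Bd A n"
      by (rule coboundaries_iff[OF ev])
    also have "\<dots> \<longleftrightarrow> sc (nf_coeff n P) (mon (homog 4 y) ?e ?b) \<in> Bd A n"
      by (rule Bd_cong[OF normal])
    also have "\<dots> \<longleftrightarrow> (if ?e = 1 then int M dvd nf_coeff n P else if ?b = 0 then nf_coeff n P = 0 else 8 * int M dvd nf_coeff n P)"
      using mon_order[OF gy e1, of "nf_coeff n P" n ?b] unfolding deg[OF True] .
    also have "\<dots> \<longleftrightarrow> nf_zero s n (nf_coeff n P)"
    proof -
      \<comment> \<open>For even n the exponent of X is 1 exactly when n is 2 modulo 4, which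
        matches the cases of \<open>mon_order\<close> with those of \<open>nf_zero\<close>.\<close>
      have "?e = 1 \<longleftrightarrow> \<not> 4 dvd n" using True by (auto elim!: evenE simp: mod_2_eq_odd)
      moreover have "?e \<noteq> 1 \<Longrightarrow> ?b = 0 \<longleftrightarrow> n = 0" using deg[OF True] by auto
      ultimately show ?thesis by (auto simp: nf_zero_def of_nat_power)
    qed
    also have "\<dots> \<longleftrightarrow> in_ideal s P"
      using in_ideal_imp_nf_zero nf_zero_imp_in_ideal[OF P True] by blast
    finally show ?thesis .
  next
    case False
    have "Poly_Mapping.keys P = {}"
    proof (rule equals0I)
      fix m assume "m \<in> Poly_Mapping.keys P"
      then have "n = 2 * (fst m + 2 * snd m)" using P by (auto simp: homogeneous_def wdeg_def)
      then show False using False by simp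
    qed
    then have P0: "P = 0" by simp
    have "homog n (eval_deg n x y P) = 0" by (simp add: eval_deg_homog P0)
    then have "homog n (eval_deg n x y P) \<in> Bd A n" by simp
    then show ?thesis using coboundaries_iff[OF ev] in_ideal_zero P0 by blast
  qed
  have "x \<in> cocycles G 2" "y \<in> cocycles G 4" using cocycles_iff x y xh_Zc yhZ by simp_all
  then show ?thesis using 1 2 by blast
qed

end

theorem theorem10p8:
  fixes G :: "('a, 'b) monoid_scheme" and p q z :: 'a and s :: nat
  assumes "s \<ge> 2"
    and "group G"
    and "p \<in> carrier G" and "q \<in> carrier G" and "z \<in> carrier G"
    and "p [^]\<^bsub>G\<^esub> (2::nat) = (p \<otimes>\<^bsub>G\<^esub> q) [^]\<^bsub>G\<^esub> (2::nat)"
    and "(p \<otimes>\<^bsub>G\<^esub> q) [^]\<^bsub>G\<^esub> (2::nat) = q [^]\<^bsub>G\<^esub> (2::nat)"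
    and "z \<otimes>\<^bsub>G\<^esub> p \<otimes>\<^bsub>G\<^esub> inv\<^bsub>G\<^esub> z = q"
    and "z \<otimes>\<^bsub>G\<^esub> q \<otimes>\<^bsub>G\<^esub> inv\<^bsub>G\<^esub> z = p \<otimes>\<^bsub>G\<^esub> q"
    and "z [^]\<^bsub>G\<^esub> ((3::nat) ^ s) = \<one>\<^bsub>G\<^esub>"
    and "carrier G = generate G {p, q, z}"
    and "order G = 8 * 3 ^ s"
  shows "\<exists>x y. x \<in> cocycles G 2 \<and> y \<in> cocycles G 4 \<and>
           (\<forall>n. \<forall>f \<in> cocycles G n. \<exists>P. (\<lambda>gs. f gs - eval_deg n x y P gs) \<in> coboundaries G n) \<and>
           (\<forall>n P. homogeneous n P \<longrightarrow> (eval_deg n x y P \<in> coboundaries G n \<longleftrightarrow> in_ideal s P))"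
proof -
  interpret group G by fact
  note c [simp] = assms(3-5)
  have pq2: "(p \<otimes>\<^bsub>G\<^esub> q) \<otimes>\<^bsub>G\<^esub> (p \<otimes>\<^bsub>G\<^esub> q) = q \<otimes>\<^bsub>G\<^esub> q"
    using assms(7) by (simp add: numeral_2_eq_2)
  have pp: "p \<otimes>\<^bsub>G\<^esub> p = q \<otimes>\<^bsub>G\<^esub> q"
    using assms(6,7) by (simp add: numeral_2_eq_2)
  have "(p \<otimes>\<^bsub>G\<^esub> (q \<otimes>\<^bsub>G\<^esub> p)) \<otimes>\<^bsub>G\<^esub> q = q \<otimes>\<^bsub>G\<^esub> q" using pq2 by (simp add: m_assoc)
  \<comment> \<open>Cancelling q on the right of (pq)^2 = q^2 gives the palindromic form of the
    relation.\<close>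
  then have pqp: "p \<otimes>\<^bsub>G\<^esub> (q \<otimes>\<^bsub>G\<^esub> p) = q" by simp
  have zp: "z \<otimes>\<^bsub>G\<^esub> p = q \<otimes>\<^bsub>G\<^esub> z" using assms(8) by (metis c inv_solve_right m_closed)
  have zq: "z \<otimes>\<^bsub>G\<^esub> q = p \<otimes>\<^bsub>G\<^esub> (q \<otimes>\<^bsub>G\<^esub> z)" using assms(9) by (metis c inv_solve_right m_closed m_assoc)
  interpret q8_cyclic G p q z s
    by unfold_locales (use assms pp pqp zp zq in auto)
  show ?thesis by (rule cohomology_ring)
qed

end
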